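(* Let $a<b$, $T>0$, $0<\alpha<1$, $\rho>0$, $\gamma\ge0$, $\delta\in\mathbb{R}$ with $\delta\ne\frac12$, and an integer $k\ge0$ be given. Let $u$ be the exact solution, periodic in $x$, of $${}_0^{C}D_t^{\alpha,\gamma}u(x,t)+\rho u(x,t)-\frac{\partial^2u(x,t)}{\partial x^2}=f(x,t),\quad (x,t)\in(a,b)\times(0,T],\qquad u(x,0)=u_0(x),$$ where $f$ and $u_0$ are given smooth functions, and suppose that $u$ is sufficiently smooth with bounded derivatives. Let $u_h^n$ be the numerical solution of the fully discrete local discontinuous Galerkin (LDG) scheme (S) described in the context. Then $$\|u(\cdot,t_n)-u_h^n\|\le C\left(h^{k+1}+\tau^{2-\alpha}\right),\qquad n=1,\dots,M,$$ where $\|\cdot\|$ is the $L^2(a,b)$ norm and $C$ is a constant depending on $u,T,\alpha$ and independent of $h$, $\tau$ and $n$ (the data $a,b,\rho,\gamma,\delta,k$ and the mesh quasi-uniformity constant $\kappa$ being fixed).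
   Context: **Tempered fractional derivative.** Let $\Omega=(a,b)$. For $0<\alpha<1$, $${}_0^{C}D_t^{\alpha,\gamma}u(x,t)=\frac{e^{-\gamma t}}{\Gamma(1-\alpha)}\int_0^t\frac{\partial}{\partial s}\left[e^{\gamma s}u(x,s)\right]\frac{ds}{(t-s)^\alpha}.$$ The equation is rewritten as the first-order system $p=u_x$, ${}_0^{C}D_t^{\alpha,\gamma}u+\rho u-p_x=f$. **Time grid.** $M$ is a positive integer, $\tau=T/M$, $t_n=n\tau$ for $0\le n\le M$, $b_i=(i+1)^{1-\alpha}-i^{1-\alpha}$ for $i\ge 0$, and $f^n=f(\cdot,t_n)$. **Space grid.** $a=x_{1/2}<x_{3/2}<\cdots<x_{N+1/2}=b$, $I_j=[x_{j-1/2},x_{j+1/2}]$, $h_j=x_{j+1/2}-x_{j-1/2}$, $h=\max_{1\le j\le N} h_j$. The mesh is quasi-uniform: there is a constant $\kappa>0$ independent of $h$ with $h_j\ge\kappa h$ for all $j$. **Finite element space.** $V_h^k$ is the space of functions $v$ whose restriction to each cell $I_j$, $j=1,\dots,N$, is a polynomial of degree at most $k$, with no continuity required across cell interfaces. The notation $v_x$ is the cellwise derivative. The values $v^+_{j+1/2}$ and $v^-_{j+1/2}$ are the limits of $v$ at $x_{j+1/2}$ from the right cell $I_{j+1}$ and the left cell $I_j$, respectively. Boundary conditions are periodic: $v^-_{1/2}:=v^-_{N+1/2}$ and $v^+_{N+1/2}:=v^+_{1/2}$. The weighted average is $$v^{(\delta)}_{j+1/2}=\delta v^+_{j+1/2}+(1-\delta)v^-_{j+1/2}.$$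 **Generalized Gauss–Radau projection.** For $\delta\neq\frac12$ and a periodic function $\omega$ on $[a,b]$, $\mathcal{P}_\delta\omega$ is the unique element of $V_h^k$ such that, with $\omega^e=\mathcal{P}_\delta\omega-\omega$, for every $j=1,\dots,N$: $\int_{I_j}\omega^e v\,dx=0$ for all polynomials $v$ of degree at most $k-1$ on $I_j$ (no condition when $k=0$), and $(\omega^e)^{(\delta)}_{j+\frac12}=0$. **Scheme (S).** Set $u_h^0=\mathcal{P}_\delta u_0$. For each $n=1,\dots,M$ find $u_h^n,p_h^n\in V_h^k$ such that for all $v,w\in V_h^k$ $$\left(\rho+\frac{\tau^{-\alpha}}{\Gamma(2-\alpha)}\right)\int_\Omega u_h^n v\,dx+\int_\Omega p_h^n v_x\,dx-\sum_{j=1}^N\left((\widehat{p_h^n}v^-)_{j+\frac12}-(\widehat{p_h^n}v^+)_{j-\frac12}\right)$$ $$=\frac{\tau^{-\alpha}}{\Gamma(2-\alpha)}\left(\sum_{i=1}^{n-1}(b_{i-1}-b_i)e^{-i\gamma\tau}\int_\Omega u_h^{n-i}v\,dx+b_{n-1}e^{-n\gamma\tau}\int_\Omega u_h^0 v\,dx\right)+\int_\Omega f^n v\,dx,$$ $$\int_\Omega p_h^n w\,dx+\int_\Omega u_h^n w_x\,dx-\sum_{j=1}^N\left((\widehat{u_h^n}w^-)_{j+\frac12}-(\widehat{u_h^n}w^+)_{j-\frac12}\right)=0,$$ with the generalized alternating numerical fluxes, at every interface, $$\widehat{u_h^n}=(u_h^n)^{(\delta)},\qquad \widehat{p_h^n}=(p_h^n)^{(1-\delta)}.$$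 *)

theory Defs
  imports "HOL-Analysis.Analysis" "HOL-Computational_Algebra.Polynomial"
begin

section \<open>Regularity of functions of \<open>(x, t)\<close>\<close>

text \<open>All iterated partial derivatives of \<open>g\<close> of total order at most \<open>m\<close>, in any order of
  differentiation and with \<open>g\<close> itself included, exist on \<open>X \<times> J\<close> and satisfy \<open>Q\<close>. Derivatives are
  taken within \<open>X\<close> and \<open>J\<close>, hence are one-sided at end points belonging to these sets.\<close>

primrec partials_satisfy ::
  "nat \<Rightarrow> (((real \<times> real) \<Rightarrow> real) \<Rightarrow> bool) \<Rightarrow> real set \<Rightarrow> real set \<Rightarrow> (real \<Rightarrow> real \<Rightarrow> real) \<Rightarrow> bool"
where
  "partials_satisfy 0 Q X J g \<longleftrightarrow> Q (\<lambda>(x, t). g x t)"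
| "partials_satisfy (Suc m) Q X J g \<longleftrightarrow>
     Q (\<lambda>(x, t). g x t) \<and>
     (\<exists>gx gt.
        (\<forall>x\<in>X. \<forall>t\<in>J.
           ((\<lambda>y. g y t) has_real_derivative gx x t) (at x within X) \<and>
           ((\<lambda>s. g x s) has_real_derivative gt x t) (at t within J)) \<and>
        partials_satisfy m Q X J gx \<and> partials_satisfy m Q X J gt)"

definition Ck_on :: "nat \<Rightarrow> real set \<Rightarrow> real set \<Rightarrow> (real \<Rightarrow> real \<Rightarrow> real) \<Rightarrow> bool" where
  "Ck_on m X J g \<longleftrightarrow> partials_satisfy m (continuous_on (X \<times> J)) X J g"

definition Ck_bounded_on :: "nat \<Rightarrow> real set \<Rightarrow> real set \<Rightarrow> (real \<Rightarrow> real \<Rightarrow> real) \<Rightarrow> bool" where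
  "Ck_bounded_on m X J g \<longleftrightarrow>
     partials_satisfy m (\<lambda>F. continuous_on (X \<times> J) F \<and> bounded (F ` (X \<times> J))) X J g"

definition smooth_on :: "real set \<Rightarrow> real set \<Rightarrow> (real \<Rightarrow> real \<Rightarrow> real) \<Rightarrow> bool" where
  "smooth_on X J g \<longleftrightarrow> (\<forall>m. Ck_on m X J g)"


section \<open>The tempered fractional problem\<close>

text \<open>For a function given on \<open>[0, T]\<close> and \<open>0 < t \<le> T\<close>, only derivatives at interior points
  of \<open>[0, t]\<close> matter, since the value of the integrand at \<open>s = 0\<close> and \<open>s = t\<close> is irrelevant.\<close>

definition tempered_caputo :: "real \<Rightarrow> real \<Rightarrow> (real \<Rightarrow> real) \<Rightarrow> real \<Rightarrow> real" where
  "tempered_caputo \<alpha> \<gamma> v t =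
     exp (- \<gamma> * t) / Gamma (1 - \<alpha>) *
     integral {0..t} (\<lambda>s. deriv (\<lambda>r. exp (\<gamma> * r) * v r) s / (t - s) powr \<alpha>)"

text \<open>A periodic function on \<open>[a, b]\<close> is represented by its periodic extension to the real line.\<close>

definition exact_solution ::
  "real \<Rightarrow> real \<Rightarrow> real \<Rightarrow> real \<Rightarrow> real \<Rightarrow> real \<Rightarrow>
   (real \<Rightarrow> real \<Rightarrow> real) \<Rightarrow> (real \<Rightarrow> real) \<Rightarrow> (real \<Rightarrow> real \<Rightarrow> real) \<Rightarrow> bool"
where
  "exact_solution a b T \<alpha> \<rho> \<gamma> f u0 u \<longleftrightarrow>
     (\<forall>x. \<forall>t\<in>{0..T}. u (x + (b - a)) t = u x t) \<and>
     (\<forall>x\<in>{a<..<b}. \<forall>t\<in>{0<..T}.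
        tempered_caputo \<alpha> \<gamma> (u x) t + \<rho> * u x t - (deriv ^^ 2) (\<lambda>y. u y t) x = f x t) \<and>
     (\<forall>x. u x 0 = u0 x)"


section \<open>Mesh and discontinuous piecewise polynomials\<close>

text \<open>\<open>xs j\<close> stands for the interface \<open>x\<^bsub>j+1/2\<^esub>\<close>, \<open>0 \<le> j \<le> N\<close>, so that the cell \<open>I\<^sub>j\<close>, \<open>1 \<le> j \<le> N\<close>,
  is \<open>[xs (j - 1), xs j]\<close>. Interface \<open>0\<close> and interface \<open>N\<close> are identified by periodicity.\<close>

definition mesh :: "real \<Rightarrow> real \<Rightarrow> nat \<Rightarrow> (nat \<Rightarrow> real) \<Rightarrow> bool" where
  "mesh a b N xs \<longleftrightarrow> N \<ge> 1 \<and> xs 0 = a \<and> xs N = b \<and> (\<forall>j\<in>{1..N}. xs (j - 1) < xs j)"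

definition mesh_size :: "nat \<Rightarrow> (nat \<Rightarrow> real) \<Rightarrow> real" where
  "mesh_size N xs = Max ((\<lambda>j. xs j - xs (j - 1)) ` {1..N})"

definition quasi_uniform :: "real \<Rightarrow> nat \<Rightarrow> (nat \<Rightarrow> real) \<Rightarrow> bool" where
  "quasi_uniform \<kappa> N xs \<longleftrightarrow> (\<forall>j\<in>{1..N}. xs j - xs (j - 1) \<ge> \<kappa> * mesh_size N xs)"

text \<open>Elements of the space are functions on the real line whose values at the interfaces and
  outside \<open>[a, b]\<close> are arbitrary; nothing below depends on these values.\<close>

definition dg_space :: "nat \<Rightarrow> nat \<Rightarrow> (nat \<Rightarrow> real) \<Rightarrow> (real \<Rightarrow> real) set" where
  "dg_space k N xs =
     {v. \<forall>j\<in>{1..N}. \<exists>q. degree q \<le> k \<and> (\<forall>x\<in>{xs (j - 1)<..<xs j}. v x = poly q x)}"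

definition trace_plus :: "nat \<Rightarrow> (nat \<Rightarrow> real) \<Rightarrow> (real \<Rightarrow> real) \<Rightarrow> nat \<Rightarrow> real" where
  "trace_plus N xs v j = (if j = N then Lim (at_right (xs 0)) v else Lim (at_right (xs j)) v)"

definition trace_minus :: "nat \<Rightarrow> (nat \<Rightarrow> real) \<Rightarrow> (real \<Rightarrow> real) \<Rightarrow> nat \<Rightarrow> real" where
  "trace_minus N xs v j = (if j = 0 then Lim (at_left (xs N)) v else Lim (at_left (xs j)) v)"

definition weighted_avg :: "real \<Rightarrow> nat \<Rightarrow> (nat \<Rightarrow> real) \<Rightarrow> (real \<Rightarrow> real) \<Rightarrow> nat \<Rightarrow> real" where
  "weighted_avg \<delta> N xs v j = \<delta> * trace_plus N xs v j + (1 - \<delta>) * trace_minus N xs v j"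

text \<open>\<open>gauss_radau \<delta> k N xs \<omega> v\<close> says that \<open>v\<close> is the projection of \<open>\<omega>\<close>. A relation is used because
  the projection is unique only up to the irrelevant values at the interfaces and outside \<open>[a, b]\<close>.
  The condition \<open>degree q < k\<close> means degree at most \<open>k - 1\<close>, and is void for \<open>k = 0\<close>.\<close>

definition gauss_radau ::
  "real \<Rightarrow> nat \<Rightarrow> nat \<Rightarrow> (nat \<Rightarrow> real) \<Rightarrow> (real \<Rightarrow> real) \<Rightarrow> (real \<Rightarrow> real) \<Rightarrow> bool"
where
  "gauss_radau \<delta> k N xs \<omega> v \<longleftrightarrow>
     v \<in> dg_space k N xs \<and>
     (\<forall>j\<in>{1..N}.
        (\<forall>q. degree q < k \<longrightarrow> integral {xs (j - 1)..xs j} (\<lambda>x. (v x - \<omega> x) * poly q x) = 0) \<and>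
        weighted_avg \<delta> N xs (\<lambda>x. v x - \<omega> x) j = 0)"


section \<open>The fully discrete scheme\<close>

definition l1_weight :: "real \<Rightarrow> nat \<Rightarrow> real" where
  "l1_weight \<alpha> i = (real i + 1) powr (1 - \<alpha>) - real i powr (1 - \<alpha>)"

text \<open>\<open>\<Sum>\<^sub>j ((g v\<^sup>-)\<^bsub>j+1/2\<^esub> - (g v\<^sup>+)\<^bsub>j-1/2\<^esub>)\<close> for interface values \<open>g\<close> of a numerical flux.\<close>

definition flux_sum :: "nat \<Rightarrow> (nat \<Rightarrow> real) \<Rightarrow> (nat \<Rightarrow> real) \<Rightarrow> (real \<Rightarrow> real) \<Rightarrow> real" where
  "flux_sum N xs g v =
     (\<Sum>j=1..N. g j * trace_minus N xs v j - g (j - 1) * trace_plus N xs v (j - 1))"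

text \<open>In the integrals containing \<open>deriv v\<close> or \<open>deriv w\<close>, the finitely many interfaces are
  negligible, so \<open>deriv\<close> there is the cellwise derivative.\<close>

definition ldg_scheme ::
  "real \<Rightarrow> real \<Rightarrow> real \<Rightarrow> real \<Rightarrow> real \<Rightarrow> real \<Rightarrow> real \<Rightarrow> nat \<Rightarrow>
   (real \<Rightarrow> real \<Rightarrow> real) \<Rightarrow> (real \<Rightarrow> real) \<Rightarrow> nat \<Rightarrow> nat \<Rightarrow> (nat \<Rightarrow> real) \<Rightarrow>
   (nat \<Rightarrow> real \<Rightarrow> real) \<Rightarrow> (nat \<Rightarrow> real \<Rightarrow> real) \<Rightarrow> bool"
where
  "ldg_scheme a b T \<alpha> \<rho> \<gamma> \<delta> k f u0 M N xs uh ph \<longleftrightarrow>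
     (let \<tau> = T / real M;
          \<beta> = \<tau> powr (- \<alpha>) / Gamma (2 - \<alpha>);
          V = dg_space k N xs
      in gauss_radau \<delta> k N xs u0 (uh 0) \<and>
         (\<forall>n\<in>{1..M}.
            uh n \<in> V \<and> ph n \<in> V \<and>
            (\<forall>v\<in>V.
               (\<rho> + \<beta>) * integral {a..b} (\<lambda>x. uh n x * v x)
               + integral {a..b} (\<lambda>x. ph n x * deriv v x)
               - flux_sum N xs (weighted_avg (1 - \<delta>) N xs (ph n)) v
               = \<beta> * ((\<Sum>i=1..n - 1. (l1_weight \<alpha> (i - 1) - l1_weight \<alpha> i)
                             * exp (- real i * \<gamma> * \<tau>) * integral {a..b} (\<lambda>x. uh (n - i) x * v x))
                       + l1_weight \<alpha> (n - 1) * exp (- real n * \<gamma> * \<tau>)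
                             * integral {a..b} (\<lambda>x. uh 0 x * v x))
                 + integral {a..b} (\<lambda>x. f x (real n * \<tau>) * v x)) \<and>
            (\<forall>w\<in>V.
               integral {a..b} (\<lambda>x. ph n x * w x)
               + integral {a..b} (\<lambda>x. uh n x * deriv w x)
               - flux_sum N xs (weighted_avg \<delta> N xs (uh n)) w = 0)))"

definition L2_norm_on :: "real \<Rightarrow> real \<Rightarrow> (real \<Rightarrow> real) \<Rightarrow> real" where
  "L2_norm_on a b g = sqrt (integral {a..b} (\<lambda>x. (g x)\<^sup>2))"

end

(* Let U^n and P^n be the projections of u(t_n) with weight delta and of u_x(t_n) with weight
   1 - delta. The projections are exact under the discrete derivative with the corresponding flux,
   and the two alternating fluxes cancel when the equations for xi = U - u_h and theta = P - p_h are
   tested with xi and theta. What remains is a right-hand side bounded pointwise by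
   h^(k+1) + tau^(2-alpha), made of the L1 truncation error and of projection errors. The history
   weights are nonnegative with sum at most 1, and rho > 0, so one bound for the L2 norm of xi^m
   propagates to all time levels without any Gronwall argument.

   The projection error is controlled cell by cell on the reference interval up to a multiple of the
   top Legendre polynomial; these multiples solve a cyclic bidiagonal system whose two coefficients
   have different absolute values because delta is not 1/2. *)
theory Submission
  imports Defs
begin


section \<open>Piecewise smooth functions on a mesh\<close>

text \<open>The obstacle is the factor \<open>\<beta>\<close>, of size \<tau> to the power
  -\<alpha>, in front of the discrete history: a direct bound of the L1 operator applied to the
  projection error would lose this power. Since the projection is linear, the tempered increment of
  the projection error over one time step is itself the projection error of a tempered increment of
  u. The x-derivative of order k+1 of that increment is bounded by a multiple of \<tau>, so its
  projection error is O(\<tau> h^(k+1)). Summation by parts rewrites the L1 operator through such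
  increments, and because the L1 weights sum to n^(1-\<alpha>), the powers of \<tau> and n combine
  to at most T^(1-\<alpha>). In the energy estimate \<open>\<beta>\<close> cancels, since the
  history consumes only half of the term it is compared with. The induction starts from zero: the
  projection at time 0 is chosen to be \<open>uh 0\<close>. The projection of u_x leaves a mismatch
  in the second equation; tested with theta, it is absorbed by the squared norm of theta.\<close>

definition cells :: "nat \<Rightarrow> (nat \<Rightarrow> real) \<Rightarrow> real set" where
  "cells N xs = (\<Union>j\<in>{1..N}. {xs (j - 1)<..<xs j})"

text \<open>A common class for smooth data, discrete functions, their cellwise derivatives and the
  residual of the scheme: it is closed under sums and products and implies integrability, whatever
  happens at the interfaces.\<close>

definition pwc :: "nat \<Rightarrow> (nat \<Rightarrow> real) \<Rightarrow> (real \<Rightarrow> real) \<Rightarrow> bool" where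
  "pwc N xs g \<longleftrightarrow> continuous_on (cells N xs) g \<and> bounded (g ` cells N xs)"

lemma cellsE:
  assumes "x \<in> cells N xs"
  obtains j where "j \<in> {1..N}" "xs (j - 1) < x" "x < xs j"
  using assms by (auto simp: cells_def)

lemma open_cells: "open (cells N xs)"
  by (auto simp: cells_def)

lemma mesh_mono_points:
  assumes "mesh a b N xs" "i \<le> j" "j \<le> N"
  shows "xs i \<le> xs j"
  using assms(2,3)
proof (induction j)
  case (Suc j)
  have "xs j < xs (Suc j)"
    using assms(1) Suc.prems unfolding mesh_def by (metis Suc_le_eq atLeastAtMost_iff diff_Suc_1 le_add1 plus_1_eq_Suc)
  with Suc show ?case by (cases "i = Suc j") auto
qed auto

lemma mesh_cell_less: "mesh a b N xs \<Longrightarrow> j \<in> {1..N} \<Longrightarrow> xs (j - 1) < xs j"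
  by (auto simp: mesh_def)

lemma mesh_le_size: "mesh a b N xs \<Longrightarrow> j \<in> {1..N} \<Longrightarrow> xs j - xs (j - 1) \<le> mesh_size N xs"
  unfolding mesh_size_def by (intro Max_ge) auto

lemma mesh_size_pos: "mesh a b N xs \<Longrightarrow> mesh_size N xs > 0"
  using mesh_le_size[of a b N xs 1] mesh_cell_less[of a b N xs 1] by (auto simp: mesh_def)

lemma mesh_cell_subset:
  assumes "mesh a b N xs" "j \<in> {1..N}"
  shows "{xs (j - 1)..xs j} \<subseteq> {a..b}"
proof -
  have "xs 0 \<le> xs (j - 1)" "xs j \<le> xs N"
    using assms(2) by (auto intro!: mesh_mono_points[OF assms(1)])
  then show ?thesis using assms(1) by (auto simp: mesh_def)
qed

lemma cells_subset:
  assumes "mesh a b N xs" shows "cells N xs \<subseteq> {a<..<b}"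
proof
  fix x assume "x \<in> cells N xs"
  then obtain j where j: "j \<in> {1..N}" "xs (j - 1) < x" "x < xs j" by (rule cellsE)
  have "xs 0 \<le> xs (j - 1)" "xs j \<le> xs N"
    using j(1) by (auto intro!: mesh_mono_points[OF assms(1)])
  with j show "x \<in> {a<..<b}" using assms(1) by (auto simp: mesh_def)
qed

text \<open>Stated without \<open>mesh\<close>, whose condition \<open>xs N = b\<close> would not
  survive the removal of the last cell in the induction.\<close>

lemma interval_subset_cells:
  "{xs 0..xs n} \<subseteq> cells n xs \<union> xs ` {0..n}"
proof (induction n)
  case (Suc n)
  have c: "cells (Suc n) xs = cells n xs \<union> {xs n<..<xs (Suc n)}"
    by (auto simp: cells_def atLeastAtMostSuc_conv)
  show ?case
  proof
    fix x assume x: "x \<in> {xs 0..xs (Suc n)}"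
    show "x \<in> cells (Suc n) xs \<union> xs ` {0..Suc n}"
    proof (cases "x \<le> xs n")
      case True
      then have "x \<in> cells n xs \<union> xs ` {0..n}" using Suc x by auto
      then show ?thesis unfolding c by auto
    next
      case False
      then show ?thesis using x unfolding c by (cases "x = xs (Suc n)") auto
    qed
  qed
qed auto

lemma negligible_mesh_diff:
  assumes "mesh a b N xs"
  shows "negligible ({a..b} - cells N xs)"
proof -
  have "{a..b} - cells N xs \<subseteq> xs ` {0..N}"
    using interval_subset_cells[of xs N] assms by (auto simp: mesh_def)
  then show ?thesis
    by (meson finite_atLeastAtMost finite_imageI finite_subset negligible_finite)
qed

lemma integral_cells:
  assumes "mesh a b N xs"
  shows "integral {a..b} g = integral (cells N xs) (g :: real \<Rightarrow> real)"
    and "g integrable_on {a..b} \<longleftrightarrow> g integrable_on cells N xs"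
proof -
  have 1: "negligible {x \<in> {a..b} - cells N xs. g x \<noteq> 0}"
    by (rule negligible_subset[OF negligible_mesh_diff[OF assms]]) auto
  have 2: "{x \<in> cells N xs - {a..b}. g x \<noteq> 0} = {}"
    using cells_subset[OF assms] by force
  show "integral {a..b} g = integral (cells N xs) g"
    using 1 by (rule integral_spike_set) (simp only: 2 negligible_empty)
  show "g integrable_on {a..b} \<longleftrightarrow> g integrable_on cells N xs"
    by (rule integrable_spike_set_eq)
       (rule negligible_subset[OF negligible_mesh_diff[OF assms]], use cells_subset[OF assms] in force)
qed

text \<open>A \<open>pwc\<close> function may lack one-sided limits at the interfaces, so
  integrability comes from measurability and a constant bound rather than from continuity on closed
  cells.\<close>

lemma pwc_integrable:
  assumes "mesh a b N xs" "pwc N xs g"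
  shows "g integrable_on {a..b}"
proof -
  let ?S = "cells N xs"
  have lm: "?S \<in> lmeasurable"
    by (rule lmeasurable_open[OF bounded_subset[OF _ cells_subset[OF assms(1)]] open_cells])
       (rule bounded_subset[OF bounded_closed_interval[of a b]], auto)
  obtain B where B: "\<And>x. x \<in> ?S \<Longrightarrow> norm (g x) \<le> B"
    using assms(2) by (auto simp: pwc_def bounded_iff)
  have "g integrable_on ?S"
  proof (rule measurable_bounded_by_integrable_imp_integrable)
    show "g \<in> borel_measurable (lebesgue_on ?S)"
      using assms(2) lm by (intro continuous_imp_measurable_on_sets_lebesgue) (auto simp: pwc_def)
    show "(\<lambda>x. B) integrable_on ?S" using lm by (rule integrable_on_const)
    show "?S \<in> sets lebesgue" using lm by auto
  qed (use B in auto)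
  then show ?thesis using integral_cells(2)[OF assms(1)] by simp
qed

lemma integral_mono_cells:
  assumes "mesh a b N xs" "pwc N xs g" "pwc N xs g'" "\<And>x. x \<in> cells N xs \<Longrightarrow> g x \<le> g' x"
  shows "integral {a..b} g \<le> integral {a..b} g'"
  unfolding integral_cells(1)[OF assms(1), of g] integral_cells(1)[OF assms(1), of g']
  using pwc_integrable[OF assms(1,2)] pwc_integrable[OF assms(1,3)] assms(4)
  unfolding integral_cells(2)[OF assms(1)] by (intro integral_le) auto

lemma pwc_continuous_on:
  assumes "mesh a b N xs" "continuous_on {a..b} g"
  shows "pwc N xs g"
proof -
  have s: "cells N xs \<subseteq> {a..b}" using cells_subset[OF assms(1)] by force
  have "bounded (g ` {a..b})"
    using assms(2) by (intro compact_imp_bounded compact_continuous_image) auto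
  then show ?thesis unfolding pwc_def
    using continuous_on_subset[OF assms(2) s] bounded_subset[OF _ image_mono[OF s]] by auto
qed

section \<open>Closure properties of piecewise continuous functions\<close>

lemma pwc_const [intro]: "pwc N xs (\<lambda>x. c)"
  by (auto simp: pwc_def bounded_iff)

lemma pwc_add [intro]: "pwc N xs f \<Longrightarrow> pwc N xs g \<Longrightarrow> pwc N xs (\<lambda>x. f x + g x)"
  unfolding pwc_def by (auto intro: continuous_intros bounded_plus_comp)

lemma pwc_diff [intro]: "pwc N xs f \<Longrightarrow> pwc N xs g \<Longrightarrow> pwc N xs (\<lambda>x. f x - g x)"
  unfolding pwc_def by (auto intro: continuous_intros bounded_minus_comp)

lemma pwc_mult [intro]:
  assumes "pwc N xs f" "pwc N xs g" shows "pwc N xs (\<lambda>x. f x * g x)"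
proof -
  obtain B where B: "\<And>x. x \<in> cells N xs \<Longrightarrow> \<bar>f x\<bar> \<le> B"
    using assms(1) by (auto simp: pwc_def bounded_iff)
  obtain C where C: "\<And>x. x \<in> cells N xs \<Longrightarrow> \<bar>g x\<bar> \<le> C"
    using assms(2) by (auto simp: pwc_def bounded_iff)
  have "\<bar>f x * g x\<bar> \<le> B * C" if "x \<in> cells N xs" for x
    unfolding abs_mult using B[OF that] C[OF that] by (intro mult_mono) auto
  then have "bounded ((\<lambda>x. f x * g x) ` cells N xs)" by (auto simp: bounded_iff)
  then show ?thesis using assms unfolding pwc_def by (auto intro: continuous_intros)
qed

lemma pwc_power2 [intro]: "pwc N xs f \<Longrightarrow> pwc N xs (\<lambda>x. (f x)\<^sup>2)"
  unfolding power2_eq_square by (rule pwc_mult)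

lemma pwc_sum [intro]:
  "(\<And>i. i \<in> I \<Longrightarrow> pwc N xs (f i)) \<Longrightarrow> pwc N xs (\<lambda>x. \<Sum>i\<in>I. f i x)"
  by (induction I rule: infinite_finite_induct) auto

lemma pwc_cellwise:
  assumes "\<And>j. j \<in> {1..N} \<Longrightarrow>
    \<exists>G. continuous_on {xs (j - 1)..xs j} G \<and> (\<forall>x\<in>{xs (j - 1)<..<xs j}. g x = G x)"
  shows "pwc N xs g"
proof -
  have "continuous_on {xs (j - 1)<..<xs j} g \<and> bounded (g ` {xs (j - 1)<..<xs j})"
    if jj: "j \<in> {1..N}" for j
  proof -
    obtain G where G: "continuous_on {xs (j - 1)..xs j} G" "\<And>x. x\<in>{xs (j - 1)<..<xs j} \<Longrightarrow> g x = G x"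
      using assms[OF jj] by blast
    have s: "{xs (j - 1)<..<xs j} \<subseteq> {xs (j - 1)..xs j}" by auto
    have "continuous_on {xs (j - 1)<..<xs j} g"
      using continuous_on_subset[OF G(1) s] G(2) by (metis (mono_tags, lifting) continuous_on_cong)
    moreover have "bounded (G ` {xs (j - 1)..xs j})"
      using G(1) by (intro compact_imp_bounded compact_continuous_image) auto
    then have "bounded (g ` {xs (j - 1)<..<xs j})"
      by (rule bounded_subset) (use G(2) in force)
    ultimately show ?thesis by simp
  qed
  then show ?thesis unfolding pwc_def cells_def
    by (auto simp: image_UN intro!: continuous_on_open_UN)
qed

section \<open>Elements of the finite element space\<close>

lemma dg_space_cell:
  assumes "v \<in> dg_space k N xs" "j \<in> {1..N}"
  obtains q where "degree q \<le> k" "\<And>x. xs (j - 1) < x \<Longrightarrow> x < xs j \<Longrightarrow> v x = poly q x"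
    "\<And>x. xs (j - 1) < x \<Longrightarrow> x < xs j \<Longrightarrow> deriv v x = poly (pderiv q) x"
proof -
  obtain q where q: "degree q \<le> k" "\<And>x. x \<in> {xs (j - 1)<..<xs j} \<Longrightarrow> v x = poly q x"
    using assms unfolding dg_space_def by blast
  have "deriv v x = poly (pderiv q) x" if "xs (j - 1) < x" "x < xs j" for x
  proof (rule DERIV_imp_deriv)
    have "(poly q has_field_derivative poly (pderiv q) x) (at x)" by (rule poly_DERIV)
    then show "(v has_field_derivative poly (pderiv q) x) (at x)"
      by (rule has_field_derivative_transform_within_open[of _ _ _ "{xs (j - 1)<..<xs j}"])
         (use that q in auto)
  qed
  with q that show thesis by auto
qed

lemma pwc_dg:
  assumes "v \<in> dg_space k N xs" shows "pwc N xs v" "pwc N xs (deriv v)"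
  by (rule pwc_cellwise, erule dg_space_cell[OF assms],
      metis continuous_on_poly continuous_on_id greaterThanLessThan_iff)+

lemma dg_space_lincomb:
  assumes "v \<in> dg_space k N xs" "w \<in> dg_space k N xs"
  shows "(\<lambda>x. v x - c * w x) \<in> dg_space k N xs"
  unfolding dg_space_def
proof (safe)
  fix j assume j: "j \<in> {1..N}"
  obtain q where q: "degree q \<le> k" "\<And>x. xs (j - 1) < x \<Longrightarrow> x < xs j \<Longrightarrow> v x = poly q x"
    using dg_space_cell[OF assms(1) j] by metis
  obtain p where p: "degree p \<le> k" "\<And>x. xs (j - 1) < x \<Longrightarrow> x < xs j \<Longrightarrow> w x = poly p x"
    using dg_space_cell[OF assms(2) j] by metis
  have "degree (q - smult c p) \<le> k"
    using q(1) p(1) by (meson degree_diff_le degree_smult_le order_trans)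
  then show "\<exists>q. degree q \<le> k \<and> (\<forall>x\<in>{xs (j - 1)<..<xs j}. v x - c * w x = poly q x)"
    using q p by (intro exI[of _ "q - smult c p"]) auto
qed

lemma dg_space_diff:
  "v \<in> dg_space k N xs \<Longrightarrow> w \<in> dg_space k N xs \<Longrightarrow> (\<lambda>x. v x - w x) \<in> dg_space k N xs"
  using dg_space_lincomb[of v k N xs w 1] by simp

section \<open>One-sided traces at the interfaces\<close>

lemma tendsto_cell_left:
  fixes g G :: "real \<Rightarrow> real"
  assumes "l < r" "isCont G r" "\<And>x. l < x \<Longrightarrow> x < r \<Longrightarrow> g x = G x"
  shows "(g \<longlongrightarrow> G r) (at_left r)"
proof (rule Lim_transform_eventually)
  show "(G \<longlongrightarrow> G r) (at_left r)" using assms(2) by (meson filterlim_at_split isCont_def)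
  show "\<forall>\<^sub>F x in at_left r. G x = g x"
    using assms(1,3) by (auto simp: eventually_at_left intro!: exI[of _ l])
qed

lemma tendsto_cell_right:
  fixes g G :: "real \<Rightarrow> real"
  assumes "l < r" "isCont G l" "\<And>x. l < x \<Longrightarrow> x < r \<Longrightarrow> g x = G x"
  shows "(g \<longlongrightarrow> G l) (at_right l)"
proof (rule Lim_transform_eventually)
  show "(G \<longlongrightarrow> G l) (at_right l)" using assms(2) by (meson filterlim_at_split isCont_def)
  show "\<forall>\<^sub>F x in at_right l. G x = g x"
    using assms(1,3) by (auto simp: eventually_at_right intro!: exI[of _ r])
qed

lemma trace_periodic:
  assumes "N \<ge> 1"
  shows "trace_plus N xs v 0 = trace_plus N xs v N" "trace_minus N xs v 0 = trace_minus N xs v N"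
    "weighted_avg \<delta> N xs v 0 = weighted_avg \<delta> N xs v N"
  using assms by (auto simp: trace_plus_def trace_minus_def weighted_avg_def)

text \<open>Here \<open>j\<close> is at least 1, and in the companion \<open>trace_plus_cell\<close>
  the interface \<open>j - 1\<close> is below \<open>N\<close>; so the periodic branches of the
  trace definitions are not taken. They are reached through \<open>trace_periodic\<close>.\<close>

lemma trace_minus_cell:
  assumes "mesh a b N xs" "j \<in> {1..N}" "isCont G (xs j)"
    "\<And>x. xs (j - 1) < x \<Longrightarrow> x < xs j \<Longrightarrow> g x = G x"
  shows "trace_minus N xs g j = G (xs j)"
proof -
  have "(g \<longlongrightarrow> G (xs j)) (at_left (xs j))"
    by (rule tendsto_cell_left[OF mesh_cell_less[OF assms(1,2)] assms(3,4)])
  then show ?thesis using assms(2) by (auto simp: trace_minus_def intro!: tendsto_Lim)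
qed

lemma trace_plus_cell:
  assumes "mesh a b N xs" "j \<in> {1..N}" "isCont G (xs (j - 1))"
    "\<And>x. xs (j - 1) < x \<Longrightarrow> x < xs j \<Longrightarrow> g x = G x"
  shows "trace_plus N xs g (j - 1) = G (xs (j - 1))"
proof -
  have "(g \<longlongrightarrow> G (xs (j - 1))) (at_right (xs (j - 1)))"
    by (rule tendsto_cell_right[OF mesh_cell_less[OF assms(1,2)] assms(3,4)])
  then show ?thesis using assms(2) by (auto simp: trace_plus_def intro!: tendsto_Lim)
qed

section \<open>Splitting integrals over a mesh and integration by parts\<close>

lemma has_integral_mesh:
  fixes F :: "real \<Rightarrow> real"
  assumes "mesh a b N xs" "\<And>j. j \<in> {1..N} \<Longrightarrow> (F has_integral I j) {xs (j - 1)..xs j}"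
  shows "(F has_integral (\<Sum>j=1..N. I j)) {a..b}"
proof -
  have "(F has_integral (\<Sum>j=1..n. I j)) {xs 0..xs n}" if "n \<le> N" for n
    using that
  proof (induction n)
    case (Suc n)
    have "(F has_integral (\<Sum>j=1..n. I j) + I (Suc n)) {xs 0..xs (Suc n)}"
    proof (rule has_integral_combine)
      show "xs 0 \<le> xs n" "xs n \<le> xs (Suc n)"
        using Suc.prems by (auto intro!: mesh_mono_points[OF assms(1)])
      show "(F has_integral I (Suc n)) {xs n..xs (Suc n)}"
        using assms(2)[of "Suc n"] Suc.prems by simp
    qed (use Suc in auto)
    then show ?case by simp
  qed auto
  from this[of N] show ?thesis using assms(1) by (simp add: mesh_def)
qed

text \<open>Allowing \<open>g\<close> to be broken as well covers both smooth and piecewise polynomial \<open>g\<close>.\<close>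

lemma integration_by_parts_cells:
  assumes m: "mesh a b N xs" and v: "v \<in> dg_space k N xs"
    and g: "\<And>j. j \<in> {1..N} \<Longrightarrow> \<exists>G G'. (\<forall>x. (G has_real_derivative G' x) (at x)) \<and>
       (\<forall>x\<in>{xs (j - 1)<..<xs j}. g x = G x \<and> g' x = G' x) \<and> G (xs j) = gm j \<and> G (xs (j - 1)) = gp (j - 1)"
  shows "integral {a..b} (\<lambda>x. g x * deriv v x + g' x * v x) =
    (\<Sum>j=1..N. gm j * trace_minus N xs v j - gp (j - 1) * trace_plus N xs v (j - 1))"
proof (rule integral_unique, rule has_integral_mesh[OF m])
  fix j assume j: "j \<in> {1..N}"
  obtain G G' where G: "\<And>x. (G has_real_derivative G' x) (at x)"
    "\<And>x. xs (j - 1) < x \<Longrightarrow> x < xs j \<Longrightarrow> g x = G x" "\<And>x. xs (j - 1) < x \<Longrightarrow> x < xs j \<Longrightarrow> g' x = G' x"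
    "G (xs j) = gm j" "G (xs (j - 1)) = gp (j - 1)"
    using g[OF j] by (metis greaterThanLessThan_iff)
  obtain q where q: "\<And>x. xs (j - 1) < x \<Longrightarrow> x < xs j \<Longrightarrow> v x = poly q x"
    "\<And>x. xs (j - 1) < x \<Longrightarrow> x < xs j \<Longrightarrow> deriv v x = poly (pderiv q) x"
    using dg_space_cell[OF v j] by metis
  let ?h = "\<lambda>x. G x * poly (pderiv q) x + G' x * poly q x"
  have "(?h has_integral (G (xs j) * poly q (xs j) - G (xs (j - 1)) * poly q (xs (j - 1))))
     {xs (j - 1)..xs j}"
  proof (rule fundamental_theorem_of_calculus)
    show "xs (j - 1) \<le> xs j" using mesh_cell_less[OF m j] by simp
    fix x
    have "((\<lambda>x. G x * poly q x) has_real_derivative ?h x) (at x)"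
      by (rule derivative_eq_intros G(1) poly_DERIV | simp)+
    then show "((\<lambda>x. G x * poly q x) has_vector_derivative ?h x) (at x within {xs (j - 1)..xs j})"
      by (metis has_field_derivative_at_within has_real_derivative_iff_has_vector_derivative)
  qed
  then have "((\<lambda>x. g x * deriv v x + g' x * v x) has_integral
      (G (xs j) * poly q (xs j) - G (xs (j - 1)) * poly q (xs (j - 1)))) {xs (j - 1)..xs j}"
    by (rule has_integral_spike_finite[of "{xs (j - 1), xs j}", rotated 2])
       (auto simp: G(2,3) q)
  moreover have "trace_minus N xs v j = poly q (xs j)"
    by (rule trace_minus_cell[OF m j _ q(1)]) auto
  moreover have "trace_plus N xs v (j - 1) = poly q (xs (j - 1))"
    by (rule trace_plus_cell[OF m j _ q(1)]) auto
  ultimately show "((\<lambda>x. g x * deriv v x + g' x * v x) has_integral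
      gm j * trace_minus N xs v j - gp (j - 1) * trace_plus N xs v (j - 1)) {xs (j - 1)..xs j}"
    by (simp only: G(4,5))
qed

text \<open>A smooth \<open>g\<close> has the same value from both sides of an interface, so the
  boundary terms of the cells assemble into a flux sum whose flux is \<open>g\<close>
  itself.\<close>

lemma integration_by_parts_smooth:
  assumes m: "mesh a b N xs" and v: "v \<in> dg_space k N xs"
    and g: "\<And>x. (g has_real_derivative g' x) (at x)" and c: "continuous_on UNIV g'"
  shows "integral {a..b} (\<lambda>x. g x * deriv v x) + integral {a..b} (\<lambda>x. g' x * v x)
    = flux_sum N xs (\<lambda>j. g (xs j)) v"
proof -
  have "continuous_on {a..b} g" by (meson DERIV_isCont continuous_at_imp_continuous_on g)
  then have "pwc N xs g" "pwc N xs g'"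
    using c continuous_on_subset by (auto intro!: pwc_continuous_on[OF m])
  then have "integral {a..b} (\<lambda>x. g x * deriv v x) + integral {a..b} (\<lambda>x. g' x * v x)
    = integral {a..b} (\<lambda>x. g x * deriv v x + g' x * v x)"
    using pwc_dg[OF v] by (intro Henstock_Kurzweil_Integration.integral_add[symmetric] pwc_integrable[OF m]) auto
  also have "\<dots> = flux_sum N xs (\<lambda>j. g (xs j)) v"
    unfolding flux_sum_def by (rule integration_by_parts_cells[OF m v]) (use g in auto)
  finally show ?thesis .
qed

text \<open>The two alternating fluxes add up to the jump of the product at every interface.\<close>

lemma integration_by_parts_dg:
  assumes m: "mesh a b N xs" and v: "v \<in> dg_space k N xs" and w: "w \<in> dg_space k N xs"
  shows "integral {a..b} (\<lambda>x. w x * deriv v x) + integral {a..b} (\<lambda>x. v x * deriv w x)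
    = flux_sum N xs (weighted_avg (1 - \<delta>) N xs w) v + flux_sum N xs (weighted_avg \<delta> N xs v) w"
proof -
  have N: "N \<ge> 1" using m by (simp add: mesh_def)
  have "integral {a..b} (\<lambda>x. w x * deriv v x) + integral {a..b} (\<lambda>x. v x * deriv w x)
    = integral {a..b} (\<lambda>x. w x * deriv v x + deriv w x * v x)"
    using pwc_dg[OF v] pwc_dg[OF w]
    by (subst Henstock_Kurzweil_Integration.integral_add) (auto intro!: pwc_integrable[OF m] simp: mult.commute)
  also have "\<dots> = (\<Sum>j=1..N. trace_minus N xs w j * trace_minus N xs v j
       - trace_plus N xs w (j - 1) * trace_plus N xs v (j - 1))"
  proof (rule integration_by_parts_cells[OF m v])
    fix j assume j: "j \<in> {1..N}"
    obtain q where q: "\<And>x. xs (j - 1) < x \<Longrightarrow> x < xs j \<Longrightarrow> w x = poly q x"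
      "\<And>x. xs (j - 1) < x \<Longrightarrow> x < xs j \<Longrightarrow> deriv w x = poly (pderiv q) x"
      using dg_space_cell[OF w j] by metis
    have "trace_minus N xs w j = poly q (xs j)" "trace_plus N xs w (j - 1) = poly q (xs (j - 1))"
      by (rule trace_minus_cell[OF m j _ q(1)] trace_plus_cell[OF m j _ q(1)]; simp)+
    then show "\<exists>G G'. (\<forall>x. (G has_real_derivative G' x) (at x)) \<and>
       (\<forall>x\<in>{xs (j - 1)<..<xs j}. w x = G x \<and> deriv w x = G' x) \<and>
       G (xs j) = trace_minus N xs w j \<and> G (xs (j - 1)) = trace_plus N xs w (j - 1)"
      using q by (intro exI[of _ "poly q"] exI[of _ "poly (pderiv q)"]) auto
  qed
  also have "\<dots> = flux_sum N xs (weighted_avg (1 - \<delta>) N xs w) v + flux_sum N xs (weighted_avg \<delta> N xs v) w"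
  proof -
    \<comment> \<open>Because the weights \<delta> and 1 - \<delta> are complementary, the two
      fluxes times the opposite jumps add up to the jump of the product. Hence \<open>A j\<close>
      does not change if the plus traces in it are replaced by minus traces, each cell contributes
      \<open>A j - A (j - 1)\<close>, and periodicity closes the telescoping sum.\<close>
    define A where "A = (\<lambda>j. weighted_avg (1 - \<delta>) N xs w j * trace_plus N xs v j
      + weighted_avg \<delta> N xs v j * trace_plus N xs w j - trace_plus N xs w j * trace_plus N xs v j)"
    have "A 0 = A N" unfolding A_def trace_periodic[OF N] ..
    moreover have "(\<Sum>j=1..N. A j - A (j - 1)) = A N - A 0"
      by (induction N) auto
    ultimately have "(\<Sum>j=1..N. A j - A (j - 1)) = 0" by simp
    moreover have "flux_sum N xs (weighted_avg (1 - \<delta>) N xs w) v + flux_sum N xs (weighted_avg \<delta> N xs v) w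
      - (\<Sum>j=1..N. trace_minus N xs w j * trace_minus N xs v j
       - trace_plus N xs w (j - 1) * trace_plus N xs v (j - 1)) = (\<Sum>j=1..N. A j - A (j - 1))"
      unfolding flux_sum_def sum_subtractf[symmetric] sum.distrib[symmetric]
      by (intro sum.cong refl) (simp add: A_def weighted_avg_def algebra_simps)
    ultimately show ?thesis by linarith
  qed
  finally show ?thesis .
qed


section \<open>Legendre polynomials on the unit interval\<close>

text \<open>Rodrigues' formula shifted to \<open>[0, 1]\<close>, without the normalizing factor.\<close>

definition legendre :: "nat \<Rightarrow> real poly" where
  "legendre k = (pderiv ^^ k) ([:0, -1, 1:] ^ k)"

text \<open>The k-th power of X^2 - X vanishes to order k at 0 and at 1, and each derivative lowers
  these orders by one. The cases \<open>i < k\<close> make boundary terms vanish in the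
  orthogonality proof; the case \<open>i = k\<close> gives nonzero end point values.\<close>

lemma order_legendre_base:
  assumes "c \<in> {0, 1 :: real}" "i \<le> k"
  shows "(pderiv ^^ i) ([:0, -1, 1 :: real:] ^ k) \<noteq> 0" "order c ((pderiv ^^ i) ([:0, -1, 1:] ^ k)) = k - i"
proof -
  let ?p = "[:0, -1, 1:] ^ k :: real poly"
  have deg: "degree ?p = 2 * k" by (simp add: degree_power_eq)
  have nz: "(pderiv ^^ i) ?p \<noteq> 0" if "i \<le> k" for i
  proof (cases "k = 0")
    case False
    then have "degree ((pderiv ^^ i) ?p) > 0" using that by (simp add: degree_higher_pderiv deg)
    then show ?thesis by auto
  qed (use that in auto)
  show "(pderiv ^^ i) ?p \<noteq> 0" by (rule nz[OF assms(2)])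
  have f: "[:0, -1, 1 :: real:] = [:-0, 1:] * [:-1, 1:]" by simp
  have o0: "order c ?p = k"
  proof -
    have "order c ?p = order c ([:-0, 1:] ^ k) + order c ([:-1, 1:] ^ k)"
      unfolding f power_mult_distrib by (rule order_mult) auto
    also have "\<dots> = k"
    proof (cases "c = 0")
      case True
      have "order c ([:-1, 1:] ^ k) = 0" using True by (intro order_0I) (simp add: poly_power)
      then show ?thesis using order_power_n_n[of 0 k] True by simp
    next
      case False
      then have c: "c = 1" using assms(1) by simp
      have "order c ([:-0, 1:] ^ k) = 0" using c by (intro order_0I) (simp add: poly_power)
      then show ?thesis using order_power_n_n[of 1 k] c by simp
    qed
    finally show ?thesis .
  qed
  show "order c ((pderiv ^^ i) ?p) = k - i"
    using assms(2)
  proof (induction i)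
    case (Suc i)
    then have "order c ((pderiv ^^ i) ?p) = k - i" "k - i \<noteq> 0" by auto
    then have "order c ((pderiv ^^ i) ?p) = Suc (order c (pderiv ((pderiv ^^ i) ?p)))"
      using nz[of i] Suc.prems by (intro order_pderiv) (auto simp: order_root)
    then show ?case using \<open>order c ((pderiv ^^ i) ?p) = k - i\<close> by simp
  qed (use o0 in auto)
qed

lemma legendre_nonzero: "legendre k \<noteq> 0"
  unfolding legendre_def by (rule order_legendre_base(1)[of 0]) auto

lemma degree_legendre: "degree (legendre k) = k"
  unfolding legendre_def by (simp add: degree_higher_pderiv degree_power_eq)

lemma poly_legendre_endpoint: "c \<in> {0, 1} \<Longrightarrow> poly (legendre k) c \<noteq> 0"
  using order_legendre_base[of c k k] unfolding legendre_def by (auto simp: order_root)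

lemma higher_pderiv_reflect:
  "(pderiv ^^ n) (pcompose p [:1, -1:]) = smult ((-1) ^ n) (pcompose ((pderiv ^^ n) p) [:1, -1 :: real:])"
  by (induction n) (simp_all add: pderiv_smult pderiv_pcompose pderiv_pCons)

text \<open>X^2 - X is invariant under y to 1 - y, and each of the k differentiations contributes a
  sign. The end point values therefore have equal modulus, so that the cyclic interface system only
  compares the moduli of \<delta> and 1 - \<delta>.\<close>

lemma legendre_reflect: "poly (legendre k) (1 - y) = (-1) ^ k * poly (legendre k) y"
proof -
  have pw: "pcompose (p ^ n) r = pcompose p r ^ n" for p r :: "real poly" and n
    by (induction n) (simp_all add: pcompose_mult pcompose_1)
  have "pcompose [:0, -1, 1:] [:1, -1 :: real:] = [:0, -1, 1:]" by (simp add: pcompose_pCons)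
  then have "pcompose ([:0, -1, 1:] ^ k) [:1, -1 :: real:] = [:0, -1, 1:] ^ k"
    by (simp only: pw)
  then have "legendre k = smult ((-1) ^ k) (pcompose (legendre k) [:1, -1:])"
    using higher_pderiv_reflect[of k "[:0, -1, 1:] ^ k"] by (simp add: legendre_def)
  from arg_cong[OF this, of "\<lambda>p. poly p y"] have "poly (legendre k) y = (-1) ^ k * poly (legendre k) (1 - y)"
    by (simp add: poly_pcompose)
  then show ?thesis by (metis left_minus_one_mult_self)
qed

lemma abs_legendre_endpoints: "\<bar>poly (legendre k) 0\<bar> = \<bar>poly (legendre k) 1\<bar>"
  using legendre_reflect[of k 0] by (simp add: abs_mult)

lemma poly_integrable [simp]: "(\<lambda>y. poly p y) integrable_on {a..b :: real}"
  by (intro integrable_continuous_real continuous_intros)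

lemma legendre_orthogonal:
  assumes "degree q < k"
  shows "integral {0..1} (\<lambda>y. poly (legendre k) y * poly q y) = 0"
proof -
  let ?p = "[:0, -1, 1:] ^ k :: real poly"
  \<comment> \<open>Generalized to \<open>j\<close> derivatives and all \<open>q\<close> of degree
    below \<open>j\<close>: one integration by parts removes a derivative from the first factor and
    lowers the degree of \<open>q\<close>, and the boundary terms vanish since both end points are
    still roots.\<close>
  have "integral {0..1} (poly ((pderiv ^^ j) ?p * q)) = 0" if "degree q < j" "j \<le> k" for j q
    using that
  proof (induction j arbitrary: q)
    case (Suc j)
    let ?d = "(pderiv ^^ j) ?p"
    have z: "poly ?d c = 0" if "c \<in> {0, 1}" for c
      using order_legendre_base[OF that, of j k] Suc.prems by (auto simp: order_root)
    have "(poly (pderiv (?d * q)) has_integral poly (?d * q) 1 - poly (?d * q) 0) {0..1}"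
      by (rule fundamental_theorem_of_calculus)
         (auto intro!: has_field_derivative_at_within poly_DERIV
           simp: has_real_derivative_iff_has_vector_derivative[symmetric] simp del: poly_mult)
    then have "integral {0..1} (poly (pderiv (?d * q))) = 0"
      using z by (simp add: integral_unique)
    then have "integral {0..1} (\<lambda>y. poly (pderiv ?d * q) y + poly (?d * pderiv q) y) = 0"
      by (simp only: pderiv_mult poly_add[symmetric]) (simp only: add.commute mult.commute)
    then have "integral {0..1} (poly (pderiv ?d * q)) + integral {0..1} (poly (?d * pderiv q)) = 0"
      by (subst (asm) Henstock_Kurzweil_Integration.integral_add) (auto simp del: poly_mult)
    moreover have "integral {0..1} (poly (?d * pderiv q)) = 0"
    proof (cases "degree q = 0")
      case True
      then have "pderiv q = 0" by (simp add: pderiv_eq_0_iff)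
      then show ?thesis by (simp add: poly_0[abs_def])
    next
      case False
      then show ?thesis using Suc by (intro Suc.IH) (auto simp: degree_pderiv)
    qed
    ultimately show ?case by (simp only: funpow.simps o_apply add_0_right)
  qed simp
  from this[OF assms order_refl] show ?thesis
    unfolding legendre_def poly_mult[symmetric] by (simp only:)
qed

text \<open>A continuous nonnegative function with zero integral vanishes everywhere, which the
  nonzero value at the end point 0 excludes.\<close>

lemma legendre_norm_pos: "integral {0..1} (\<lambda>y. poly (legendre k) y * poly (legendre k) y) > 0"
proof -
  let ?I = "integral {0..1} (\<lambda>y. poly (legendre k) y * poly (legendre k) y)"
  have "?I \<ge> 0" by (intro Henstock_Kurzweil_Integration.integral_nonneg)
      (auto intro!: integrable_continuous_real continuous_intros)
  moreover have "?I \<noteq> 0"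
  proof
    assume "?I = 0"
    then have "\<forall>x\<in>{0..1}. poly (legendre k) x * poly (legendre k) x = 0"
      by (subst (asm) integral_eq_0_iff) (auto intro!: continuous_intros)
    then show False using poly_legendre_endpoint[of 0 k] by auto
  qed
  ultimately show ?thesis by simp
qed

section \<open>Legendre expansions and projection on the reference interval\<close>

lemma legendre_expansion:
  "degree D \<le> k \<Longrightarrow> \<exists>c. D = (\<Sum>i\<le>k. smult (c i) (legendre i))"
proof (induction k arbitrary: D)
  case 0
  then obtain d where "D = [:d:]" using degree_eq_zeroE by auto
  then show ?case by (intro exI[of _ "\<lambda>_. d"]) (simp add: legendre_def)
next
  case (Suc k)
  let ?L = "legendre (Suc k)"
  define c where "c = coeff D (Suc k) / coeff ?L (Suc k)"
  have "coeff ?L (Suc k) \<noteq> 0"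
    using legendre_nonzero[of "Suc k"] degree_legendre[of "Suc k"] by (metis leading_coeff_0_iff)
  then have "coeff (D - smult c ?L) (Suc k) = 0" by (simp add: c_def)
  moreover have "degree (D - smult c ?L) \<le> Suc k"
    using Suc.prems degree_legendre[of "Suc k"] by (intro degree_diff_le) (auto intro: order_trans[OF degree_smult_le])
  ultimately have "degree (D - smult c ?L) \<le> k"
    by (metis degree_0 le_SucE leading_coeff_0_iff zero_le)
  from Suc.IH[OF this] obtain d where "D - smult c ?L = (\<Sum>i\<le>k. smult (d i) (legendre i))" by blast
  then have "D = (\<Sum>i\<le>k. smult (d i) (legendre i)) + smult c ?L" by (simp add: algebra_simps)
  then show ?case by (intro exI[of _ "d(Suc k := c)"]) simp
qed

lemma integral_legendre_coeff:
  assumes "i \<le> k"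
  shows "integral {0..1} (\<lambda>y. poly (\<Sum>i\<le>k. smult (c i) (legendre i)) y * poly (legendre i) y)
    = c i * integral {0..1} (\<lambda>y. poly (legendre i) y * poly (legendre i) y)"
proof -
  have "integral {0..1} (\<lambda>y. poly (\<Sum>i\<le>k. smult (c i) (legendre i)) y * poly (legendre i) y)
    = integral {0..1} (\<lambda>y. \<Sum>j\<le>k. c j * (poly (legendre j) y * poly (legendre i) y))"
    by (simp add: poly_sum sum_distrib_right mult.assoc)
  also have "\<dots> = (\<Sum>j\<le>k. c j * integral {0..1} (\<lambda>y. poly (legendre j) y * poly (legendre i) y))"
    by (subst Henstock_Kurzweil_Integration.integral_sum)
       (auto intro!: integrable_continuous_real continuous_intros)
  also have "\<dots> = (\<Sum>j\<le>k. if j = i then c i * integral {0..1} (\<lambda>y. poly (legendre i) y * poly (legendre i) y) else 0)"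
  proof (intro sum.cong refl)
    fix j
    have "integral {0..1} (\<lambda>y. poly (legendre j) y * poly (legendre i) y) = 0" if "j \<noteq> i"
      using that legendre_orthogonal[of "legendre i" j] legendre_orthogonal[of "legendre j" i]
      by (cases "i < j") (auto simp: degree_legendre mult.commute)
    then show "c j * integral {0..1} (\<lambda>y. poly (legendre j) y * poly (legendre i) y) =
       (if j = i then c i * integral {0..1} (\<lambda>y. poly (legendre i) y * poly (legendre i) y) else 0)" by auto
  qed
  also have "\<dots> = c i * integral {0..1} (\<lambda>y. poly (legendre i) y * poly (legendre i) y)"
    using assms by simp
  finally show ?thesis .
qed

text \<open>Testing with \<open>legendre i\<close> for \<open>i < k\<close> determines every
  Legendre coefficient of \<open>D\<close> except the top one and bounds it by the size of
  \<open>E\<close>. The top coefficient stays free as \<open>c\<close>; on a mesh the interface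
  conditions determine it. The constant depends on \<open>k\<close> alone, so after scaling it
  serves every cell.\<close>

lemma reference_projection_bound:
  "\<exists>C\<ge>0. \<forall>D E \<epsilon>. degree D \<le> k \<longrightarrow> continuous_on {0..1} E \<longrightarrow> (\<forall>y\<in>{0..1}. \<bar>E y\<bar> \<le> \<epsilon>) \<longrightarrow>
     (\<forall>q. degree q < k \<longrightarrow> integral {0..1} (\<lambda>y. (poly D y - E y) * poly q y) = 0) \<longrightarrow>
     (\<exists>c. \<forall>y\<in>{0..1}. \<bar>poly D y - c * poly (legendre k) y\<bar> \<le> C * \<epsilon>)"
proof -
  have "\<exists>s. \<forall>y\<in>{0..1}. \<bar>poly (legendre i) y\<bar> \<le> s" for i
  proof -
    have "bounded (poly (legendre i) ` {0..1})"
      by (intro compact_imp_bounded compact_continuous_image continuous_intros) auto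
    then show ?thesis by (auto simp: bounded_iff)
  qed
  then obtain S where S: "\<And>i y. y \<in> {0..1} \<Longrightarrow> \<bar>poly (legendre i) y\<bar> \<le> S i" by metis
  then have S0: "S i \<ge> 0" for i by (meson abs_ge_zero atLeastAtMost_iff dual_order.trans order_refl zero_le_one)
  define m where "m = (\<lambda>i. integral {0..1} (\<lambda>y. poly (legendre i) y * poly (legendre i) y))"
  have m: "m i > 0" for i unfolding m_def by (rule legendre_norm_pos)
  show ?thesis
  \<comment> \<open>One factor \<open>S i\<close> bounds the test polynomial in the formula for the
    i-th coefficient, the other bounds \<open>legendre i\<close> where the expansion is evaluated,
    and \<open>m i\<close> normalizes.\<close>
  proof (rule exI[of _ "\<Sum>i<k. S i * S i / m i"], intro conjI allI impI)
    show "0 \<le> (\<Sum>i<k. S i * S i / m i)" using S0 m by (intro sum_nonneg divide_nonneg_pos mult_nonneg_nonneg) auto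
    fix D :: "real poly" and E :: "real \<Rightarrow> real" and \<epsilon> :: real
    assume D: "degree D \<le> k" and E: "continuous_on {0..1} E" and eps: "\<forall>y\<in>{0..1}. \<bar>E y\<bar> \<le> \<epsilon>"
      and orth: "\<forall>q. degree q < k \<longrightarrow> integral {0..1} (\<lambda>y. (poly D y - E y) * poly q y) = 0"
    obtain c where c: "D = (\<Sum>i\<le>k. smult (c i) (legendre i))" using legendre_expansion[OF D] by blast
    have ci: "\<bar>c i\<bar> \<le> \<epsilon> * S i / m i" if "i < k" for i
    proof -
      have i1: "(\<lambda>y. E y * poly (legendre i) y) integrable_on {0..1}"
        by (intro integrable_continuous_real continuous_intros E)
      have "0 = integral {0..1} (\<lambda>y. poly D y * poly (legendre i) y - E y * poly (legendre i) y)"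
        using orth[rule_format, of "legendre i"] that by (simp add: degree_legendre algebra_simps)
      also have "\<dots> = c i * m i - integral {0..1} (\<lambda>y. E y * poly (legendre i) y)"
        using i1 that unfolding c m_def
        by (subst Henstock_Kurzweil_Integration.integral_diff)
           (auto simp: integral_legendre_coeff intro!: integrable_continuous_real continuous_intros)
      finally have "\<bar>c i * m i\<bar> = \<bar>integral {0..1} (\<lambda>y. E y * poly (legendre i) y)\<bar>" by simp
      also have "\<dots> \<le> integral {0..1} (\<lambda>y::real. \<epsilon> * S i)"
      proof (rule integral_norm_bound_integral[OF i1, unfolded real_norm_def])
        fix y :: real assume y: "y \<in> {0..1}"
        show "\<bar>E y * poly (legendre i) y\<bar> \<le> \<epsilon> * S i"
          unfolding abs_mult using eps y S[OF y, of i] S0[of i] abs_ge_zero[of "E y"]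
          by (intro mult_mono) (auto intro: order_trans[OF abs_ge_zero])
      qed auto
      finally have "\<bar>c i\<bar> * m i \<le> \<epsilon> * S i" using m[of i] by (simp add: abs_mult)
      then show ?thesis using m[of i] by (simp add: field_simps)
    qed
    have "\<bar>poly D y - c k * poly (legendre k) y\<bar> \<le> (\<Sum>i<k. S i * S i / m i) * \<epsilon>" if y: "y \<in> {0..1}" for y
    proof -
      have "poly D y - c k * poly (legendre k) y = (\<Sum>i<k. c i * poly (legendre i) y)"
        by (simp add: c poly_sum lessThan_Suc_atMost[symmetric])
      also have "\<bar>\<dots>\<bar> \<le> (\<Sum>i<k. \<bar>c i * poly (legendre i) y\<bar>)" by (rule sum_abs)
      also have "\<dots> \<le> (\<Sum>i<k. S i * S i / m i * \<epsilon>)"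
      proof (rule sum_mono)
        fix i assume "i \<in> {..<k}"
        then have "\<bar>c i * poly (legendre i) y\<bar> \<le> (\<epsilon> * S i / m i) * S i"
          unfolding abs_mult using ci[of i] S[OF y] by (intro mult_mono) auto
        then show "\<bar>c i * poly (legendre i) y\<bar> \<le> S i * S i / m i * \<epsilon>" by (simp add: mult_ac)
      qed
      finally show ?thesis by (simp add: sum_distrib_right)
    qed
    then show "\<exists>c. \<forall>y\<in>{0..1}. \<bar>poly D y - c * poly (legendre k) y\<bar> \<le> (\<Sum>i<k. S i * S i / m i) * \<epsilon>" by blast
  qed
qed

text \<open>The truncated Legendre expansion of \<open>E\<close> has the required moments, and
  adding a multiple of \<open>legendre k\<close> does not change moments of lower degree. This
  multiple is the free parameter of a cell, later spent on the interface conditions.\<close>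

lemma reference_projection_exists:
  assumes E: "continuous_on {0..1} E"
  shows "\<exists>D. degree D \<le> k \<and> (\<forall>c q. degree q < k \<longrightarrow>
    integral {0..1} (\<lambda>y. (poly (D + smult c (legendre k)) y - E y) * poly q y) = 0)"
proof -
  define m where "m = (\<lambda>i. integral {0..1} (\<lambda>y. poly (legendre i) y * poly (legendre i) y))"
  have m: "m i > 0" for i unfolding m_def by (rule legendre_norm_pos)
  define d where "d = (\<lambda>i. integral {0..1} (\<lambda>y. E y * poly (legendre i) y) / m i)"
  define D where "D = (\<Sum>i\<le>k. smult (d i) (legendre i))"
  have "degree D \<le> k" unfolding D_def
    by (intro degree_sum_le) (auto simp: degree_legendre intro: order_trans[OF degree_smult_le])
  moreover have "integral {0..1} (\<lambda>y. (poly (D + smult c (legendre k)) y - E y) * poly q y) = 0"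
    if q: "degree q < k" for c q
  proof -
    \<comment> \<open>The strict degree bound forces \<open>k\<close> to be positive, so
      \<open>q\<close> is a combination of the Legendre polynomials up to
      \<open>k - 1\<close>.\<close>
    obtain k' where k': "k = Suc k'" using q by (cases k) auto
    obtain e where e: "q = (\<Sum>i\<le>k'. smult (e i) (legendre i))"
      using legendre_expansion[of q k'] q k' by auto
    have "integral {0..1} (\<lambda>y. (poly (D + smult c (legendre k)) y - E y) * poly (legendre i) y) = 0"
      if i: "i \<le> k'" for i
    proof -
      have "integral {0..1} (\<lambda>y. (poly (D + smult c (legendre k)) y - E y) * poly (legendre i) y)
        = integral {0..1} (\<lambda>y. poly D y * poly (legendre i) y + c * (poly (legendre k) y * poly (legendre i) y)
             - E y * poly (legendre i) y)" by (simp add: algebra_simps)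
      also have "\<dots> = integral {0..1} (\<lambda>y. poly D y * poly (legendre i) y)
         + c * integral {0..1} (\<lambda>y. poly (legendre k) y * poly (legendre i) y)
         - integral {0..1} (\<lambda>y. E y * poly (legendre i) y)"
        by (subst Henstock_Kurzweil_Integration.integral_diff, (auto intro!: integrable_continuous_real continuous_intros E)[2],
            subst Henstock_Kurzweil_Integration.integral_add, (auto intro!: integrable_continuous_real continuous_intros E)[2]) simp
      also have "integral {0..1} (\<lambda>y. poly D y * poly (legendre i) y) = d i * m i"
        unfolding D_def m_def using i k' by (intro integral_legendre_coeff) auto
      also have "\<dots> = integral {0..1} (\<lambda>y. E y * poly (legendre i) y)" using m[of i] by (simp add: d_def)
      also have "integral {0..1} (\<lambda>y. poly (legendre k) y * poly (legendre i) y) = 0"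
        using i k' by (intro legendre_orthogonal) (simp add: degree_legendre)
      finally show ?thesis by simp
    qed
    moreover have "integral {0..1} (\<lambda>y. (poly (D + smult c (legendre k)) y - E y) * poly q y)
      = (\<Sum>i\<le>k'. e i * integral {0..1} (\<lambda>y. (poly (D + smult c (legendre k)) y - E y) * poly (legendre i) y))"
    proof -
      have "integral {0..1} (\<lambda>y. (poly (D + smult c (legendre k)) y - E y) * poly q y)
        = integral {0..1} (\<lambda>y. \<Sum>i\<le>k'. e i * ((poly (D + smult c (legendre k)) y - E y) * poly (legendre i) y))"
        by (simp only: e poly_sum poly_smult sum_distrib_left mult_ac)
      also have "\<dots> = (\<Sum>i\<le>k'. e i * integral {0..1} (\<lambda>y. (poly (D + smult c (legendre k)) y - E y) * poly (legendre i) y))"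
        by (subst Henstock_Kurzweil_Integration.integral_sum)
           (auto intro!: integrable_continuous_real continuous_intros E)
      finally show ?thesis .
    qed
    ultimately show ?thesis by simp
  qed
  ultimately show ?thesis by blast
qed

lemma integral_cell_affine:
  fixes g :: "real \<Rightarrow> real"
  assumes "l < r" "g integrable_on {l..r}"
  shows "integral {l..r} g = (r - l) * integral {0..1} (\<lambda>y. g (l + (r - l) * y))"
proof -
  have "((\<lambda>y. g ((r - l) *\<^sub>R y + l)) has_integral (integral {l..r} g /\<^sub>R (r - l) ^ DIM(real)))
     (cbox ((l - l) /\<^sub>R (r - l)) ((r - l) /\<^sub>R (r - l)))"
    using assms by (intro has_integral_affinity') (auto simp: has_integral_integral)
  then have "((\<lambda>y. g (l + (r - l) * y)) has_integral integral {l..r} g / (r - l)) {0..1}"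
    using assms(1) by (simp add: add.commute divide_inverse_commute)
  then show ?thesis using assms(1) by (simp add: integral_unique)
qed


section \<open>The generalized Gauss-Radau projection\<close>

text \<open>Traces are linear only where the limits exist, since \<open>Lim\<close> is unspecified
  otherwise. The representatives are continuous on the whole line so that they are continuous at
  both ends of the cell.\<close>

definition broken_cont :: "nat \<Rightarrow> (nat \<Rightarrow> real) \<Rightarrow> (real \<Rightarrow> real) \<Rightarrow> bool" where
  "broken_cont N xs g \<longleftrightarrow>
    (\<forall>j\<in>{1..N}. \<exists>G. continuous_on UNIV G \<and> (\<forall>x\<in>{xs (j - 1)<..<xs j}. g x = G x))"

lemma broken_cont_dg: "v \<in> dg_space k N xs \<Longrightarrow> broken_cont N xs v"
  unfolding broken_cont_def
  by (metis dg_space_cell continuous_on_poly continuous_on_id greaterThanLessThan_iff)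

lemma broken_cont_continuous: "continuous_on UNIV g \<Longrightarrow> broken_cont N xs g"
  unfolding broken_cont_def by blast

lemma trace_lincomb:
  assumes m: "mesh a b N xs" and g: "broken_cont N xs g" and g': "broken_cont N xs g'" and j: "j \<le> N"
  shows "trace_plus N xs (\<lambda>x. g x - c * g' x) j = trace_plus N xs g j - c * trace_plus N xs g' j"
    "trace_minus N xs (\<lambda>x. g x - c * g' x) j = trace_minus N xs g j - c * trace_minus N xs g' j"
proof -
  have N: "N \<ge> 1" using m by (simp add: mesh_def)
  \<comment> \<open>Indexing by cells gives the plus trace at the left end and the minus trace at
    the right end. The plus trace at \<open>N\<close> and the minus trace at 0 then follow by
    periodicity.\<close>
  have *: "trace_plus N xs (\<lambda>x. g x - c * g' x) (i - 1) = trace_plus N xs g (i - 1) - c * trace_plus N xs g' (i - 1)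
     \<and> trace_minus N xs (\<lambda>x. g x - c * g' x) i = trace_minus N xs g i - c * trace_minus N xs g' i"
    if i: "i \<in> {1..N}" for i
  proof -
    obtain G where G: "continuous_on UNIV G" "\<And>x. xs (i - 1) < x \<Longrightarrow> x < xs i \<Longrightarrow> g x = G x"
      using g i unfolding broken_cont_def by (metis greaterThanLessThan_iff)
    obtain G' where G': "continuous_on UNIV G'" "\<And>x. xs (i - 1) < x \<Longrightarrow> x < xs i \<Longrightarrow> g' x = G' x"
      using g' i unfolding broken_cont_def by (metis greaterThanLessThan_iff)
    have c: "isCont G x" "isCont G' x" "isCont (\<lambda>x. G x - c * G' x) x" for x
      using G(1) G'(1) by (auto intro!: continuous_intros simp: continuous_on_eq_continuous_at)
    show ?thesis
      using trace_plus_cell[OF m i c(1) G(2)] trace_plus_cell[OF m i c(2) G'(2)]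
        trace_plus_cell[OF m i c(3), of "\<lambda>x. g x - c * g' x"]
        trace_minus_cell[OF m i c(1) G(2)] trace_minus_cell[OF m i c(2) G'(2)]
        trace_minus_cell[OF m i c(3), of "\<lambda>x. g x - c * g' x"] G(2) G'(2) by simp
  qed
  show "trace_plus N xs (\<lambda>x. g x - c * g' x) j = trace_plus N xs g j - c * trace_plus N xs g' j"
  proof (cases "j = N")
    case True
    then show ?thesis using *[of 1] N by (simp add: trace_periodic(1)[OF N, symmetric])
  next
    case False
    then show ?thesis using *[of "Suc j"] j by simp
  qed
  show "trace_minus N xs (\<lambda>x. g x - c * g' x) j = trace_minus N xs g j - c * trace_minus N xs g' j"
  proof (cases "j = 0")
    case True
    then show ?thesis using *[of N] N by (simp add: trace_periodic(2)[OF N])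
  next
    case False
    then show ?thesis using *[of j] j by simp
  qed
qed

lemma weighted_avg_lincomb:
  assumes "mesh a b N xs" "broken_cont N xs g" "broken_cont N xs g'" "j \<le> N"
  shows "weighted_avg \<delta> N xs (\<lambda>x. g x - c * g' x) j = weighted_avg \<delta> N xs g j - c * weighted_avg \<delta> N xs g' j"
  unfolding weighted_avg_def trace_lincomb[OF assms] by (simp add: algebra_simps)

lemma weighted_avg_continuous:
  assumes m: "mesh a b N xs" and w: "continuous_on UNIV w" "w b = w a" and j: "j \<le> N"
  shows "weighted_avg \<delta> N xs w j = w (xs j)"
proof -
  have N: "N \<ge> 1" and e: "xs 0 = a" "xs N = b" using m by (auto simp: mesh_def)
  have c: "isCont w x" for x using w(1) by (simp add: continuous_on_eq_continuous_at)
  have p: "trace_plus N xs w j = w (xs j)"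
  proof (cases "j = N")
    case True
    then show ?thesis using trace_plus_cell[OF m _ c, of 1 w] N w(2) e by (simp add: trace_periodic(1)[OF N, symmetric])
  next
    case False
    then show ?thesis using trace_plus_cell[OF m _ c, of "Suc j" w] j by simp
  qed
  have "trace_minus N xs w j = w (xs j)"
  proof (cases "j = 0")
    case True
    then show ?thesis using trace_minus_cell[OF m _ c, of N w] N w(2) e by (simp add: trace_periodic(2)[OF N])
  next
    case False
    then show ?thesis using trace_minus_cell[OF m _ c, of j w] j by simp
  qed
  with p show ?thesis by (simp add: weighted_avg_def algebra_simps)
qed

text \<open>The weighted average of the projection error vanishes, and a continuous periodic
  function equals its own weighted average because the weights sum to 1. So the numerical flux of
  the projection is exact.\<close>

lemma gauss_radau_interface:
  assumes m: "mesh a b N xs" and w: "continuous_on UNIV w" "w b = w a"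
    and v: "gauss_radau \<delta> k N xs w v" and j: "j \<le> N"
  shows "weighted_avg \<delta> N xs v j = w (xs j)"
proof -
  have N: "N \<ge> 1" and e: "xs 0 = a" "xs N = b" using m by (auto simp: mesh_def)
  have *: "weighted_avg \<delta> N xs v i = w (xs i)" if "i \<in> {1..N}" for i
  proof -
    have "weighted_avg \<delta> N xs (\<lambda>x. v x - 1 * w x) i = 0" using v that by (simp add: gauss_radau_def)
    then show ?thesis
      using v that weighted_avg_continuous[OF m w, of i \<delta>]
      by (subst (asm) weighted_avg_lincomb[OF m])
         (auto simp: gauss_radau_def intro: broken_cont_dg broken_cont_continuous w)
  qed
  show ?thesis
  proof (cases "j = 0")
    case True
    then show ?thesis using *[of N] N trace_periodic(3)[OF N] e w(2) by simp
  next
    case False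
    then show ?thesis using * j by simp
  qed
qed

lemma cell_integrable:
  assumes m: "mesh a b N xs" and j: "j \<in> {1..N}" and g: "pwc N xs g"
  shows "g integrable_on {xs (j - 1)..xs j}"
  using pwc_integrable[OF m g] mesh_cell_subset[OF m j] by (rule integrable_on_subinterval)

text \<open>On a cell the derivative of a test function has degree at most \<open>k - 1\<close>,
  which is exactly the range of the moment conditions.\<close>

lemma gauss_radau_orthogonal_deriv:
  assumes m: "mesh a b N xs" and w: "continuous_on UNIV w"
    and v: "gauss_radau \<delta> k N xs w v" and y: "y \<in> dg_space k N xs"
  shows "integral {a..b} (\<lambda>x. v x * deriv y x) = integral {a..b} (\<lambda>x. w x * deriv y x)"
proof -
  have pv: "pwc N xs v" using v pwc_dg by (auto simp: gauss_radau_def)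
  have pw: "pwc N xs w" using w by (intro pwc_continuous_on[OF m]) (auto intro: continuous_on_subset)
  have py: "pwc N xs (deriv y)" using pwc_dg[OF y] by simp
  have "((\<lambda>x. (v x - w x) * deriv y x) has_integral (\<Sum>j=1..N. 0)) {a..b}"
  proof (rule has_integral_mesh[OF m])
    fix j assume j: "j \<in> {1..N}"
    obtain q where q: "degree q \<le> k" "\<And>x. xs (j - 1) < x \<Longrightarrow> x < xs j \<Longrightarrow> deriv y x = poly (pderiv q) x"
      using dg_space_cell[OF y j] by metis
    have "integral {xs (j - 1)..xs j} (\<lambda>x. (v x - w x) * deriv y x)
      = integral {xs (j - 1)..xs j} (\<lambda>x. (v x - w x) * poly (pderiv q) x)"
      by (rule integral_spike[of "{xs (j - 1), xs j}"]) (auto simp: q)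
    also have "\<dots> = 0"
    \<comment> \<open>For \<open>k = 0\<close> there are no moment conditions, but then the
      derivative of the test function is zero.\<close>
    proof (cases "pderiv q = 0")
      case False
      then have "degree (pderiv q) < k" using q(1) by (auto simp: degree_pderiv pderiv_eq_0_iff)
      then show ?thesis using v j by (simp add: gauss_radau_def)
    qed simp
    finally have "integral {xs (j - 1)..xs j} (\<lambda>x. (v x - w x) * deriv y x) = 0" .
    moreover have "(\<lambda>x. (v x - w x) * deriv y x) integrable_on {xs (j - 1)..xs j}"
      using pv pw py by (intro cell_integrable[OF m j]) auto
    ultimately show "((\<lambda>x. (v x - w x) * deriv y x) has_integral 0) {xs (j - 1)..xs j}"
      by (metis has_integral_integral)
  qed
  then have "integral {a..b} (\<lambda>x. v x * deriv y x - w x * deriv y x) = 0"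
    by (simp add: integral_unique algebra_simps)
  then show ?thesis
    using pv pw py by (subst (asm) Henstock_Kurzweil_Integration.integral_diff) (auto intro!: pwc_integrable[OF m])
qed

text \<open>Applied to consecutive time levels with \<open>c\<close> equal to the damping factor of
  one time step: it identifies the increment of the projection error as a projection error.\<close>

lemma gauss_radau_lincomb:
  assumes m: "mesh a b N xs" and w: "continuous_on UNIV w" and w': "continuous_on UNIV w'"
    and v: "gauss_radau \<delta> k N xs w v" and v': "gauss_radau \<delta> k N xs w' v'"
  shows "gauss_radau \<delta> k N xs (\<lambda>x. w x - c * w' x) (\<lambda>x. v x - c * v' x)"
  unfolding gauss_radau_def
proof (intro conjI ballI allI impI)
  have V: "v \<in> dg_space k N xs" "v' \<in> dg_space k N xs" using v v' by (auto simp: gauss_radau_def)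
  then show "(\<lambda>x. v x - c * v' x) \<in> dg_space k N xs" by (rule dg_space_lincomb)
  have pw: "pwc N xs g" if "continuous_on UNIV g" for g
    using that by (intro pwc_continuous_on[OF m]) (auto intro: continuous_on_subset)
  fix j assume j: "j \<in> {1..N}"
  {
    fix q :: "real poly" assume q: "degree q < k"
    have "continuous_on UNIV (poly q)" by (intro continuous_intros)
    note pq = pw[OF this]
    have "(\<lambda>x. (v x - w x) * poly q x) integrable_on {xs (j - 1)..xs j}"
      "(\<lambda>x. c * ((v' x - w' x) * poly q x)) integrable_on {xs (j - 1)..xs j}"
      by (intro cell_integrable[OF m j] pwc_mult pwc_diff pwc_const
          pwc_dg(1)[OF V(1)] pwc_dg(1)[OF V(2)] pw[OF w] pw[OF w'] pq)+
    from Henstock_Kurzweil_Integration.integral_diff[OF this]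
    have "integral {xs (j - 1)..xs j} (\<lambda>x. (v x - w x) * poly q x - c * ((v' x - w' x) * poly q x)) = 0"
      using v v' j q by (simp add: gauss_radau_def)
    then show "integral {xs (j - 1)..xs j} (\<lambda>x. (v x - c * v' x - (w x - c * w' x)) * poly q x) = 0"
      by (simp add: algebra_simps)
  }
  have bc: "broken_cont N xs (\<lambda>x. y x - 1 * z x)" if yz: "y \<in> dg_space k N xs" "continuous_on UNIV z" for y z
    unfolding broken_cont_def
  proof
    fix i assume "i \<in> {1..N}"
    then obtain G where "continuous_on UNIV G" "\<forall>x\<in>{xs (i - 1)<..<xs i}. y x = G x"
      using broken_cont_dg[OF yz(1)] unfolding broken_cont_def by blast
    then show "\<exists>G. continuous_on UNIV G \<and> (\<forall>x\<in>{xs (i - 1)<..<xs i}. y x - 1 * z x = G x)"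
      using yz(2) by (intro exI[of _ "\<lambda>x. G x - z x"]) (auto intro: continuous_intros)
  qed
  have "weighted_avg \<delta> N xs (\<lambda>x. (v x - 1 * w x) - c * (v' x - 1 * w' x)) j = 0"
    using v v' j by (subst weighted_avg_lincomb[OF m bc[OF V(1) w] bc[OF V(2) w']]) (auto simp: gauss_radau_def)
  then show "weighted_avg \<delta> N xs (\<lambda>x. v x - c * v' x - (w x - c * w' x)) j = 0"
    by (simp add: algebra_simps)
qed

section \<open>Approximation order of the projection\<close>

lemma taylor_poly_bound:
  fixes D :: "nat \<Rightarrow> real \<Rightarrow> real"
  assumes d: "\<And>i x. i \<le> k \<Longrightarrow> (D i has_real_derivative D (Suc i) x) (at x)"
    and B: "\<And>x. \<bar>D (Suc k) x\<bar> \<le> B"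
  shows "\<exists>q. degree q \<le> k \<and> (\<forall>x\<ge>l. \<bar>D 0 x - poly q x\<bar> \<le> B * (x - l) ^ Suc k)"
proof -
  define q where "q = (\<Sum>m\<le>k. smult (D m l / fact m) ([:-l, 1:] ^ m))"
  have "degree q \<le> k" unfolding q_def
    by (intro degree_sum_le) (auto intro!: order_trans[OF degree_smult_le] order_trans[OF degree_power_le])
  moreover have "\<bar>D 0 x - poly q x\<bar> \<le> B * (x - l) ^ Suc k" if "x \<ge> l" for x
  \<comment> \<open>\<open>Taylor_up\<close> requires the evaluation point to lie strictly above the
    expansion point \<open>l\<close>.\<close>
  proof (cases "x = l")
    case True
    have "poly q l = (\<Sum>m\<le>k. if m = 0 then D 0 l else 0)"
      unfolding q_def poly_sum by (intro sum.cong refl) (auto simp: poly_power)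
    then show ?thesis using True by simp
  next
    case False
    with that have lx: "l < x" by simp
    obtain t where t: "D 0 x = (\<Sum>m<Suc k. (D m l / fact m) * (x - l) ^ m) + (D (Suc k) t / fact (Suc k)) * (x - l) ^ Suc k"
      using Taylor_up[of "Suc k" D "D 0" l x l] d lx by auto
    have "poly q x = (\<Sum>m<Suc k. (D m l / fact m) * (x - l) ^ m)"
      by (simp add: q_def poly_sum poly_power lessThan_Suc_atMost algebra_simps)
    then have "\<bar>D 0 x - poly q x\<bar> = \<bar>D (Suc k) t\<bar> / fact (Suc k) * (x - l) ^ Suc k"
      using lx by (simp only: t) (simp add: abs_mult)
    also have "\<dots> \<le> B * (x - l) ^ Suc k"
    proof (rule mult_right_mono)
      have "\<bar>D (Suc k) t\<bar> / fact (Suc k) \<le> \<bar>D (Suc k) t\<bar> / 1"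
        by (intro divide_left_mono fact_ge_1) auto
      then show "\<bar>D (Suc k) t\<bar> / fact (Suc k) \<le> B" using B[of t] by linarith
    qed (use lx in auto)
    finally show ?thesis .
  qed
  ultimately show ?thesis by blast
qed

lemma poly_affine_inverse:
  fixes l r y :: real
  assumes "l < r" shows "poly [:- l / (r - l), 1 / (r - l):] (l + (r - l) * y) = y"
proof -
  have "(l + (r - l) * y) * (1 / (r - l)) = l / (r - l) + (r - l) * y / (r - l)"
    by (simp only: times_divide_eq_right mult_1_right add_divide_distrib)
  also have "(r - l) * y / (r - l) = y" using assms by simp
  finally have "(l + (r - l) * y) * (1 / (r - l)) = l / (r - l) + y" .
  then have "- l / (r - l) + (l + (r - l) * y) * (1 / (r - l)) = y"
    by (simp only: minus_divide_left[symmetric])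
  then show ?thesis by (simp only: poly_pCons poly_0 mult_zero_right add_0_right)
qed

lemma reference_to_cell_orthogonal:
  fixes l r :: real
  assumes lr: "l < r" and p: "degree p < k"
  obtains q where "degree q < k" "\<And>y. poly q (l + (r - l) * y) = poly p y"
proof -
  let ?q = "pcompose p [:- l / (r - l), 1 / (r - l):]"
  have "degree ?q < k" using p by (simp add: degree_pcompose)
  moreover have "poly ?q (l + (r - l) * y) = poly p y" for y
    by (simp only: poly_pcompose poly_affine_inverse[OF lr])
  ultimately show thesis using that by blast
qed

text \<open>Subtracting the Taylor polynomial and scaling to the reference interval reduces the
  claim to \<open>reference_projection_bound\<close>. This step exploits the moment conditions
  inside the cell, so \<open>K\<close> is uniform in \<delta> and in the mesh; the traces are
  recorded because the interface conditions will determine \<open>c\<close>.\<close>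

lemma gauss_radau_cell_bound:
  "\<exists>K\<ge>0. \<forall>a b N xs D B \<delta> v j. mesh a b N xs \<longrightarrow>
     (\<forall>i x. i \<le> k \<longrightarrow> (D i has_real_derivative D (Suc i) x) (at x)) \<longrightarrow> (\<forall>x. \<bar>D (Suc k) x\<bar> \<le> B) \<longrightarrow>
     gauss_radau \<delta> k N xs (D 0) v \<longrightarrow> j \<in> {1..N} \<longrightarrow>
     (\<exists>c. (\<forall>x\<in>{xs (j - 1)<..<xs j}. \<exists>y\<in>{0..1}.
            \<bar>v x - D 0 x - c * poly (legendre k) y\<bar> \<le> K * (B * mesh_size N xs ^ Suc k)) \<and>
        \<bar>trace_minus N xs (\<lambda>x. v x - D 0 x) j - c * poly (legendre k) 1\<bar> \<le> K * (B * mesh_size N xs ^ Suc k) \<and>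
        \<bar>trace_plus N xs (\<lambda>x. v x - D 0 x) (j - 1) - c * poly (legendre k) 0\<bar> \<le> K * (B * mesh_size N xs ^ Suc k))"
proof -
  obtain C1 where C1: "C1 \<ge> 0" "\<And>D E \<epsilon>. degree D \<le> k \<Longrightarrow> continuous_on {0..1} E \<Longrightarrow> (\<forall>y\<in>{0..1}. \<bar>E y\<bar> \<le> \<epsilon>) \<Longrightarrow>
     (\<forall>q. degree q < k \<longrightarrow> integral {0..1} (\<lambda>y. (poly D y - E y) * poly q y) = 0) \<Longrightarrow>
     \<exists>c. \<forall>y\<in>{0..1}. \<bar>poly D y - c * poly (legendre k) y\<bar> \<le> C1 * \<epsilon>"
    using reference_projection_bound[of k] by blast
  show ?thesis
  \<comment> \<open>\<open>C1\<close> accounts for the polynomial part relative to its top Legendre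
    multiple, and 1 for the Taylor remainder \<open>E\<close>.\<close>
  proof (rule exI[of _ "C1 + 1"], intro conjI allI impI)
    show "C1 + 1 \<ge> 0" using C1 by simp
    fix a b N xs D B \<delta> v j
    assume m: "mesh a b N xs"
      and d: "\<forall>i x. i \<le> k \<longrightarrow> (D i has_real_derivative D (Suc i) x) (at x)"
      and B: "\<forall>x. \<bar>D (Suc k) x\<bar> \<le> B"
      and v: "gauss_radau \<delta> k N xs (D 0) v" and j: "j \<in> {1..N}"
    define l r where "l = xs (j - 1)" and "r = xs j"
    define \<epsilon> where "\<epsilon> = B * mesh_size N xs ^ Suc k"
    have lr: "l < r" and rl: "r - l \<le> mesh_size N xs"
      using mesh_cell_less[OF m j] mesh_le_size[OF m j] by (auto simp: l_def r_def)
    have B0: "B \<ge> 0" using B by (meson abs_ge_zero order_trans)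
    have w: "continuous_on UNIV (D 0)"
      using d by (intro continuous_at_imp_continuous_on) (auto intro: DERIV_isCont)
    obtain T where T: "degree T \<le> k" "\<And>x. x \<ge> l \<Longrightarrow> \<bar>D 0 x - poly T x\<bar> \<le> B * (x - l) ^ Suc k"
      using taylor_poly_bound[of k D B l] d B by blast
    have Te: "\<bar>D 0 x - poly T x\<bar> \<le> \<epsilon>" if "x \<in> {l..r}" for x
    proof -
      have "\<bar>D 0 x - poly T x\<bar> \<le> B * (x - l) ^ Suc k" using T(2) that by simp
      also have "\<dots> \<le> \<epsilon>" unfolding \<epsilon>_def using that rl B0 by (intro mult_left_mono power_mono) auto
      finally show ?thesis .
    qed
    have V: "v \<in> dg_space k N xs" using v by (simp add: gauss_radau_def)
    obtain q where q: "degree q \<le> k" "\<And>x. xs (j - 1) < x \<Longrightarrow> x < xs j \<Longrightarrow> v x = poly q x"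
      using dg_space_cell[OF V j] by metis
    \<comment> \<open>Both \<open>Dj\<close> and \<open>E\<close> are taken relative to the Taylor
      polynomial: their difference is still the projection error, while \<open>E\<close> has size
      \<open>\<epsilon>\<close>.\<close>
    define Dj where "Dj = pcompose (q - T) [:l, r - l:]"
    define E where "E = (\<lambda>y. D 0 (l + (r - l) * y) - poly T (l + (r - l) * y))"
    have Dj: "poly Dj y - E y = poly q (l + (r - l) * y) - D 0 (l + (r - l) * y)" for y
      by (simp add: Dj_def E_def poly_pcompose algebra_simps)
    have range: "l + (r - l) * y \<in> {l..r}" if "y \<in> {0..1}" for y
    proof -
      have "(r - l) * y \<le> r - l" by (rule mult_left_le) (use that lr in auto)
      moreover have "0 \<le> (r - l) * y" using that lr by simp
      ultimately have "l \<le> l + (r - l) * y \<and> l + (r - l) * y \<le> r" by linarith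
      then show ?thesis by (simp only: atLeastAtMost_iff)
    qed
    have "\<exists>c. \<forall>y\<in>{0..1}. \<bar>poly Dj y - c * poly (legendre k) y\<bar> \<le> C1 * \<epsilon>"
    proof (rule C1(2))
      show "degree Dj \<le> k" unfolding Dj_def using q(1) T(1) lr
        by (simp add: degree_pcompose degree_diff_le)
      show "continuous_on {0..1} E" unfolding E_def
        by (intro continuous_intros continuous_on_compose2[OF w]) auto
      show "\<forall>y\<in>{0..1}. \<bar>E y\<bar> \<le> \<epsilon>" using Te[OF range] by (simp add: E_def)
      show "\<forall>p. degree p < k \<longrightarrow> integral {0..1} (\<lambda>y. (poly Dj y - E y) * poly p y) = 0"
      proof (intro allI impI)
        fix p :: "real poly" assume "degree p < k"
        then obtain p' where p': "degree p' < k" "\<And>y. poly p' (l + (r - l) * y) = poly p y"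
          using reference_to_cell_orthogonal[OF lr] by blast
        have "0 = integral {l..r} (\<lambda>x. (v x - D 0 x) * poly p' x)"
          using v j p'(1) by (simp add: gauss_radau_def l_def r_def)
        also have "\<dots> = integral {l..r} (\<lambda>x. (poly q x - D 0 x) * poly p' x)"
          by (rule integral_spike[of "{l, r}"]) (auto simp: q l_def r_def)
        also have "\<dots> = (r - l) * integral {0..1} (\<lambda>y. (poly q (l + (r - l) * y) - D 0 (l + (r - l) * y)) * poly p' (l + (r - l) * y))"
          by (rule integral_cell_affine[OF lr])
             (intro integrable_continuous_real continuous_intros continuous_on_subset[OF w], auto)
        finally show "integral {0..1} (\<lambda>y. (poly Dj y - E y) * poly p y) = 0"
          using lr by (simp add: Dj p'(2))
      qed
    qed
    then obtain c where c: "\<And>y. y \<in> {0..1} \<Longrightarrow> \<bar>poly Dj y - c * poly (legendre k) y\<bar> \<le> C1 * \<epsilon>" by blast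
    have bound: "\<bar>poly q x - D 0 x - c * poly (legendre k) y\<bar> \<le> (C1 + 1) * \<epsilon>"
      if "y \<in> {0..1}" "x = l + (r - l) * y" for x y
    proof -
      have "poly q x - D 0 x - c * poly (legendre k) y = (poly Dj y - c * poly (legendre k) y) - E y"
        using Dj[of y] that(2) by simp
      moreover have "\<bar>E y\<bar> \<le> \<epsilon>" using Te[OF range[OF that(1)]] by (simp add: E_def)
      ultimately show ?thesis using c[OF that(1)] by (simp add: distrib_right)
    qed
    have cont: "isCont (\<lambda>x. poly q x - D 0 x) x" for x
      using w by (auto intro!: continuous_intros simp: continuous_on_eq_continuous_at)
    have tm: "trace_minus N xs (\<lambda>x. v x - D 0 x) j = poly q (xs j) - D 0 (xs j)"
      by (rule trace_minus_cell[OF m j cont]) (use q in auto)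
    have tp: "trace_plus N xs (\<lambda>x. v x - D 0 x) (j - 1) = poly q (xs (j - 1)) - D 0 (xs (j - 1))"
      by (rule trace_plus_cell[OF m j cont]) (use q in auto)
    show "\<exists>c. (\<forall>x\<in>{xs (j - 1)<..<xs j}. \<exists>y\<in>{0..1}.
            \<bar>v x - D 0 x - c * poly (legendre k) y\<bar> \<le> (C1 + 1) * (B * mesh_size N xs ^ Suc k)) \<and>
        \<bar>trace_minus N xs (\<lambda>x. v x - D 0 x) j - c * poly (legendre k) 1\<bar> \<le> (C1 + 1) * (B * mesh_size N xs ^ Suc k) \<and>
        \<bar>trace_plus N xs (\<lambda>x. v x - D 0 x) (j - 1) - c * poly (legendre k) 0\<bar> \<le> (C1 + 1) * (B * mesh_size N xs ^ Suc k)"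
      unfolding \<epsilon>_def[symmetric] tm tp
    proof (intro exI[of _ c] conjI ballI)
      show "\<bar>poly q (xs j) - D 0 (xs j) - c * poly (legendre k) 1\<bar> \<le> (C1 + 1) * \<epsilon>"
        by (rule bound) (auto simp: r_def)
      show "\<bar>poly q (xs (j - 1)) - D 0 (xs (j - 1)) - c * poly (legendre k) 0\<bar> \<le> (C1 + 1) * \<epsilon>"
        by (rule bound) (auto simp: l_def)
      fix x assume x: "x \<in> {xs (j - 1)<..<xs j}"
      show "\<exists>y\<in>{0..1}. \<bar>v x - D 0 x - c * poly (legendre k) y\<bar> \<le> (C1 + 1) * \<epsilon>"
      proof (rule bexI[of _ "(x - l) / (r - l)"])
        have "x = l + (r - l) * ((x - l) / (r - l))" using lr by simp
        moreover show y: "(x - l) / (r - l) \<in> {0..1}" using x lr by (simp add: l_def r_def)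
        ultimately show "\<bar>v x - D 0 x - c * poly (legendre k) ((x - l) / (r - l))\<bar> \<le> (C1 + 1) * \<epsilon>"
          using bound[OF y, of x] q(2) x by simp
      qed
    qed
  qed
qed

text \<open>Since \<open>\<bar>\<delta>\<bar> \<noteq> \<bar>1 - \<delta>\<bar>\<close>, the cyclic bidiagonal system for the leading Legendre coefficients is
  diagonally dominant, read forwards or backwards.\<close>

lemma cyclic_system_bound:
  fixes c :: "nat \<Rightarrow> real"
  assumes N: "N \<ge> 1" and AB: "\<bar>A\<bar> \<noteq> \<bar>B\<bar>"
    and eq: "\<And>j. j \<in> {1..N} \<Longrightarrow> \<bar>A * c (j mod N + 1) + B * c j\<bar> \<le> G" and i: "i \<in> {1..N}"
  shows "\<bar>c i\<bar> \<le> G / \<bar>\<bar>A\<bar> - \<bar>B\<bar>\<bar>"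
proof -
  obtain J where J: "J \<in> {1..N}" "\<And>j. j \<in> {1..N} \<Longrightarrow> \<bar>c j\<bar> \<le> \<bar>c J\<bar>"
  proof -
    have f: "finite ((\<lambda>j. \<bar>c j\<bar>) ` {1..N})" "(\<lambda>j. \<bar>c j\<bar>) ` {1..N} \<noteq> {}" using N by auto
    obtain J where "J \<in> {1..N}" "Max ((\<lambda>j. \<bar>c j\<bar>) ` {1..N}) = \<bar>c J\<bar>" using Max_in[OF f] by auto
    moreover from this have "\<bar>c j\<bar> \<le> \<bar>c J\<bar>" if "j \<in> {1..N}" for j
      using Max_ge[OF f(1)] that by (metis imageI)
    ultimately show thesis using that by blast
  qed
  have "\<bar>c J\<bar> * \<bar>\<bar>A\<bar> - \<bar>B\<bar>\<bar> \<le> G"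
  \<comment> \<open>\<open>J\<close> maximizes the modulus of \<open>c\<close>. If \<open>B\<close>
    dominates, the equation with index \<open>J\<close> is used, where \<open>B\<close> multiplies
    \<open>c J\<close>; otherwise the preceding equation, where \<open>A\<close> multiplies
    \<open>c J\<close>. The other unknown is bounded by maximality.\<close>
  proof (cases "\<bar>A\<bar> < \<bar>B\<bar>")
    case True
    have "J mod N + 1 \<in> {1..N}" using N by (auto simp: Suc_le_eq)
    then have "\<bar>A\<bar> * \<bar>c (J mod N + 1)\<bar> \<le> \<bar>A\<bar> * \<bar>c J\<bar>" using J(2) by (intro mult_left_mono) auto
    moreover have "\<bar>B * c J\<bar> \<le> \<bar>A * c (J mod N + 1) + B * c J\<bar> + \<bar>A * c (J mod N + 1)\<bar>" by linarith
    ultimately have "\<bar>B\<bar> * \<bar>c J\<bar> \<le> G + \<bar>A\<bar> * \<bar>c J\<bar>" using eq[OF J(1)] by (simp add: abs_mult)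
    then show ?thesis using True by (simp add: algebra_simps)
  next
    case False
    \<comment> \<open>The predecessor of \<open>J\<close> in the cyclic order.\<close>
    define p where "p = (if J = 1 then N else J - 1)"
    have p: "p \<in> {1..N}" "p mod N + 1 = J" using J(1) N by (auto simp: p_def)
    have "\<bar>B\<bar> * \<bar>c p\<bar> \<le> \<bar>B\<bar> * \<bar>c J\<bar>" using J(2) p by (intro mult_left_mono) auto
    moreover have "\<bar>A * c J\<bar> \<le> \<bar>A * c J + B * c p\<bar> + \<bar>B * c p\<bar>" by linarith
    ultimately have "\<bar>A\<bar> * \<bar>c J\<bar> \<le> G + \<bar>B\<bar> * \<bar>c J\<bar>" using eq[OF p(1)] unfolding p(2) by (simp add: abs_mult)
    then show ?thesis using False by (simp add: algebra_simps)
  qed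
  then have "\<bar>c J\<bar> \<le> G / \<bar>\<bar>A\<bar> - \<bar>B\<bar>\<bar>" using AB by (simp add: pos_le_divide_eq)
  then show ?thesis using J(2)[OF i] by linarith
qed

text \<open>If \<open>A\<close> is nonzero, the equations are a recursion from the value
  \<open>s\<close> in cell 1. Its N-th iterate is affine in \<open>s\<close> with slope
  \<open>\<rho> ^ N\<close>, which differs from 1 because the moduli of \<open>A\<close> and
  \<open>B\<close> differ; so one starting value closes the cycle.\<close>

lemma cyclic_system_exists:
  fixes d :: "nat \<Rightarrow> real"
  assumes N: "N \<ge> 1" and AB: "\<bar>A\<bar> \<noteq> \<bar>B\<bar>"
  shows "\<exists>c. \<forall>j\<in>{1..N}. A * c (j mod N + 1) + B * c j = d j"
proof (cases "A = 0")
  case True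
  then show ?thesis using AB by (intro exI[of _ "\<lambda>j. d j / B"]) auto
next
  case False
  define f where "f = (\<lambda>s. rec_nat s (\<lambda>n y. (d (Suc n) - B * y) / A))"
  define \<rho> where "\<rho> = - B / A"
  have f: "f s 0 = s" "f s (Suc n) = (d (Suc n) - B * f s n) / A" for s n by (auto simp: f_def)
  have aff: "f s n = \<rho> ^ n * s + f 0 n" for s n
    by (induction n) (use False in \<open>auto simp: f \<rho>_def field_simps\<close>)
  have "\<bar>\<rho>\<bar> \<noteq> 1" using AB False by (auto simp: \<rho>_def abs_divide)
  then have "\<rho> ^ N \<noteq> 1" using N by (metis abs_1 not_one_le_zero power_abs power_eq_1_iff real_norm_def)
  define s where "s = f 0 N / (1 - \<rho> ^ N)"
  have fs: "f s N = s" using \<open>\<rho> ^ N \<noteq> 1\<close> unfolding aff[of s N] by (simp add: s_def field_simps)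
  show ?thesis
  \<comment> \<open>The unknown of cell \<open>j\<close> is the iterate with index
    \<open>j - 1\<close>, so \<open>f s N = s\<close> leads from cell \<open>N\<close> back to cell
    1.\<close>
  proof (intro exI[of _ "\<lambda>j. f s (j - 1)"] ballI)
    fix j assume j: "j \<in> {1..N}"
    have "f s (j mod N + 1 - 1) = f s j" using j fs f(1)[of s] by (cases "j = N") auto
    moreover have "f s j = (d j - B * f s (j - 1)) / A" using f(2)[of s "j - 1"] j by simp
    ultimately show "A * f s (j mod N + 1 - 1) + B * f s (j - 1) = d j" using False by simp
  qed
qed

text \<open>\<open>j mod N + 1\<close> is the cell to the right of interface \<open>j\<close> in
  cyclic order; for \<open>j = N\<close> it is cell 1, whose left end is interface 0.\<close>

lemma trace_plus_mod:
  assumes "mesh a b N xs" "j \<in> {1..N}"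
  shows "trace_plus N xs g j = trace_plus N xs g (j mod N + 1 - 1)" "j mod N + 1 \<in> {1..N}"
proof -
  have N: "N \<ge> 1" using assms(1) by (simp add: mesh_def)
  then show "j mod N + 1 \<in> {1..N}" by (auto simp: Suc_le_eq)
  show "trace_plus N xs g j = trace_plus N xs g (j mod N + 1 - 1)"
    using assms(2) trace_periodic(1)[OF N] by (cases "j = N") auto
qed

lemma gauss_radau_bound:
  assumes \<delta>: "\<delta> \<noteq> 1/2"
  shows "\<exists>C\<ge>0. \<forall>a b N xs D B v. mesh a b N xs \<longrightarrow>
     (\<forall>i x. i \<le> k \<longrightarrow> (D i has_real_derivative D (Suc i) x) (at x)) \<longrightarrow> (\<forall>x. \<bar>D (Suc k) x\<bar> \<le> B) \<longrightarrow>
     gauss_radau \<delta> k N xs (D 0) v \<longrightarrow>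
     (\<forall>x\<in>cells N xs. \<bar>v x - D 0 x\<bar> \<le> C * (B * mesh_size N xs ^ Suc k))"
proof -
  obtain K where K: "K \<ge> 0" and K': "\<forall>a b N xs D B \<delta> v j. mesh a b N xs \<longrightarrow>
     (\<forall>i x. i \<le> k \<longrightarrow> (D i has_real_derivative D (Suc i) x) (at x)) \<longrightarrow> (\<forall>x. \<bar>D (Suc k) x\<bar> \<le> B) \<longrightarrow>
     gauss_radau \<delta> k N xs (D 0) v \<longrightarrow> j \<in> {1..N} \<longrightarrow>
     (\<exists>c. (\<forall>x\<in>{xs (j - 1)<..<xs j}. \<exists>y\<in>{0..1}.
            \<bar>v x - D 0 x - c * poly (legendre k) y\<bar> \<le> K * (B * mesh_size N xs ^ Suc k)) \<and>
        \<bar>trace_minus N xs (\<lambda>x. v x - D 0 x) j - c * poly (legendre k) 1\<bar> \<le> K * (B * mesh_size N xs ^ Suc k) \<and>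
        \<bar>trace_plus N xs (\<lambda>x. v x - D 0 x) (j - 1) - c * poly (legendre k) 0\<bar> \<le> K * (B * mesh_size N xs ^ Suc k))"
    using gauss_radau_cell_bound[of k] by (elim exE conjE)
  have "bounded (poly (legendre k) ` {0..1})"
    by (intro compact_imp_bounded compact_continuous_image continuous_intros) auto
  then have "\<exists>S. \<forall>y\<in>{0..1}. \<bar>poly (legendre k) y\<bar> \<le> S"
    unfolding bounded_iff real_norm_def by (metis imageI)
  then obtain S where S: "\<And>y. y \<in> {0..1} \<Longrightarrow> \<bar>poly (legendre k) y\<bar> \<le> S" by blast
  have S0: "S \<ge> 0" by (rule order_trans[OF abs_ge_zero S[of 0]]) simp
  let ?L0 = "poly (legendre k) 0" and ?L1 = "poly (legendre k) 1"
  define R where "R = \<bar>\<bar>\<delta> * ?L0\<bar> - \<bar>(1 - \<delta>) * ?L1\<bar>\<bar>"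
  have ne: "\<bar>\<delta> * ?L0\<bar> \<noteq> \<bar>(1 - \<delta>) * ?L1\<bar>"
  proof -
    have "\<bar>\<delta>\<bar> \<noteq> \<bar>1 - \<delta>\<bar>" using \<delta> by (auto simp: abs_if split: if_splits)
    then show ?thesis using poly_legendre_endpoint[of 1 k] by (auto simp: abs_mult abs_legendre_endpoints)
  qed
  then have R: "R > 0" by (simp add: R_def)
  define Q where "Q = (\<bar>\<delta>\<bar> + \<bar>1 - \<delta>\<bar>) * K"
  have Q: "Q \<ge> 0" using K by (simp add: Q_def)
  show ?thesis
  \<comment> \<open>\<open>K\<close> bounds the error apart from its top Legendre multiple,
    \<open>Q / R\<close> bounds that multiple through the cyclic system with dominance gap
    \<open>R\<close>, and \<open>S\<close> bounds the Legendre polynomial itself.\<close>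
  proof (rule exI[of _ "K + Q / R * S"], intro conjI allI impI ballI)
    show "K + Q / R * S \<ge> 0" using K(1) S0 Q R by simp
    fix a b N xs D B v x
    assume m: "mesh a b N xs"
      and d: "\<forall>i x. i \<le> k \<longrightarrow> (D i has_real_derivative D (Suc i) x) (at x)"
      and B: "\<forall>x. \<bar>D (Suc k) x\<bar> \<le> B"
      and v: "gauss_radau \<delta> k N xs (D 0) v" and x: "x \<in> cells N xs"
    define \<epsilon> where "\<epsilon> = B * mesh_size N xs ^ Suc k"
    have N: "N \<ge> 1" using m by (simp add: mesh_def)
    let ?g = "\<lambda>x. v x - D 0 x"
    have "\<forall>j\<in>{1..N}. \<exists>c. (\<forall>x\<in>{xs (j - 1)<..<xs j}. \<exists>y\<in>{0..1}. \<bar>?g x - c * poly (legendre k) y\<bar> \<le> K * \<epsilon>) \<and>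
        \<bar>trace_minus N xs ?g j - c * ?L1\<bar> \<le> K * \<epsilon> \<and> \<bar>trace_plus N xs ?g (j - 1) - c * ?L0\<bar> \<le> K * \<epsilon>"
      unfolding \<epsilon>_def
      by (rule ballI, rule K'[THEN spec, THEN spec, THEN spec, THEN spec, THEN spec, THEN spec, THEN spec, THEN spec, THEN spec,
        THEN mp, OF m, THEN mp, OF d, THEN mp, OF B, THEN mp, OF v, THEN mp])
    from bchoice[OF this] obtain c where c': "\<forall>j\<in>{1..N}. (\<forall>x\<in>{xs (j - 1)<..<xs j}. \<exists>y\<in>{0..1}. \<bar>?g x - c j * poly (legendre k) y\<bar> \<le> K * \<epsilon>) \<and>
        \<bar>trace_minus N xs ?g j - c j * ?L1\<bar> \<le> K * \<epsilon> \<and> \<bar>trace_plus N xs ?g (j - 1) - c j * ?L0\<bar> \<le> K * \<epsilon>"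
      by (elim exE)
    note c = c'[THEN bspec, THEN conjunct1] c'[THEN bspec, THEN conjunct2, THEN conjunct1]
      c'[THEN bspec, THEN conjunct2, THEN conjunct2]
    have cb: "\<bar>c i\<bar> \<le> Q * \<epsilon> / R" if "i \<in> {1..N}" for i
      unfolding R_def
    proof (rule cyclic_system_bound[OF N ne _ that])
      fix j assume j: "j \<in> {1..N}"
      let ?p = "trace_plus N xs ?g j" and ?m = "trace_minus N xs ?g j"
      have "\<delta> * ?p + (1 - \<delta>) * ?m = 0" using v j by (simp add: gauss_radau_def weighted_avg_def)
      \<comment> \<open>The weighted average of the actual traces is zero, so the right-hand side of
        the system consists only of the deviations of the traces from the Legendre values, each at
        most \<open>K * \<epsilon>\<close>.\<close>
      then have "\<delta> * ?L0 * c (j mod N + 1) + (1 - \<delta>) * ?L1 * c j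
        = - (\<delta> * (?p - c (j mod N + 1) * ?L0)) - (1 - \<delta>) * (?m - c j * ?L1)"
        by (simp add: algebra_simps)
      also have "\<bar>\<dots>\<bar> \<le> \<bar>\<delta>\<bar> * \<bar>?p - c (j mod N + 1) * ?L0\<bar> + \<bar>1 - \<delta>\<bar> * \<bar>?m - c j * ?L1\<bar>"
        unfolding abs_mult[symmetric] by linarith
      also have "\<dots> \<le> \<bar>\<delta>\<bar> * (K * \<epsilon>) + \<bar>1 - \<delta>\<bar> * (K * \<epsilon>)"
        using c(3)[OF trace_plus_mod(2)[OF m j]] c(2)[OF j] trace_plus_mod(1)[OF m j, of ?g]
        by (intro add_mono mult_left_mono) auto
      finally show "\<bar>\<delta> * ?L0 * c (j mod N + 1) + (1 - \<delta>) * ?L1 * c j\<bar> \<le> Q * \<epsilon>"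
        by (simp add: Q_def algebra_simps)
    qed
    obtain j where j: "j \<in> {1..N}" "xs (j - 1) < x" "x < xs j" using x by (rule cellsE)
    then obtain y where y: "y \<in> {0..1}" "\<bar>?g x - c j * poly (legendre k) y\<bar> \<le> K * \<epsilon>"
      using c(1)[OF j(1)] by (metis greaterThanLessThan_iff)
    have "\<bar>c j * poly (legendre k) y\<bar> \<le> Q * \<epsilon> / R * S"
      unfolding abs_mult using cb[OF j(1)] S[OF y(1)] by (intro mult_mono) auto
    then have "\<bar>?g x\<bar> \<le> K * \<epsilon> + Q * \<epsilon> / R * S" using y(2) by linarith
    also have "\<dots> = (K + Q / R * S) * \<epsilon>" by (simp add: algebra_simps)
    finally show "\<bar>?g x\<bar> \<le> (K + Q / R * S) * (B * mesh_size N xs ^ Suc k)" by (simp only: \<epsilon>_def)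
  qed
qed

text \<open>On every cell the moment conditions leave one free multiple of the top Legendre
  polynomial; the \<open>N\<close> interface conditions for these multiples form a solvable cyclic
  system.\<close>

lemma gauss_radau_exists:
  assumes m: "mesh a b N xs" and \<delta>: "\<delta> \<noteq> 1/2" and w: "continuous_on UNIV w"
  shows "\<exists>v. gauss_radau \<delta> k N xs w v"
proof -
  have N: "N \<ge> 1" using m by (simp add: mesh_def)
  let ?L0 = "poly (legendre k) 0" and ?L1 = "poly (legendre k) 1"
  define E where "E = (\<lambda>j y. w (xs (j - 1) + (xs j - xs (j - 1)) * y))"
  have "continuous_on {0..1} (E j)" for j unfolding E_def
    by (intro continuous_intros continuous_on_compose2[OF w]) auto
  from reference_projection_exists[OF this, of k]
  obtain D where D: "\<And>j. degree (D j) \<le> k" "\<And>j c q. degree q < k \<Longrightarrow>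
    integral {0..1} (\<lambda>y. (poly (D j + smult c (legendre k)) y - E j y) * poly q y) = 0"
    by metis
  have ne: "\<bar>\<delta> * ?L0\<bar> \<noteq> \<bar>(1 - \<delta>) * ?L1\<bar>"
  proof -
    have "\<bar>\<delta>\<bar> \<noteq> \<bar>1 - \<delta>\<bar>" using \<delta> by (auto simp: abs_if split: if_splits)
    then show ?thesis using poly_legendre_endpoint[of 1 k] by (auto simp: abs_mult abs_legendre_endpoints)
  qed
  \<comment> \<open>Minus the weighted average of the error before correction. For
    \<open>j = N\<close> the right trace is taken at \<open>xs 0\<close>, which keeps the two values
    of \<open>w\<close> apart, as no periodicity of \<open>w\<close> is assumed here.\<close>
  define \<Delta> where "\<Delta> = (\<lambda>j. - \<delta> * (poly (D (j mod N + 1)) 0 - w (xs (j mod N))) - (1 - \<delta>) * (poly (D j) 1 - w (xs j)))"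
  obtain c where c: "\<And>j. j \<in> {1..N} \<Longrightarrow> \<delta> * ?L0 * c (j mod N + 1) + (1 - \<delta>) * ?L1 * c j = \<Delta> j"
    using cyclic_system_exists[OF N ne, of \<Delta>] by blast
  define q where "q = (\<lambda>j. pcompose (D j + smult (c j) (legendre k))
     [:- xs (j - 1) / (xs j - xs (j - 1)), 1 / (xs j - xs (j - 1)):])"
  have q: "poly (q j) (xs (j - 1) + (xs j - xs (j - 1)) * y) = poly (D j + smult (c j) (legendre k)) y"
    if "j \<in> {1..N}" for j y
    by (simp only: q_def poly_pcompose poly_affine_inverse[OF mesh_cell_less[OF m that]])
  have dq: "degree (q j) \<le> k" for j
    using degree_pcompose_le[of "D j + smult (c j) (legendre k)" "[:- xs (j - 1) / (xs j - xs (j - 1)), 1 / (xs j - xs (j - 1)):]"]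
      degree_add_le[OF D(1) order_trans[OF degree_smult_le], of "legendre k" j "c j"]
    by (fastforce simp: q_def degree_legendre intro: order_trans split: if_splits)
  \<comment> \<open>The open cells are disjoint, so at most one summand is nonzero; at the
    interfaces the value is 0.\<close>
  define v where "v = (\<lambda>x. \<Sum>j\<in>{1..N}. if xs (j - 1) < x \<and> x < xs j then poly (q j) x else 0)"
  have v: "v x = poly (q j) x" if j: "j \<in> {1..N}" and x: "xs (j - 1) < x" "x < xs j" for j x
  proof -
    have "\<not> (xs (i - 1) < x \<and> x < xs i)" if i: "i \<in> {1..N}" "i \<noteq> j" for i
    proof (cases "i < j")
      case True
      then have "xs i \<le> xs (j - 1)" using j by (intro mesh_mono_points[OF m]) auto
      then show ?thesis using x by auto
    next
      case False
      then have "xs j \<le> xs (i - 1)" using i by (intro mesh_mono_points[OF m]) auto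
      then show ?thesis using x by auto
    qed
    then have "v x = (\<Sum>i\<in>{1..N}. if i = j then poly (q j) x else 0)"
      unfolding v_def using x by (intro sum.cong refl) auto
    then show ?thesis using j by simp
  qed
  have cont: "isCont (\<lambda>x. poly (q j) x - w x) x" for j x
    using w by (auto intro!: continuous_intros simp: continuous_on_eq_continuous_at)
  have tm: "trace_minus N xs (\<lambda>x. v x - w x) j = poly (D j) 1 + c j * ?L1 - w (xs j)" if "j \<in> {1..N}" for j
    using trace_minus_cell[OF m that cont, of "\<lambda>x. v x - w x" j] v[OF that] q[OF that, of 1] by simp
  have tp: "trace_plus N xs (\<lambda>x. v x - w x) (j - 1) = poly (D j) 0 + c j * ?L0 - w (xs (j - 1))" if "j \<in> {1..N}" for j
    using trace_plus_cell[OF m that cont, of "\<lambda>x. v x - w x" j] v[OF that] q[OF that, of 0] by simp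
  have "gauss_radau \<delta> k N xs w v"
    unfolding gauss_radau_def
  proof (intro conjI ballI allI impI)
    show "v \<in> dg_space k N xs" unfolding dg_space_def using v dq by auto
    fix j assume j: "j \<in> {1..N}"
    show "weighted_avg \<delta> N xs (\<lambda>x. v x - w x) j = 0"
      unfolding weighted_avg_def tm[OF j] trace_plus_mod(1)[OF m j] tp[OF trace_plus_mod(2)[OF m j]]
      using c[OF j] by (simp add: \<Delta>_def algebra_simps)
    fix p :: "real poly" assume p: "degree p < k"
    let ?l = "xs (j - 1)" and ?r = "xs j"
    have lr: "?l < ?r" using mesh_cell_less[OF m j] .
    have dp: "degree (pcompose p [:?l, ?r - ?l:]) < k" using p lr by (simp add: degree_pcompose)
    have "integral {?l..?r} (\<lambda>x. (v x - w x) * poly p x) = integral {?l..?r} (\<lambda>x. (poly (q j) x - w x) * poly p x)"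
      by (rule integral_spike[of "{?l, ?r}"]) (auto simp: v[OF j])
    also have "\<dots> = (?r - ?l) * integral {0..1} (\<lambda>y. (poly (q j) (?l + (?r - ?l) * y) - w (?l + (?r - ?l) * y)) * poly p (?l + (?r - ?l) * y))"
      by (rule integral_cell_affine[OF lr])
         (intro integrable_continuous_real continuous_intros continuous_on_subset[OF w], auto)
    also have "\<dots> = (?r - ?l) * integral {0..1} (\<lambda>y. (poly (D j + smult (c j) (legendre k)) y - E j y) * poly (pcompose p [:?l, ?r - ?l:]) y)"
      unfolding q[OF j] E_def by (simp add: poly_pcompose mult.commute)
    also have "\<dots> = 0" using D(2)[OF dp] by simp
    finally show "integral {?l..?r} (\<lambda>x. (v x - w x) * poly p x) = 0" .
  qed
  then show ?thesis by blast
qed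


section \<open>The L1 formula for the tempered derivative\<close>

text \<open>The bracket on the right-hand side of the scheme for arbitrary level values
  \<open>X\<close>, so that inner products, point values and projection errors can all be
  inserted.\<close>

definition l1_history :: "real \<Rightarrow> real \<Rightarrow> real \<Rightarrow> nat \<Rightarrow> (nat \<Rightarrow> real) \<Rightarrow> real" where
  "l1_history \<alpha> \<gamma> \<tau> n X =
     (\<Sum>i=1..n - 1. (l1_weight \<alpha> (i - 1) - l1_weight \<alpha> i) * exp (- real i * \<gamma> * \<tau>) * X (n - i))
     + l1_weight \<alpha> (n - 1) * exp (- real n * \<gamma> * \<tau>) * X 0"

section \<open>Signs, monotonicity and sums of the L1 weights\<close>

lemma l1_weight_0: "l1_weight \<alpha> 0 = 1"
  by (simp add: l1_weight_def)

text \<open>Writing a weight as a derivative at an intermediate point yields both its sign and its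
  monotonicity in \<open>i\<close>. For \<open>i = 0\<close> the power is only continuous at the
  left end, so differentiability is used in the interior alone.\<close>

lemma powr_increment_mvt:
  fixes \<alpha> :: real
  assumes "\<alpha> < 1"
  obtains z where "real i < z" "z < real i + 1" "l1_weight \<alpha> i = (1 - \<alpha>) * z powr (- \<alpha>)"
proof -
  have "\<exists>l z. real i < z \<and> z < real i + 1 \<and> DERIV (\<lambda>x. x powr (1 - \<alpha>)) z :> l \<and>
     (real i + 1) powr (1 - \<alpha>) - real i powr (1 - \<alpha>) = (real i + 1 - real i) * l"
  proof (rule MVT)
    show "continuous_on {real i..real i + 1} (\<lambda>x. x powr (1 - \<alpha>))"
      using assms by (intro continuous_on_powr') (auto intro: continuous_intros)
    fix x assume "real i < x"
    then have "x > 0" by linarith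
    then show "(\<lambda>x. x powr (1 - \<alpha>)) differentiable at x"
      using has_real_derivative_powr real_differentiable_def by blast
  qed simp
  then obtain l z where z: "real i < z" "z < real i + 1" "DERIV (\<lambda>x. x powr (1 - \<alpha>)) z :> l"
    "l1_weight \<alpha> i = l" unfolding l1_weight_def by auto
  have "z > 0" using z(1) by linarith
  then have "l = (1 - \<alpha>) * z powr (1 - \<alpha> - 1)"
    using DERIV_unique[OF z(3) has_real_derivative_powr] by simp
  with z that show thesis by simp
qed

lemma l1_weight_nonneg: "\<alpha> < 1 \<Longrightarrow> l1_weight \<alpha> i \<ge> 0"
  using powr_increment_mvt[of \<alpha> i] by (metis diff_ge_0_iff_ge less_eq_real_def mult_nonneg_nonneg powr_ge_zero)

lemma l1_weight_decreasing:
  assumes "0 < \<alpha>" "\<alpha> < 1" "i \<ge> 1"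
  shows "l1_weight \<alpha> i \<le> l1_weight \<alpha> (i - 1)"
proof -
  obtain z where z: "real i < z" "z < real i + 1" "l1_weight \<alpha> i = (1 - \<alpha>) * z powr (- \<alpha>)"
    using powr_increment_mvt[OF assms(2), of i] .
  obtain y where y: "real (i - 1) < y" "y < real (i - 1) + 1" "l1_weight \<alpha> (i - 1) = (1 - \<alpha>) * y powr (- \<alpha>)"
    using powr_increment_mvt[OF assms(2), of "i - 1"] .
  have "y > 0" "y \<le> z" using y z assms(3) by (auto simp: of_nat_diff)
  then have "z powr (- \<alpha>) \<le> y powr (- \<alpha>)" using assms(1) by (intro powr_mono2') auto
  then show ?thesis using assms(2) y(3) z(3) by (simp add: mult_left_mono)
qed

lemma sum_l1_weight:
  assumes "\<alpha> < 1" shows "(\<Sum>i<n. l1_weight \<alpha> i) = real n powr (1 - \<alpha>)"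
  by (induction n) (use assms in \<open>auto simp: l1_weight_def add.commute\<close>)

text \<open>The undamped weights are nonnegative and telescope to 1. The exponentials can only
  reduce the total weight, which is harmless because \<open>A\<close> is nonnegative.\<close>

lemma l1_history_le:
  assumes "0 < \<alpha>" "\<alpha> < 1" "\<gamma> \<ge> 0" "\<tau> \<ge> 0" "n \<ge> 1" "A \<ge> 0" and X: "\<And>m. m < n \<Longrightarrow> X m \<le> A"
  shows "l1_history \<alpha> \<gamma> \<tau> n X \<le> A"
proof -
  have e: "exp (- real i * \<gamma> * \<tau>) * X m \<le> A" if "m < n" for i m
  proof -
    have "exp (- real i * \<gamma> * \<tau>) * X m \<le> exp (- real i * \<gamma> * \<tau>) * A" using X[OF that] by simp
    also have "\<dots> \<le> 1 * A" using assms by (intro mult_right_mono) auto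
    finally show ?thesis by simp
  qed
  have "l1_history \<alpha> \<gamma> \<tau> n X \<le> (\<Sum>i=1..n - 1. (l1_weight \<alpha> (i - 1) - l1_weight \<alpha> i) * A) + l1_weight \<alpha> (n - 1) * A"
    unfolding l1_history_def mult.assoc[of _ "exp _"]
    using assms(1,2,5) e l1_weight_decreasing[OF assms(1,2)] l1_weight_nonneg[OF assms(2)]
    by (intro add_mono sum_mono mult_left_mono) auto
  also have "\<dots> = ((\<Sum>i=1..n - 1. l1_weight \<alpha> (i - 1) - l1_weight \<alpha> i) + l1_weight \<alpha> (n - 1)) * A"
    by (simp add: sum_distrib_right distrib_right)
  also have "(\<Sum>i=1..m. l1_weight \<alpha> (i - 1) - l1_weight \<alpha> i) + l1_weight \<alpha> m = 1" for m
    by (induction m) (auto simp: l1_weight_0)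
  finally show ?thesis by simp
qed

text \<open>Abel summation of the damped values
  \<open>exp (- real i * \<gamma> * \<tau>) * X (n - i)\<close>; it exposes one-step increments, to
  which both smoothness in time and the exact L1 formula apply.\<close>

lemma l1_summation_by_parts:
  assumes "n \<ge> 1"
  shows "X n - l1_history \<alpha> \<gamma> \<tau> n X =
    (\<Sum>i<n. l1_weight \<alpha> i * (exp (- real i * \<gamma> * \<tau>) * X (n - i) - exp (- real (Suc i) * \<gamma> * \<tau>) * X (n - Suc i)))"
proof -
  define Y where "Y = (\<lambda>i. exp (- real i * \<gamma> * \<tau>) * X (n - i))"
  have "Y 0 - ((\<Sum>i=1..m. (l1_weight \<alpha> (i - 1) - l1_weight \<alpha> i) * Y i) + l1_weight \<alpha> m * Y (Suc m))
    = (\<Sum>i<Suc m. l1_weight \<alpha> i * (Y i - Y (Suc i)))" for m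
    by (induction m) (auto simp: l1_weight_0 algebra_simps)
  from this[of "n - 1"] show ?thesis
    using assms by (simp add: l1_history_def Y_def mult.assoc del: of_nat_Suc)
qed

text \<open>Increments of size \<open>\<tau> * A\<close> compensate the negative power:
  \<tau>^(-\<alpha>) times \<tau> times n^(1-\<alpha>) is (n \<tau>)^(1-\<alpha>), which stays below
  T^(1-\<alpha>).\<close>

lemma l1_operator_bound:
  assumes "0 < \<alpha>" "\<alpha> < 1" "\<tau> > 0" "n \<ge> 1" "real n * \<tau> \<le> T" "A \<ge> 0"
    and X: "\<And>i. i < n \<Longrightarrow> \<bar>X (Suc i) - exp (- \<gamma> * \<tau>) * X i\<bar> \<le> \<tau> * A" and "\<gamma> \<ge> 0"
  shows "\<bar>\<tau> powr (- \<alpha>) / Gamma (2 - \<alpha>) * (X n - l1_history \<alpha> \<gamma> \<tau> n X)\<bar> \<le> T powr (1 - \<alpha>) / Gamma (2 - \<alpha>) * A"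
proof -
  have G: "Gamma (2 - \<alpha>) > 0" using assms by (intro Gamma_real_pos) auto
  have "\<bar>X n - l1_history \<alpha> \<gamma> \<tau> n X\<bar> \<le> (\<Sum>i<n. l1_weight \<alpha> i * (\<tau> * A))"
    unfolding l1_summation_by_parts[OF assms(4)]
  proof (rule order_trans[OF sum_abs], rule sum_mono)
    fix i assume i: "i \<in> {..<n}"
    \<comment> \<open>The common damping factor is at most 1; pulling it out leaves a tempered
      increment over a single step.\<close>
    have "exp (- real i * \<gamma> * \<tau>) * X (n - i) - exp (- real (Suc i) * \<gamma> * \<tau>) * X (n - Suc i)
      = exp (- real i * \<gamma> * \<tau>) * (X (Suc (n - Suc i)) - exp (- \<gamma> * \<tau>) * X (n - Suc i))"
      using i by (simp add: algebra_simps exp_add[symmetric] Suc_diff_Suc)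
    also have "\<bar>\<dots>\<bar> \<le> 1 * (\<tau> * A)"
      unfolding abs_mult using X[of "n - Suc i"] i assms by (intro mult_mono) auto
    finally show "\<bar>l1_weight \<alpha> i * (exp (- real i * \<gamma> * \<tau>) * X (n - i) - exp (- real (Suc i) * \<gamma> * \<tau>) * X (n - Suc i))\<bar>
      \<le> l1_weight \<alpha> i * (\<tau> * A)"
      using l1_weight_nonneg[OF assms(2), of i] by (simp add: abs_mult mult_left_mono)
  qed
  also have "\<dots> = real n powr (1 - \<alpha>) * (\<tau> * A)"
    by (simp only: sum_distrib_right[symmetric] sum_l1_weight[OF assms(2)])
  finally have "\<bar>\<tau> powr (- \<alpha>) / Gamma (2 - \<alpha>) * (X n - l1_history \<alpha> \<gamma> \<tau> n X)\<bar>
     \<le> \<tau> powr (- \<alpha>) / Gamma (2 - \<alpha>) * (real n powr (1 - \<alpha>) * (\<tau> * A))"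
    using G by (simp add: abs_mult divide_right_mono mult_left_mono)
  also have "\<dots> = (real n * \<tau>) powr (1 - \<alpha>) / Gamma (2 - \<alpha>) * A"
  proof -
    have "\<tau> powr (- \<alpha>) * \<tau> = \<tau> powr (1 - \<alpha>)" using assms(3) powr_add[of \<tau> "-\<alpha>" 1] by (simp add: algebra_simps)
    then show ?thesis using assms(3,4) by (simp add: powr_mult algebra_simps)
  qed
  also have "\<dots> \<le> T powr (1 - \<alpha>) / Gamma (2 - \<alpha>) * A"
    using assms G by (intro mult_right_mono divide_right_mono powr_mono2) auto
  finally show ?thesis .
qed

section \<open>Integrals against the weakly singular kernel\<close>

lemma has_integral_kernel:
  fixes \<alpha> t :: real
  assumes "\<alpha> < 1" "p \<le> q" "q \<le> t"
  shows "((\<lambda>s. (t - s) powr (- \<alpha>)) has_integral ((t - p) powr (1 - \<alpha>) - (t - q) powr (1 - \<alpha>)) / (1 - \<alpha>)) {p..q}"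
proof -
  let ?F = "\<lambda>s. - ((t - s) powr (1 - \<alpha>)) / (1 - \<alpha>)"
  have "((\<lambda>s. (t - s) powr (- \<alpha>)) has_integral ?F q - ?F p) {p..q}"
  \<comment> \<open>The case \<open>q = t\<close> is included: there the primitive is continuous but
    its derivative blows up, hence the version with derivatives only in the interior.\<close>
  proof (rule fundamental_theorem_of_calculus_interior[OF assms(2)])
    show "continuous_on {p..q} ?F"
      using assms by (intro continuous_on_divide continuous_on_minus continuous_on_powr') (auto intro!: continuous_intros)
    fix s assume s: "s \<in> {p<..<q}"
    have "(?F has_real_derivative (t - s) powr (- \<alpha>)) (at s)"
    proof -
      have "((\<lambda>s. (t - s) powr (1 - \<alpha>)) has_real_derivative (1 - \<alpha>) * (t - s) powr (1 - \<alpha> - 1) * (-1)) (at s)"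
        using s assms(3) by (intro DERIV_chain2[OF has_real_derivative_powr]) (auto intro!: derivative_eq_intros)
      from DERIV_cdivide[OF DERIV_minus[OF this], of "1 - \<alpha>"] show ?thesis using assms(1) by simp
    qed
    then show "(?F has_vector_derivative (t - s) powr (- \<alpha>)) (at s)"
      by (simp add: has_real_derivative_iff_has_vector_derivative)
  qed
  then show ?thesis by (simp add: diff_divide_distrib)
qed

text \<open>On the open interval the product is continuous and dominated by a multiple of the
  kernel, which is integrable even up to the singularity.\<close>

lemma integrable_mult_kernel:
  fixes \<alpha> t :: real
  assumes "\<alpha> < 1" "p \<le> q" "q \<le> t" and g: "continuous_on {p..q} g"
  shows "(\<lambda>s. g s * (t - s) powr (- \<alpha>)) integrable_on {p..q}"
proof -
  have "bounded (g ` {p..q})" using g by (intro compact_imp_bounded compact_continuous_image) auto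
  then have "\<exists>M. \<forall>s\<in>{p..q}. \<bar>g s\<bar> \<le> M" by (auto simp: bounded_iff)
  then obtain M where M: "\<And>s. s \<in> {p..q} \<Longrightarrow> \<bar>g s\<bar> \<le> M" by blast
  have "(\<lambda>s. g s * (t - s) powr (- \<alpha>)) integrable_on {p<..<q}"
  proof (rule measurable_bounded_by_integrable_imp_integrable)
    show "(\<lambda>s. g s * (t - s) powr (- \<alpha>)) \<in> borel_measurable (lebesgue_on {p<..<q})"
    proof (rule continuous_imp_measurable_on_sets_lebesgue)
      show "continuous_on {p<..<q} (\<lambda>s. g s * (t - s) powr (- \<alpha>))"
        using assms by (intro continuous_intros continuous_on_subset[OF g]) auto
    qed auto
    have "(\<lambda>s. (t - s) powr (- \<alpha>)) integrable_on {p..q}"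
      using has_integral_kernel[OF assms(1-3)] by blast
    then have "(\<lambda>s. (t - s) powr (- \<alpha>)) integrable_on {p<..<q}"
      by (simp add: integrable_on_open_interval_real)
    then show "(\<lambda>s. M * (t - s) powr (- \<alpha>)) integrable_on {p<..<q}" by (rule integrable_on_mult_right)
    fix s assume "s \<in> {p<..<q}"
    then show "norm (g s * (t - s) powr (- \<alpha>)) \<le> M * (t - s) powr (- \<alpha>)"
      using M[of s] by (simp add: abs_mult mult_right_mono)
  qed auto
  then show ?thesis by (simp add: integrable_on_open_interval_real)
qed

text \<open>Meant for the time step that ends at the singularity, where the kernel is unbounded and
  cannot be compared with its value at one end; the integral of the kernel serves as the
  bound.\<close>

lemma l1_last_cell_bound:
  fixes \<alpha> t :: real
  assumes "\<alpha> < 1" "p \<le> q" "q \<le> t" and g: "continuous_on {p..q} g" and A: "\<And>s. s \<in> {p..q} \<Longrightarrow> \<bar>g s\<bar> \<le> A"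
  shows "\<bar>integral {p..q} (\<lambda>s. g s * (t - s) powr (- \<alpha>))\<bar>
    \<le> A * (((t - p) powr (1 - \<alpha>) - (t - q) powr (1 - \<alpha>)) / (1 - \<alpha>))"
proof -
  have "norm (integral {p..q} (\<lambda>s. g s * (t - s) powr (- \<alpha>))) \<le> integral {p..q} (\<lambda>s. A * (t - s) powr (- \<alpha>))"
  proof (rule integral_norm_bound_integral[OF integrable_mult_kernel[OF assms(1-4)]])
    show "(\<lambda>s. A * (t - s) powr (- \<alpha>)) integrable_on {p..q}"
      using has_integral_kernel[OF assms(1-3)] by (intro integrable_on_mult_right) blast
  qed (auto simp: abs_mult A intro!: mult_right_mono)
  then show ?thesis using has_integral_kernel[OF assms(1-3)] by (simp add: integral_unique)
qed

text \<open>Subtracting the value of the kernel at \<open>p\<close> is free because \<open>g\<close> has mean zero; the resulting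
  bounds telescope when summed over the cells.\<close>

lemma l1_cell_bound:
  fixes \<alpha> t :: real
  assumes "0 < \<alpha>" "\<alpha> < 1" "p \<le> q" "q < t" and g: "continuous_on {p..q} g" and A: "\<And>s. s \<in> {p..q} \<Longrightarrow> \<bar>g s\<bar> \<le> A"
    and mean: "integral {p..q} g = 0"
  shows "\<bar>integral {p..q} (\<lambda>s. g s * (t - s) powr (- \<alpha>))\<bar> \<le> A * (q - p) * ((t - q) powr (- \<alpha>) - (t - p) powr (- \<alpha>))"
proof -
  let ?k = "\<lambda>s. (t - s) powr (- \<alpha>)"
  have ck: "continuous_on {p..q} ?k" using assms by (intro continuous_intros) auto
  have i: "(\<lambda>s. g s * ?k s) integrable_on {p..q}" "(\<lambda>s. g s * ?k p) integrable_on {p..q}"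
    by (intro integrable_continuous_real continuous_intros g ck)+
  have "integral {p..q} (\<lambda>s. g s * ?k s) = integral {p..q} (\<lambda>s. g s * ?k s) - integral {p..q} (\<lambda>s. g s * ?k p)"
    using mean by simp
  also have "\<dots> = integral {p..q} (\<lambda>s. g s * (?k s - ?k p))"
    unfolding Henstock_Kurzweil_Integration.integral_diff[OF i, symmetric] by (simp add: right_diff_distrib)
  also have "norm \<dots> \<le> integral {p..q} (\<lambda>s. A * (?k q - ?k p))"
  proof (rule integral_norm_bound_integral)
    show "(\<lambda>s. g s * (?k s - ?k p)) integrable_on {p..q}"
      by (intro integrable_continuous_real continuous_intros g ck)
    fix s assume s: "s \<in> {p..q}"
    have "?k p \<le> ?k s" "?k s \<le> ?k q" using s assms by (auto intro!: powr_mono2')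
    then show "norm (g s * (?k s - ?k p)) \<le> A * (?k q - ?k p)"
      unfolding real_norm_def abs_mult using A[OF s] by (intro mult_mono) auto
  qed auto
  finally show ?thesis using assms(3) by (simp add: mult_ac)
qed

text \<open>Replacing w' on each time step by the difference quotient of w gives the L1 formula
  exactly. The defect has mean zero and size \<open>W * \<tau>\<close>. In the constant, 1 comes
  from the steps before the last, where the kernel bounds telescope, and
  \<open>1 / (1 - \<alpha>)\<close> from the last step.\<close>

lemma l1_truncation:
  fixes \<alpha> \<tau> :: real
  assumes al: "0 < \<alpha>" "\<alpha> < 1" and tau: "\<tau> > 0" and n: "n \<ge> 1"
    and d: "\<And>s. s \<in> {0..real n * \<tau>} \<Longrightarrow> (w has_real_derivative w' s) (at s within {0..real n * \<tau>})"
    and lip: "\<And>s r. s \<in> {0..real n * \<tau>} \<Longrightarrow> r \<in> {0..real n * \<tau>} \<Longrightarrow> \<bar>w' s - w' r\<bar> \<le> W * \<bar>s - r\<bar>"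
  shows "\<bar>integral {0..real n * \<tau>} (\<lambda>s. w' s * (real n * \<tau> - s) powr (- \<alpha>))
     - \<tau> powr (- \<alpha>) / (1 - \<alpha>) * (\<Sum>i<n. l1_weight \<alpha> i * (w (real (n - i) * \<tau>) - w (real (n - Suc i) * \<tau>)))\<bar>
    \<le> W * (1 + 1 / (1 - \<alpha>)) * \<tau> powr (2 - \<alpha>)"
proof -
  define t where "t = real n * \<tau>"
  define xs where "xs = (\<lambda>j. real j * \<tau>)"
  let ?k = "\<lambda>s. (t - s) powr (- \<alpha>)"
  have m: "mesh 0 t n xs" using n tau by (auto simp: mesh_def xs_def t_def)
  have W0: "W \<ge> 0" 
  proof -
    have p: "real n * \<tau> > 0" using n tau by simp
    have "0 \<le> W * \<bar>0 - real n * \<tau>\<bar>" using p by (intro order_trans[OF abs_ge_zero lip]) auto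
    moreover have "0 < L \<Longrightarrow> 0 \<le> W * L \<Longrightarrow> 0 \<le> W" for L by (simp add: zero_le_mult_iff)
    ultimately show ?thesis using p by simp
  qed
  have c': "continuous_on {0..t} w'"
  proof (rule continuous_onI)
    fix x e :: real assume x: "x \<in> {0..t}" "e > 0"
    show "\<exists>d>0. \<forall>x'\<in>{0..t}. dist x' x < d \<longrightarrow> dist (w' x') (w' x) \<le> e"
    proof (intro exI[of _ "e / (W + 1)"] conjI ballI impI)
      show "e / (W + 1) > 0" using x W0 by simp
      fix y assume y: "y \<in> {0..t}" "dist y x < e / (W + 1)"
      have "\<bar>w' y - w' x\<bar> \<le> W * \<bar>y - x\<bar>" using lip x y by (simp add: t_def)
      also have "\<dots> \<le> (W + 1) * \<bar>y - x\<bar>" by (intro mult_right_mono) auto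
      also have "\<dots> \<le> e" using y(2) W0 by (simp add: dist_real_def pos_less_divide_eq mult.commute)
      finally show "dist (w' y) (w' x) \<le> e" by (simp add: dist_real_def)
    qed
  qed
  \<comment> \<open>The integral of the kernel over step \<open>j\<close>; the index
    \<open>n - j\<close> counts time steps backwards from \<open>t\<close>, as the L1 weights
    do.\<close>
  define J where "J = (\<lambda>j. \<tau> powr (1 - \<alpha>) / (1 - \<alpha>) * l1_weight \<alpha> (n - j))"
  define D where "D = (\<lambda>j. (w (xs j) - w (xs (j - 1))) / \<tau>)"
  have cell: "xs j - xs (j - 1) = \<tau>" "0 \<le> xs (j - 1)" "xs j \<le> t" "xs (j - 1) \<le> xs j"
    "t - xs j = real (n - j) * \<tau>" "t - xs (j - 1) = (real (n - j) + 1) * \<tau>" if "j \<in> {1..n}" for j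
    using that tau by (auto simp: xs_def t_def of_nat_diff algebra_simps)
  have sub: "{xs (j - 1)..xs j} \<subseteq> {0..t}" if "j \<in> {1..n}" for j
    using cell[OF that] by auto
  have J: "((\<lambda>s. ?k s) has_integral J j) {xs (j - 1)..xs j}" if "j \<in> {1..n}" for j
  proof -
    have "((t - xs (j - 1)) powr (1 - \<alpha>) - (t - xs j) powr (1 - \<alpha>)) / (1 - \<alpha>) = J j"
    proof -
      have "((real (n - j) + 1) * \<tau>) powr (1 - \<alpha>) = (real (n - j) + 1) powr (1 - \<alpha>) * \<tau> powr (1 - \<alpha>)"
        "(real (n - j) * \<tau>) powr (1 - \<alpha>) = real (n - j) powr (1 - \<alpha>) * \<tau> powr (1 - \<alpha>)"
        using tau by (simp_all add: powr_mult)
      moreover have "(A * p - B * p) / c = p / c * (A - B)" for A B p c :: real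
        by (simp add: left_diff_distrib[symmetric])
      ultimately show ?thesis unfolding cell(5,6)[OF that] J_def l1_weight_def by metis
    qed
    then show ?thesis using has_integral_kernel[OF al(2) cell(4,3)[OF that]] by simp
  qed
  define e where "e = (\<lambda>j. integral {xs (j - 1)..xs j} (\<lambda>s. (w' s - D j) * ?k s))"
  have main: "((\<lambda>s. w' s * ?k s) has_integral (D j * J j + e j)) {xs (j - 1)..xs j}" if j: "j \<in> {1..n}" for j
  proof -
    have "((\<lambda>s. (w' s - D j) * ?k s) has_integral e j) {xs (j - 1)..xs j}"
      unfolding e_def
      by (intro integrable_integral integrable_mult_kernel al cell j continuous_intros continuous_on_subset[OF c' sub])
    from has_integral_add[OF has_integral_mult_right[OF J[OF j], of "D j"] this]
    show ?thesis by (simp add: algebra_simps)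
  qed
  have I: "integral {0..t} (\<lambda>s. w' s * ?k s) = (\<Sum>j=1..n. D j * J j + e j)"
    using has_integral_mesh[OF m main] by (rule integral_unique)
  \<comment> \<open>The difference quotient equals w' at some point of the same step, so the
    Lipschitz bound applies over a distance of at most \<open>\<tau>\<close>.\<close>
  have gb: "\<bar>w' s - D j\<bar> \<le> W * \<tau>" if j: "j \<in> {1..n}" and s: "s \<in> {xs (j - 1)..xs j}" for j s
  proof -
    have "\<exists>z\<in>{xs (j - 1)<..<xs j}. w (xs j) - w (xs (j - 1)) = (\<lambda>h. h * w' z) (xs j - xs (j - 1))"
    proof (rule mvt_simple)
      show "xs (j - 1) < xs j" using cell(1)[OF j] tau by linarith
      fix x assume x: "xs (j - 1) \<le> x" "x \<le> xs j"
      then have "x \<in> {0..t}" using sub[OF j] by auto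
      then have "(w has_real_derivative w' x) (at x within {xs (j - 1)..xs j})"
        using d[of x] sub[OF j] unfolding t_def by (meson has_field_derivative_subset)
      then show "(w has_derivative (\<lambda>h. h * w' x)) (at x within {xs (j - 1)..xs j})"
        by (simp add: has_field_derivative_def mult_commute_abs)
    qed
    then obtain z where z: "z \<in> {xs (j - 1)<..<xs j}" "w (xs j) - w (xs (j - 1)) = \<tau> * w' z"
      using cell(1)[OF j] by auto
    then have "D j = w' z" using tau by (simp add: D_def)
    moreover have "\<bar>w' s - w' z\<bar> \<le> W * \<bar>s - z\<bar>"
      using sub[OF j] s z by (intro lip) (auto simp: t_def)
    moreover have "W * \<bar>s - z\<bar> \<le> W * \<tau>" using s z cell(1)[OF j] W0 by (intro mult_left_mono) auto
    ultimately show ?thesis by simp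
  qed
  have mean: "integral {xs (j - 1)..xs j} (\<lambda>s. w' s - D j) = 0" if j: "j \<in> {1..n}" for j
  proof -
    have "(w' has_integral w (xs j) - w (xs (j - 1))) {xs (j - 1)..xs j}"
    proof (rule fundamental_theorem_of_calculus[OF cell(4)[OF j]])
      fix x assume x: "x \<in> {xs (j - 1)..xs j}"
      then have "x \<in> {0..t}" using sub[OF j] by auto
      then have "(w has_real_derivative w' x) (at x within {xs (j - 1)..xs j})"
        using d[of x] sub[OF j] unfolding t_def by (meson has_field_derivative_subset)
      then show "(w has_vector_derivative w' x) (at x within {xs (j - 1)..xs j})"
        by (simp add: has_real_derivative_iff_has_vector_derivative)
    qed
    from has_integral_diff[OF this has_integral_const_real[of "D j"]]
    have "((\<lambda>s. w' s - D j) has_integral w (xs j) - w (xs (j - 1)) - \<tau> * D j) {xs (j - 1)..xs j}"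
      using cell(1,4)[OF j] by simp
    then show ?thesis using tau by (simp add: D_def integral_unique)
  qed
  have cg: "continuous_on {xs (j - 1)..xs j} (\<lambda>s. w' s - D j)" if "j \<in> {1..n}" for j
    by (intro continuous_intros continuous_on_subset[OF c' sub[OF that]])
  have e1: "\<bar>e j\<bar> \<le> W * \<tau> * \<tau> * (?k (xs j) - ?k (xs (j - 1)))" if j: "j \<in> {1..n - 1}" for j
  proof -
    have j': "j \<in> {1..n}" using j by auto
    have "xs j < t" using j n tau by (auto simp: xs_def t_def)
    from l1_cell_bound[OF al cell(4)[OF j'] this cg[OF j'] gb[OF j'] mean[OF j']]
    show ?thesis unfolding e_def cell(1)[OF j'] .
  qed
  have e2: "\<bar>e n\<bar> \<le> W * \<tau> * (\<tau> powr (1 - \<alpha>) / (1 - \<alpha>))"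
  proof -
    have j': "n \<in> {1..n}" using n by auto
    from l1_last_cell_bound[OF al(2) cell(4,3)[OF j'] cg[OF j'] gb[OF j']]
    show ?thesis unfolding e_def cell(5,6)[OF j'] using al by simp
  qed
  have "\<bar>\<Sum>j=1..n. e j\<bar> \<le> W * (1 + 1 / (1 - \<alpha>)) * \<tau> powr (2 - \<alpha>)"
  proof -
    have "(\<Sum>j=1..n. e j) = (\<Sum>j=1..n - 1. e j) + e n"
      using n by (cases n) auto
    moreover have "\<bar>\<Sum>j=1..n - 1. e j\<bar> \<le> W * \<tau> * \<tau> * \<tau> powr (- \<alpha>)"
    proof -
      have "\<bar>\<Sum>j=1..n - 1. e j\<bar> \<le> (\<Sum>j=1..n - 1. W * \<tau> * \<tau> * (?k (xs j) - ?k (xs (j - 1))))"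
        by (rule order_trans[OF sum_abs]) (intro sum_mono e1)
      also have "\<dots> = W * \<tau> * \<tau> * (\<Sum>j=1..n - 1. ?k (xs j) - ?k (xs (j - 1)))"
        by (simp only: sum_distrib_left)
      also have "(\<Sum>j=1..m. ?k (xs j) - ?k (xs (j - 1))) = ?k (xs m) - ?k (xs 0)" for m
        by (induction m) auto
      also have "t - xs (n - 1) = \<tau>" using n by (simp add: t_def xs_def of_nat_diff algebra_simps)
      also have "W * \<tau> * \<tau> * (\<tau> powr (- \<alpha>) - ?k (xs 0)) \<le> W * \<tau> * \<tau> * \<tau> powr (- \<alpha>)"
        using W0 tau by (intro mult_left_mono) auto
      finally show ?thesis .
    qed
    moreover have "W * \<tau> * \<tau> * \<tau> powr (- \<alpha>) = W * \<tau> powr (2 - \<alpha>)"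
      using tau powr_add[of \<tau> 2 "- \<alpha>"] by (simp add: power2_eq_square)
    moreover have "W * \<tau> * (\<tau> powr (1 - \<alpha>) / (1 - \<alpha>)) = W / (1 - \<alpha>) * \<tau> powr (2 - \<alpha>)"
      using tau powr_add[of \<tau> 1 "1 - \<alpha>"] by simp
    ultimately have "\<bar>\<Sum>j=1..n. e j\<bar> \<le> W * \<tau> powr (2 - \<alpha>) + W / (1 - \<alpha>) * \<tau> powr (2 - \<alpha>)"
      using e2 by linarith
    then show ?thesis by (simp add: algebra_simps)
  qed
  moreover have "(\<Sum>j=1..n. D j * J j) = \<tau> powr (- \<alpha>) / (1 - \<alpha>) *
     (\<Sum>i<n. l1_weight \<alpha> i * (w (real (n - i) * \<tau>) - w (real (n - Suc i) * \<tau>)))"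
  proof -
    have "(\<Sum>j=1..n. D j * J j) = (\<Sum>i<n. D (n - i) * J (n - i))"
      by (rule sum.reindex_bij_witness[of _ "\<lambda>i. n - i" "\<lambda>j. n - j"]) auto
    also have "\<dots> = (\<Sum>i<n. \<tau> powr (- \<alpha>) / (1 - \<alpha>) * (l1_weight \<alpha> i * (w (real (n - i) * \<tau>) - w (real (n - Suc i) * \<tau>))))"
    proof (rule sum.cong)
      fix i assume i: "i \<in> {..<n}"
      have "\<tau> powr (1 - \<alpha>) = \<tau> * \<tau> powr (- \<alpha>)" using tau powr_add[of \<tau> 1 "- \<alpha>"] by simp
      then show "D (n - i) * J (n - i) = \<tau> powr (- \<alpha>) / (1 - \<alpha>) * (l1_weight \<alpha> i * (w (real (n - i) * \<tau>) - w (real (n - Suc i) * \<tau>)))"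
        using i tau by (simp add: D_def J_def xs_def)
    qed simp
    finally show ?thesis by (simp only: sum_distrib_left)
  qed
  ultimately show ?thesis unfolding t_def[symmetric] I sum.distrib by simp
qed

text \<open>Multiplication by exp(\<gamma> s) removes the tempering: the fractional derivative of v
  is exp(-\<gamma> t) times the untempered one of w, and the same factor turns the plain L1 sum for
  w into the damped history of v. Thus \<open>l1_truncation\<close> applies to w.\<close>

lemma tempered_caputo_l1_truncation:
  fixes \<alpha> \<gamma> \<tau> T B :: real
  assumes al: "0 < \<alpha>" "\<alpha> < 1" and ga: "\<gamma> \<ge> 0" and tau: "\<tau> > 0" and n: "n \<ge> 1" "real n * \<tau> \<le> T"
    and d: "\<And>s. s \<in> {0..T} \<Longrightarrow> (v has_real_derivative v1 s) (at s within {0..T})"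
      "\<And>s. s \<in> {0..T} \<Longrightarrow> (v1 has_real_derivative v2 s) (at s within {0..T})"
    and B: "\<And>s. s \<in> {0..T} \<Longrightarrow> \<bar>v s\<bar> \<le> B" "\<And>s. s \<in> {0..T} \<Longrightarrow> \<bar>v1 s\<bar> \<le> B" "\<And>s. s \<in> {0..T} \<Longrightarrow> \<bar>v2 s\<bar> \<le> B"
  shows "\<bar>tempered_caputo \<alpha> \<gamma> v (real n * \<tau>)
     - \<tau> powr (- \<alpha>) / Gamma (2 - \<alpha>) * (v (real n * \<tau>) - l1_history \<alpha> \<gamma> \<tau> n (\<lambda>m. v (real m * \<tau>)))\<bar>
    \<le> exp (\<gamma> * T) * (\<gamma> + 1)\<^sup>2 * B * (1 + 1 / (1 - \<alpha>)) / Gamma (1 - \<alpha>) * \<tau> powr (2 - \<alpha>)"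
proof -
  define t where "t = real n * \<tau>"
  define w where "w = (\<lambda>s. exp (\<gamma> * s) * v s)"
  define w1 where "w1 = (\<lambda>s. exp (\<gamma> * s) * (\<gamma> * v s + v1 s))"
  define w2 where "w2 = (\<lambda>s. exp (\<gamma> * s) * (\<gamma>\<^sup>2 * v s + 2 * \<gamma> * v1 s + v2 s))"
  \<comment> \<open>A bound for the second derivative of \<open>w\<close>: the product rule gives
    the coefficients \<gamma>^2, 2 \<gamma> and 1, whose sum is (\<gamma> + 1)^2.\<close>
  define W where "W = exp (\<gamma> * T) * ((\<gamma> + 1)\<^sup>2 * B)"
  have t: "0 < t" "t \<le> T" using n tau by (auto simp: t_def)
  have G: "Gamma (1 - \<alpha>) > 0" using al by (intro Gamma_real_pos) auto
  have G2: "Gamma (2 - \<alpha>) = (1 - \<alpha>) * Gamma (1 - \<alpha>)"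
  proof -
    have "1 - \<alpha> \<notin> \<int>\<^sub>\<le>\<^sub>0" using al by (auto dest: nonpos_Ints_nonpos)
    from Gamma_plus1[OF this] show ?thesis by (simp add: algebra_simps)
  qed
  have dw: "(w has_real_derivative w1 s) (at s within {0..T})" if "s \<in> {0..T}" for s
    unfolding w_def w1_def by (auto intro!: derivative_eq_intros d(1)[OF that] simp: algebra_simps)
  have dw1: "(w1 has_real_derivative w2 s) (at s within {0..T})" if "s \<in> {0..T}" for s
    unfolding w1_def w2_def
    by (auto intro!: derivative_eq_intros d[OF that] simp: algebra_simps power2_eq_square)
  have w2: "\<bar>w2 s\<bar> \<le> W" if s: "s \<in> {0..T}" for s
  proof -
    have "\<bar>\<gamma>\<^sup>2 * v s + 2 * \<gamma> * v1 s + v2 s\<bar> \<le> \<gamma>\<^sup>2 * \<bar>v s\<bar> + 2 * \<gamma> * \<bar>v1 s\<bar> + \<bar>v2 s\<bar>"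
      using ga by (auto intro!: order_trans[OF abs_triangle_ineq] add_mono simp: abs_mult)
    also have "\<dots> \<le> \<gamma>\<^sup>2 * B + 2 * \<gamma> * B + B"
      using B[OF s] ga by (intro add_mono mult_left_mono) auto
    also have "\<dots> = (\<gamma> + 1)\<^sup>2 * B" by (simp add: power2_eq_square algebra_simps)
    finally show ?thesis unfolding w2_def W_def abs_mult using s ga by (intro mult_mono) (auto intro: mult_left_mono)
  qed
  have lip: "\<bar>w1 s - w1 r\<bar> \<le> W * \<bar>s - r\<bar>" if "s \<in> {0..T}" "r \<in> {0..T}" for s r
    using field_differentiable_bound[of "{0..T}" w1 w2 W s r] dw1 w2 that by (auto simp: convex_real_interval)
  have int: "integral {0..t} (\<lambda>s. deriv (\<lambda>r. exp (\<gamma> * r) * v r) s / (t - s) powr \<alpha>)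
    = integral {0..t} (\<lambda>s. w1 s * (t - s) powr (- \<alpha>))"
  \<comment> \<open>\<open>deriv\<close> is two-sided, whereas \<open>v\<close> is differentiable
    within \<open>{0..T}\<close>; the two notions agree in the interior, and the end points are
    negligible.\<close>
  proof (rule integral_spike[of "{0, t}"])
    fix s assume s: "s \<in> {0..t} - {0, t}"
    then have "s \<in> interior {0..T}" using t by auto
    then have "(w has_real_derivative w1 s) (at s)"
      using dw[of s] at_within_interior[of s "{0..T}"] s t by auto
    then have "deriv (\<lambda>r. exp (\<gamma> * r) * v r) s = w1 s"
      unfolding w_def by (rule DERIV_imp_deriv)
    then show "w1 s * (t - s) powr (- \<alpha>) = deriv (\<lambda>r. exp (\<gamma> * r) * v r) s / (t - s) powr \<alpha>"
      by (simp add: powr_minus divide_inverse)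
  qed auto
  let ?S = "\<Sum>i<n. l1_weight \<alpha> i * (w (real (n - i) * \<tau>) - w (real (n - Suc i) * \<tau>))"
  let ?I = "integral {0..t} (\<lambda>s. w1 s * (t - s) powr (- \<alpha>))"
  have tr: "\<bar>?I - \<tau> powr (- \<alpha>) / (1 - \<alpha>) * ?S\<bar> \<le> W * (1 + 1 / (1 - \<alpha>)) * \<tau> powr (2 - \<alpha>)"
    unfolding t_def
  proof (rule l1_truncation[OF al tau n(1)])
    fix s assume "s \<in> {0..real n * \<tau>}"
    then have s: "s \<in> {0..T}" using n by auto
    have "{0..real n * \<tau>} \<subseteq> {0..T}" using n by auto
    then show "(w has_real_derivative w1 s) (at s within {0..real n * \<tau>})"
      by (rule has_field_derivative_subset[OF dw[OF s]])
    fix r assume "r \<in> {0..real n * \<tau>}"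
    then show "\<bar>w1 s - w1 r\<bar> \<le> W * \<bar>s - r\<bar>" using s n by (intro lip) auto
  qed
  have S: "exp (- \<gamma> * t) * ?S = v t - l1_history \<alpha> \<gamma> \<tau> n (\<lambda>m. v (real m * \<tau>))"
    unfolding t_def l1_summation_by_parts[OF n(1), of "\<lambda>m. v (real m * \<tau>)"] sum_distrib_left
  proof (rule sum.cong)
    fix i assume i: "i \<in> {..<n}"
    have e: "exp (- \<gamma> * (real n * \<tau>)) * exp (\<gamma> * (real (n - j) * \<tau>)) = exp (- real j * \<gamma> * \<tau>)" if "j \<le> n" for j
      using that by (simp add: exp_add[symmetric] of_nat_diff algebra_simps)
    show "exp (- \<gamma> * (real n * \<tau>)) * (l1_weight \<alpha> i * (w (real (n - i) * \<tau>) - w (real (n - Suc i) * \<tau>)))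
      = l1_weight \<alpha> i * (exp (- real i * \<gamma> * \<tau>) * v (real (n - i) * \<tau>) - exp (- real (Suc i) * \<gamma> * \<tau>) * v (real (n - Suc i) * \<tau>))"
      unfolding w_def using e[of i] e[of "Suc i"] i
      by (simp only: right_diff_distrib mult.assoc[symmetric] mult.commute[of _ "l1_weight \<alpha> i"])
         (simp add: mult.assoc)
  qed simp
  have "tempered_caputo \<alpha> \<gamma> v t - \<tau> powr (- \<alpha>) / Gamma (2 - \<alpha>) * (exp (- \<gamma> * t) * ?S)
    = exp (- \<gamma> * t) / Gamma (1 - \<alpha>) * (?I - \<tau> powr (- \<alpha>) / (1 - \<alpha>) * ?S)"
  proof -
    have "E / g * I - p / (c * g) * (E * S) = E / g * (I - p / c * S)" for E g I p c S :: real
      by (simp add: right_diff_distrib mult_ac)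
    then show ?thesis unfolding tempered_caputo_def int G2 by blast
  qed
  also have "\<bar>\<dots>\<bar> \<le> 1 / Gamma (1 - \<alpha>) * (W * (1 + 1 / (1 - \<alpha>)) * \<tau> powr (2 - \<alpha>))"
    unfolding abs_mult using tr G ga t by (intro mult_mono) (auto simp: divide_right_mono)
  finally show ?thesis unfolding S unfolding t_def W_def by (simp add: mult_ac)
qed


section \<open>The energy estimate\<close>

lemma flux_sum_cong: "(\<And>j. j \<le> N \<Longrightarrow> g j = g' j) \<Longrightarrow> flux_sum N xs g v = flux_sum N xs g' v"
  unfolding flux_sum_def by (intro sum.cong refl) auto

lemma flux_sum_diff:
  "flux_sum N xs (\<lambda>j. g j - g' j) v = flux_sum N xs g v - flux_sum N xs g' v"
  unfolding flux_sum_def by (simp add: sum_subtractf[symmetric] algebra_simps)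

lemma flux_sum_weighted_avg_diff:
  assumes "mesh a b N xs" "v \<in> dg_space k N xs" "w \<in> dg_space k N xs"
  shows "flux_sum N xs (weighted_avg \<delta> N xs (\<lambda>x. v x - w x)) z =
    flux_sum N xs (weighted_avg \<delta> N xs v) z - flux_sum N xs (weighted_avg \<delta> N xs w) z"
  unfolding flux_sum_diff[symmetric]
  using weighted_avg_lincomb[OF assms(1) broken_cont_dg[OF assms(2)] broken_cont_dg[OF assms(3)], of _ \<delta> 1]
  by (intro flux_sum_cong) simp

lemma integral_diff_mult:
  assumes "mesh a b N xs" "pwc N xs f" "pwc N xs g" "pwc N xs h"
  shows "integral {a..b} (\<lambda>x. (f x - g x) * h x) = integral {a..b} (\<lambda>x. f x * h x) - integral {a..b} (\<lambda>x. g x * h x)"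
  unfolding left_diff_distrib
  using assms by (intro Henstock_Kurzweil_Integration.integral_diff pwc_integrable[OF assms(1)]) auto

text \<open>The moment conditions make the volume term exact and the interface conditions make the
  flux exact, so integration by parts for the smooth function carries over to its projection without
  error.\<close>

lemma gauss_radau_weak_derivative:
  assumes m: "mesh a b N xs" and d: "\<And>x. (w has_real_derivative w' x) (at x)"
    and c: "continuous_on UNIV w'" and per: "w b = w a"
    and g: "gauss_radau \<delta> k N xs w W" and v: "v \<in> dg_space k N xs"
  shows "integral {a..b} (\<lambda>x. W x * deriv v x) - flux_sum N xs (weighted_avg \<delta> N xs W) v
    = - integral {a..b} (\<lambda>x. w' x * v x)"
proof -
  have cw: "continuous_on UNIV w" by (meson DERIV_isCont continuous_at_imp_continuous_on d)
  have "flux_sum N xs (weighted_avg \<delta> N xs W) v = flux_sum N xs (\<lambda>j. w (xs j)) v"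
    by (intro flux_sum_cong gauss_radau_interface[OF m cw per g])
  then show ?thesis
    using integration_by_parts_smooth[OF m v d c] gauss_radau_orthogonal_deriv[OF m cw g v] by simp
qed

lemma l1_history_diff:
  "l1_history \<alpha> \<gamma> \<tau> n (\<lambda>m. X m - Y m) = l1_history \<alpha> \<gamma> \<tau> n X - l1_history \<alpha> \<gamma> \<tau> n Y"
  unfolding l1_history_def by (simp add: sum_subtractf[symmetric] right_diff_distrib)

lemma pwc_l1_history:
  assumes "\<And>m. m \<le> n \<Longrightarrow> pwc N xs (Y m)"
  shows "pwc N xs (\<lambda>x. l1_history \<alpha> \<gamma> \<tau> n (\<lambda>m. Y m x))"
  unfolding l1_history_def using assms by (intro pwc_add pwc_sum pwc_mult pwc_const) auto

lemma integral_l1_history: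
  assumes m: "mesh a b N xs" and Y: "\<And>m. m \<le> n \<Longrightarrow> pwc N xs (Y m)" and v: "pwc N xs v"
  shows "integral {a..b} (\<lambda>x. l1_history \<alpha> \<gamma> \<tau> n (\<lambda>m. Y m x) * v x)
    = l1_history \<alpha> \<gamma> \<tau> n (\<lambda>m. integral {a..b} (\<lambda>x. Y m x * v x))"
proof -
  have i: "(\<lambda>x. c * (Y m x * v x)) integrable_on {a..b}" if "m \<le> n" for m c
    using Y[OF that] v by (intro pwc_integrable[OF m]) auto
  have "integral {a..b} (\<lambda>x. l1_history \<alpha> \<gamma> \<tau> n (\<lambda>m. Y m x) * v x)
    = integral {a..b} (\<lambda>x. (\<Sum>i=1..n - 1. ((l1_weight \<alpha> (i - 1) - l1_weight \<alpha> i) * exp (- real i * \<gamma> * \<tau>)) * (Y (n - i) x * v x))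
     + (l1_weight \<alpha> (n - 1) * exp (- real n * \<gamma> * \<tau>)) * (Y 0 x * v x))"
    unfolding l1_history_def by (simp only: distrib_right sum_distrib_right mult.assoc)
  also have "\<dots> = integral {a..b} (\<lambda>x. \<Sum>i=1..n - 1. ((l1_weight \<alpha> (i - 1) - l1_weight \<alpha> i) * exp (- real i * \<gamma> * \<tau>)) * (Y (n - i) x * v x))
     + integral {a..b} (\<lambda>x. (l1_weight \<alpha> (n - 1) * exp (- real n * \<gamma> * \<tau>)) * (Y 0 x * v x))"
    by (intro Henstock_Kurzweil_Integration.integral_add integrable_sum i) auto
  also have "\<dots> = (\<Sum>i=1..n - 1. integral {a..b} (\<lambda>x. ((l1_weight \<alpha> (i - 1) - l1_weight \<alpha> i) * exp (- real i * \<gamma> * \<tau>)) * (Y (n - i) x * v x)))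
     + integral {a..b} (\<lambda>x. (l1_weight \<alpha> (n - 1) * exp (- real n * \<gamma> * \<tau>)) * (Y 0 x * v x))"
    by (intro arg_cong2[of _ _ _ _ "(+)"] Henstock_Kurzweil_Integration.integral_sum i refl) auto
  finally show ?thesis
    unfolding l1_history_def by (simp only: Henstock_Kurzweil_Integration.integral_mult_right)
qed

text \<open>\<open>Z\<close> is the residual of the first equation and \<open>G\<close> the mismatch
  in the second. Half of the \<open>\<beta>\<close> term at level \<open>n\<close> is spent on the
  history and half of the \<open>\<rho>\<close> term on \<open>Z\<close>; the assumption on
  \<open>K\<close> says that what remains is at most \<open>\<rho> / 2 * K\<close>.\<close>

lemma dg_energy_bound:
  fixes \<xi> :: "nat \<Rightarrow> real \<Rightarrow> real"
  assumes m: "mesh a b N xs" and n: "n \<ge> 1"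
    and al: "0 < \<alpha>" "\<alpha> < 1" and ga: "\<gamma> \<ge> 0" and tau: "\<tau> \<ge> 0" and rho: "\<rho> > 0" and beta: "\<beta> \<ge> 0"
    and xi: "\<And>m. m \<le> n \<Longrightarrow> \<xi> m \<in> dg_space k N xs" and th: "\<theta> \<in> dg_space k N xs"
    and Z: "pwc N xs Z" "\<And>x. x \<in> cells N xs \<Longrightarrow> \<bar>Z x\<bar> \<le> E"
    and G: "pwc N xs G" "\<And>x. x \<in> cells N xs \<Longrightarrow> \<bar>G x\<bar> \<le> F"
    and eq1: "\<And>v. v \<in> dg_space k N xs \<Longrightarrow> (\<rho> + \<beta>) * integral {a..b} (\<lambda>x. \<xi> n x * v x)
      - \<beta> * l1_history \<alpha> \<gamma> \<tau> n (\<lambda>m. integral {a..b} (\<lambda>x. \<xi> m x * v x))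
      + integral {a..b} (\<lambda>x. \<theta> x * deriv v x) - flux_sum N xs (weighted_avg (1 - \<delta>) N xs \<theta>) v
      + integral {a..b} (\<lambda>x. Z x * v x) = 0"
    and eq2: "\<And>w. w \<in> dg_space k N xs \<Longrightarrow> integral {a..b} (\<lambda>x. \<theta> x * w x) - integral {a..b} (\<lambda>x. G x * w x)
      + integral {a..b} (\<lambda>x. \<xi> n x * deriv w x) - flux_sum N xs (weighted_avg \<delta> N xs (\<xi> n)) w = 0"
    and prev: "\<And>m. m < n \<Longrightarrow> integral {a..b} (\<lambda>x. (\<xi> m x)\<^sup>2) \<le> K"
    and K: "2 * (b - a) * (E\<^sup>2 / (2 * \<rho>) + F\<^sup>2) / \<rho> \<le> K"
  shows "integral {a..b} (\<lambda>x. (\<xi> n x)\<^sup>2) \<le> K"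
proof -
  have ab: "a \<le> b" using mesh_mono_points[OF m, of 0 N] m by (simp add: mesh_def)
  note pw = pwc_dg(1)[OF xi] pwc_dg(1)[OF th] Z(1) G(1)
  have pn: "pwc N xs (\<xi> n)" and pt: "pwc N xs \<theta>" using pw by auto
  let ?X = "\<lambda>m. integral {a..b} (\<lambda>x. (\<xi> m x)\<^sup>2)"
  have int: "pwc N xs h \<Longrightarrow> h integrable_on {a..b}" for h by (rule pwc_integrable[OF m])
  have cross: "integral {a..b} (\<lambda>x. \<xi> m x * \<xi> n x) \<le> (K + ?X n) / 2" if mn: "m < n" for m
  proof -
    have pm: "pwc N xs (\<xi> m)" using pw mn by auto
    have "integral {a..b} (\<lambda>x. \<xi> m x * \<xi> n x) \<le> integral {a..b} (\<lambda>x. 1 / 2 * (\<xi> m x)\<^sup>2 + 1 / 2 * (\<xi> n x)\<^sup>2)"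
    proof (rule integral_mono_cells[OF m])
      fix x show "\<xi> m x * \<xi> n x \<le> 1 / 2 * (\<xi> m x)\<^sup>2 + 1 / 2 * (\<xi> n x)\<^sup>2"
        using zero_le_power2[of "\<xi> m x - \<xi> n x"] by (simp add: power2_eq_square algebra_simps)
    qed (intro pwc_add pwc_mult pwc_power2 pwc_const pm pn)+
    also have "\<dots> = 1 / 2 * ?X m + 1 / 2 * ?X n"
      using pm pn by (subst Henstock_Kurzweil_Integration.integral_add) (auto intro!: int)
    finally show ?thesis using prev[OF mn] by simp
  qed
  have X0: "?X m \<ge> 0" if "m \<le> n" for m
    using pw that by (intro Henstock_Kurzweil_Integration.integral_nonneg int) auto
  have K0: "K \<ge> 0" using X0[of 0] prev[of 0] n by auto
  have hist: "l1_history \<alpha> \<gamma> \<tau> n (\<lambda>m. integral {a..b} (\<lambda>x. \<xi> m x * \<xi> n x)) \<le> (K + ?X n) / 2"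
    using cross K0 X0[of n] by (intro l1_history_le al ga tau n) auto
  have "- integral {a..b} (\<lambda>x. Z x * \<xi> n x) = integral {a..b} (\<lambda>x. - 1 * (Z x * \<xi> n x))"
    by simp
  also have "\<dots> \<le> integral {a..b} (\<lambda>x. \<rho> / 2 * (\<xi> n x)\<^sup>2 + E\<^sup>2 / (2 * \<rho>))"
  proof (rule integral_mono_cells[OF m])
    fix x assume x: "x \<in> cells N xs"
    have "(Z x)\<^sup>2 \<le> E\<^sup>2" using Z(2)[OF x] by (metis abs_ge_zero power2_abs power_mono)
    moreover have "- 1 * (Z x * \<xi> n x) \<le> \<rho> / 2 * (\<xi> n x)\<^sup>2 + (Z x)\<^sup>2 / (2 * \<rho>)"
    proof -
      have "0 \<le> (\<rho> * \<xi> n x + Z x)\<^sup>2 / (2 * \<rho>)" using rho by simp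
      also have "\<dots> = \<rho> / 2 * (\<xi> n x)\<^sup>2 + (Z x)\<^sup>2 / (2 * \<rho>) + Z x * \<xi> n x"
        using rho by (simp add: power2_eq_square field_simps)
      finally show ?thesis by simp
    qed
    ultimately show "- 1 * (Z x * \<xi> n x) \<le> \<rho> / 2 * (\<xi> n x)\<^sup>2 + E\<^sup>2 / (2 * \<rho>)"
      using rho divide_right_mono[of "(Z x)\<^sup>2" "E\<^sup>2" "2 * \<rho>"] by linarith
  qed (intro pwc_add pwc_mult pwc_power2 pwc_const pn Z(1))+
  also have "\<dots> = \<rho> / 2 * ?X n + (b - a) * (E\<^sup>2 / (2 * \<rho>))"
    using pn ab by (subst Henstock_Kurzweil_Integration.integral_add) (auto intro!: int)
  finally have Zb: "- integral {a..b} (\<lambda>x. Z x * \<xi> n x) \<le> \<rho> / 2 * ?X n + (b - a) * (E\<^sup>2 / (2 * \<rho>))" .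
  have "integral {a..b} (\<lambda>x. G x * \<theta> x) \<le> integral {a..b} (\<lambda>x. \<theta> x * \<theta> x + F\<^sup>2)"
  proof (rule integral_mono_cells[OF m])
    fix x assume x: "x \<in> cells N xs"
    have "(G x)\<^sup>2 \<le> F\<^sup>2" using G(2)[OF x] by (metis abs_ge_zero power2_abs power_mono)
    moreover have "2 * (G x * \<theta> x) \<le> (G x)\<^sup>2 + \<theta> x * \<theta> x"
      using zero_le_power2[of "G x - \<theta> x"] by (simp add: power2_eq_square algebra_simps)
    moreover have "0 \<le> \<theta> x * \<theta> x" "0 \<le> F\<^sup>2" by auto
    ultimately show "G x * \<theta> x \<le> \<theta> x * \<theta> x + F\<^sup>2" by linarith
  qed (use pt G(1) in auto)
  also have "\<dots> = integral {a..b} (\<lambda>x. \<theta> x * \<theta> x) + (b - a) * F\<^sup>2"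
    using pt ab by (subst Henstock_Kurzweil_Integration.integral_add) (auto intro!: int)
  finally have Gb: "integral {a..b} (\<lambda>x. G x * \<theta> x) \<le> integral {a..b} (\<lambda>x. \<theta> x * \<theta> x) + (b - a) * F\<^sup>2" .
  \<comment> \<open>Sum of the first equation tested with \<open>\<xi> n\<close> and the second
    tested with \<open>\<theta>\<close>: the terms with derivatives and both flux sums cancel by
    \<open>integration_by_parts_dg\<close>.\<close>
  have "(\<rho> + \<beta>) * ?X n \<le> \<beta> * ((K + ?X n) / 2) + \<rho> / 2 * ?X n + ((b - a) * (E\<^sup>2 / (2 * \<rho>)) + (b - a) * F\<^sup>2)"
    using eq1[OF xi[of n]] eq2[OF th] integration_by_parts_dg[OF m xi[of n] th, of \<delta>] Zb Gb
      mult_left_mono[OF hist beta] by (simp add: power2_eq_square)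
  also have "(b - a) * (E\<^sup>2 / (2 * \<rho>)) + (b - a) * F\<^sup>2 \<le> \<rho> / 2 * K"
    using K rho by (simp add: field_simps)
  \<comment> \<open>The same positive factor stands on both sides, so no negative power of the time
    step enters the bound.\<close>
  finally have "(\<rho> / 2 + \<beta> / 2) * ?X n \<le> (\<rho> / 2 + \<beta> / 2) * K"
    by (simp add: field_simps)
  moreover have "0 < \<rho> / 2 + \<beta> / 2" using rho beta by simp
  ultimately show ?thesis by (rule mult_left_le_imp_le)
qed


section \<open>Convergence\<close>

lemma Ck_bounded_on_SucE:
  assumes "Ck_bounded_on (Suc m) X J g"
  obtains gx gt where "\<And>x t. x \<in> X \<Longrightarrow> t \<in> J \<Longrightarrow> ((\<lambda>y. g y t) has_real_derivative gx x t) (at x within X)"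
    "\<And>x t. x \<in> X \<Longrightarrow> t \<in> J \<Longrightarrow> (g x has_real_derivative gt x t) (at t within J)"
    "Ck_bounded_on m X J gx" "Ck_bounded_on m X J gt"
  using assms unfolding Ck_bounded_on_def by auto

lemma Ck_bounded_on_continuous:
  assumes "Ck_bounded_on m X J g" "t \<in> J"
  shows "continuous_on X (\<lambda>x. g x t)"
proof -
  have "continuous_on (X \<times> J) (\<lambda>(x, t). g x t)"
    using assms(1) by (cases m) (auto simp: Ck_bounded_on_def)
  then have "continuous_on X (\<lambda>x. (\<lambda>(x, t). g x t) (x, t))"
    by (rule continuous_on_compose2) (use assms(2) in \<open>auto intro!: continuous_intros\<close>)
  then show ?thesis by simp
qed

lemma Ck_bounded_on_bounded:
  assumes "Ck_bounded_on m X J g"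
  shows "\<exists>B. \<forall>x\<in>X. \<forall>t\<in>J. \<bar>g x t\<bar> \<le> B"
proof -
  have "bounded ((\<lambda>(x, t). g x t) ` (X \<times> J))"
    using assms by (cases m) (auto simp: Ck_bounded_on_def)
  then show ?thesis unfolding bounded_iff by fastforce
qed

text \<open>The derivatives in \<open>Ck_bounded_on\<close> are existential witnesses; following the
  x-branch yields one coherent family \<open>D\<close>. The reserve \<open>m\<close> leaves
  regularity for time derivatives of its members.\<close>

lemma Ck_bounded_on_x_derivatives:
  "Ck_bounded_on (n + m) UNIV J u \<Longrightarrow> \<exists>D. D 0 = u \<and>
    (\<forall>i<n. \<forall>x. \<forall>t\<in>J. ((\<lambda>y. D i y t) has_real_derivative D (Suc i) x t) (at x)) \<and>
    (\<forall>i\<le>n. Ck_bounded_on (n + m - i) UNIV J (D i))"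
proof (induction n arbitrary: u)
  case 0
  then show ?case by (intro exI[of _ "\<lambda>_. u"]) auto
next
  case (Suc n)
  have ck: "Ck_bounded_on (Suc (n + m)) UNIV J u" using Suc.prems by simp
  obtain gx gt where
    "\<And>x t. x \<in> UNIV \<Longrightarrow> t \<in> J \<Longrightarrow> ((\<lambda>y. u y t) has_real_derivative gx x t) (at x)"
    "\<And>x t. x \<in> UNIV \<Longrightarrow> t \<in> J \<Longrightarrow> (u x has_real_derivative gt x t) (at t within J)"
    and gx2: "Ck_bounded_on (n + m) UNIV J gx" "Ck_bounded_on (n + m) UNIV J gt"
    by (rule Ck_bounded_on_SucE[OF ck], rule that)
  then have gx: "\<And>x t. t \<in> J \<Longrightarrow> ((\<lambda>y. u y t) has_real_derivative gx x t) (at x)" by simp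
  obtain D where D: "D 0 = gx"
    "\<forall>i<n. \<forall>x. \<forall>t\<in>J. ((\<lambda>y. D i y t) has_real_derivative D (Suc i) x t) (at x)"
    "\<forall>i\<le>n. Ck_bounded_on (n + m - i) UNIV J (D i)"
    using Suc.IH[OF gx2(1)] by blast
  define D' where "D' = (\<lambda>i. case i of 0 \<Rightarrow> u | Suc j \<Rightarrow> D j)"
  have D'[simp]: "D' 0 = u" "D' (Suc j) = D j" for j by (auto simp: D'_def)
  show ?case
  proof (intro exI[of _ D'] conjI allI impI ballI)
    fix i x t assume i: "i < Suc n" and t: "t \<in> J"
    show "((\<lambda>y. D' i y t) has_real_derivative D' (Suc i) x t) (at x)"
      using i t D gx by (cases i) auto
  next
    fix i assume "i \<le> Suc n"
    then show "Ck_bounded_on (Suc n + m - i) UNIV J (D' i)"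
      using D(3) Suc.prems by (cases i) auto
  qed simp
qed

lemma Ck_bounded_on_lipschitz_t:
  assumes "Ck_bounded_on (Suc m) X {0..T} g"
  shows "\<exists>B. \<forall>x\<in>X. \<forall>t\<in>{0..T}. \<forall>s\<in>{0..T}. \<bar>g x t - g x s\<bar> \<le> B * \<bar>t - s\<bar>"
proof -
  obtain gt where gt: "\<And>x t. x \<in> X \<Longrightarrow> t \<in> {0..T} \<Longrightarrow> (g x has_real_derivative gt x t) (at t within {0..T})"
    "Ck_bounded_on m X {0..T} gt"
    by (rule Ck_bounded_on_SucE[OF assms], rule that)
  obtain B where B: "\<forall>x\<in>X. \<forall>t\<in>{0..T}. \<bar>gt x t\<bar> \<le> B" using Ck_bounded_on_bounded[OF gt(2)] by blast
  have "\<bar>g x t - g x s\<bar> \<le> B * \<bar>t - s\<bar>" if "x \<in> X" "t \<in> {0..T}" "s \<in> {0..T}" for x t s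
    using field_differentiable_bound[of "{0..T}" "g x" "gt x" B t s] gt(1)[OF that(1)] B that
    by (auto simp: convex_real_interval)
  then show ?thesis by blast
qed

text \<open>\<open>D i\<close> is the \<open>i\<close>-th derivative of \<open>u\<close> in \<open>x\<close>; \<open>C1\<close> and \<open>C2\<close>
  are the constants of the two projections with weights \<open>\<delta>\<close> and \<open>1 - \<delta>\<close>.\<close>

locale ldg_problem =
  fixes a b T \<alpha> \<rho> \<gamma> \<delta> B C1 C2 :: real and k :: nat
    and f u :: "real \<Rightarrow> real \<Rightarrow> real" and u0 :: "real \<Rightarrow> real"
    and D :: "nat \<Rightarrow> real \<Rightarrow> real \<Rightarrow> real" and ut utt :: "real \<Rightarrow> real \<Rightarrow> real"
  assumes ab: "a < b" and T: "T > 0" and al: "0 < \<alpha>" "\<alpha> < 1" and rho: "\<rho> > 0" and ga: "\<gamma> \<ge> 0"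
    and delta: "\<delta> \<noteq> 1/2" and C12: "C1 \<ge> 0" "C2 \<ge> 0" and B0: "B \<ge> 0"
    and f: "\<And>t. t \<in> {0<..T} \<Longrightarrow> continuous_on {a<..<b} (\<lambda>x. f x t)"
    and ex: "exact_solution a b T \<alpha> \<rho> \<gamma> f u0 u"
    and D0: "D 0 = u"
    and D: "\<And>i x t. i \<le> Suc k \<Longrightarrow> t \<in> {0..T} \<Longrightarrow> ((\<lambda>y. D i y t) has_real_derivative D (Suc i) x t) (at x)"
    and Dc: "\<And>i t. i \<le> Suc (Suc k) \<Longrightarrow> t \<in> {0..T} \<Longrightarrow> continuous_on UNIV (\<lambda>x. D i x t)"
    and DB: "\<And>i x t. i \<le> Suc (Suc k) \<Longrightarrow> t \<in> {0..T} \<Longrightarrow> \<bar>D i x t\<bar> \<le> B"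
    and Dt: "\<And>x t s. t \<in> {0..T} \<Longrightarrow> s \<in> {0..T} \<Longrightarrow> \<bar>D (Suc k) x t - D (Suc k) x s\<bar> \<le> B * \<bar>t - s\<bar>"
    and ut: "\<And>x t. t \<in> {0..T} \<Longrightarrow> (u x has_real_derivative ut x t) (at t within {0..T})"
      "\<And>x t. t \<in> {0..T} \<Longrightarrow> (ut x has_real_derivative utt x t) (at t within {0..T})"
    and utB: "\<And>x t. t \<in> {0..T} \<Longrightarrow> \<bar>ut x t\<bar> \<le> B" "\<And>x t. t \<in> {0..T} \<Longrightarrow> \<bar>utt x t\<bar> \<le> B"
    and C1: "\<forall>a b N xs D B v. mesh a b N xs \<longrightarrow>
     (\<forall>i x. i \<le> k \<longrightarrow> (D i has_real_derivative D (Suc i) x) (at x)) \<longrightarrow> (\<forall>x. \<bar>D (Suc k) x\<bar> \<le> B) \<longrightarrow>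
     gauss_radau \<delta> k N xs (D 0) v \<longrightarrow>
     (\<forall>x\<in>cells N xs. \<bar>v x - D 0 x\<bar> \<le> C1 * (B * mesh_size N xs ^ Suc k))"
    and C2: "\<forall>a b N xs D B v. mesh a b N xs \<longrightarrow>
     (\<forall>i x. i \<le> k \<longrightarrow> (D i has_real_derivative D (Suc i) x) (at x)) \<longrightarrow> (\<forall>x. \<bar>D (Suc k) x\<bar> \<le> B) \<longrightarrow>
     gauss_radau (1 - \<delta>) k N xs (D 0) v \<longrightarrow>
     (\<forall>x\<in>cells N xs. \<bar>v x - D 0 x\<bar> \<le> C2 * (B * mesh_size N xs ^ Suc k))"
begin

definition trunc_const :: real where
  "trunc_const = exp (\<gamma> * T) * (\<gamma> + 1)\<^sup>2 * B * (1 + 1 / (1 - \<alpha>)) / Gamma (1 - \<alpha>)"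

text \<open>The first summand comes from the reaction term applied to the projection error, the
  second from the L1 operator; \<open>(1 + \<gamma>) * B\<close> is the rate per time step of a
  tempered increment.\<close>

definition space_const :: real where
  "space_const = \<rho> * (C1 * B) + T powr (1 - \<alpha>) / Gamma (2 - \<alpha>) * (C1 * ((1 + \<gamma>) * B))"

definition resid_const :: real where
  "resid_const = trunc_const + space_const"

text \<open>The threshold for \<open>K\<close> in \<open>dg_energy_bound\<close>, with the common
  factor \<open>\<sigma>\<^sup>2\<close> of all squared residuals taken out.\<close>

definition energy_const :: real where
  "energy_const = 2 * (b - a) * (resid_const\<^sup>2 / (2 * \<rho>) + (C2 * B)\<^sup>2) / \<rho>"

text \<open>The factors 2 come from bounding the square of a difference by twice the sum of the
  squares, when the discrete error and the projection error are combined.\<close>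

definition error_const :: real where
  "error_const = 2 * energy_const + 2 * (b - a) * (C1 * B)\<^sup>2"

lemma trunc_const_nonneg: "trunc_const \<ge> 0"
  unfolding trunc_const_def using al B0
  by (intro divide_nonneg_nonneg mult_nonneg_nonneg Gamma_real_nonneg) auto

lemma space_const_nonneg: "space_const \<ge> 0"
  unfolding space_const_def using al B0 C12 rho ga
  by (intro add_nonneg_nonneg divide_nonneg_nonneg mult_nonneg_nonneg Gamma_real_nonneg) auto

lemma u_periodic: "t \<in> {0..T} \<Longrightarrow> u (x + (b - a)) t = u x t"
  using ex by (simp add: exact_solution_def)

text \<open>Needed for u_x to have a single value at the identified interfaces 0 and
  \<open>N\<close>, so that the flux of its projection is exact there too.\<close>

lemma D1_periodic:
  assumes t: "t \<in> {0..T}" shows "D 1 b t = D 1 a t"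
proof -
  have d: "((\<lambda>y. u y t) has_real_derivative D 1 x t) (at x)" for x
    using D[OF _ t, of 0 x] by (simp add: D0)
  have "((\<lambda>y. u (y + (b - a)) t) has_real_derivative D 1 b t) (at a)"
    using DERIV_shift[of "\<lambda>y. u y t" "D 1 b t" a "b - a"] d[of b] by simp
  then have "((\<lambda>y. u y t) has_real_derivative D 1 b t) (at a)" by (simp only: u_periodic[OF t])
  then show ?thesis using d by (rule DERIV_unique)
qed

lemma deriv2_u:
  assumes t: "t \<in> {0..T}" shows "(deriv ^^ 2) (\<lambda>y. u y t) x = D 2 x t"
proof -
  have "deriv (\<lambda>y. u y t) = (\<lambda>y. D 1 y t)"
    using D[OF _ t, of 0] by (auto simp: D0 intro!: DERIV_imp_deriv)
  moreover have "deriv (\<lambda>y. D 1 y t) x = D 2 x t"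
    using D[OF _ t, of 1] by (auto simp: numeral_2_eq_2 intro!: DERIV_imp_deriv)
  ultimately show ?thesis by (simp add: numeral_2_eq_2)
qed

lemma ldg_error:
  assumes m: "mesh a b N xs" and M: "M \<ge> 1"
    and sch: "ldg_scheme a b T \<alpha> \<rho> \<gamma> \<delta> k f u0 M N xs uh ph" and n0: "n0 \<in> {1..M}"
  shows "L2_norm_on a b (\<lambda>x. u x (real n0 * (T / real M)) - uh n0 x)
    \<le> sqrt error_const * (mesh_size N xs ^ (k + 1) + (T / real M) powr (2 - \<alpha>))"
proof -
  define \<tau> where "\<tau> = T / real M"
  define t where "t = (\<lambda>m. real m * \<tau>)"
  define \<beta> where "\<beta> = \<tau> powr (- \<alpha>) / Gamma (2 - \<alpha>)"
  define H where "H = mesh_size N xs ^ Suc k"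
  define \<sigma> where "\<sigma> = H + \<tau> powr (2 - \<alpha>)"
  have tau: "\<tau> > 0" using T M by (simp add: \<tau>_def)
  have H0: "H \<ge> 0" using mesh_size_pos[OF m] by (simp add: H_def)
  have s0: "\<sigma> \<ge> H" "\<sigma> \<ge> \<tau> powr (2 - \<alpha>)" "\<sigma> \<ge> 0" using H0 by (auto simp: \<sigma>_def)
  have G2: "Gamma (2 - \<alpha>) > 0" using al by (intro Gamma_real_pos) auto
  have beta: "\<beta> \<ge> 0" using G2 by (simp add: \<beta>_def)
  have tT: "t i \<in> {0..T}" if "i \<le> M" for i
  proof -
    have "real i * \<tau> \<le> real M * \<tau>" using that tau by simp
    also have "\<dots> = T" using M by (simp add: \<tau>_def)
    finally show ?thesis using tau by (simp add: t_def)
  qed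
  have t0: "t i \<in> {0<..T}" if "i \<in> {1..M}" for i using tT[of i] that tau by (simp add: t_def)
  let ?V = "dg_space k N xs"
  have sch0: "gauss_radau \<delta> k N xs u0 (uh 0)"
    using sch by (simp add: ldg_scheme_def Let_def)
  have schV: "uh i \<in> ?V" "ph i \<in> ?V" if "i \<in> {1..M}" for i
    using sch that by (auto simp: ldg_scheme_def Let_def)
  have uhV: "uh i \<in> ?V" if "i \<le> M" for i
    using schV[of i] sch0 that by (cases "i = 0") (auto simp: gauss_radau_def)
  have sch1: "(\<rho> + \<beta>) * integral {a..b} (\<lambda>x. uh i x * v x) + integral {a..b} (\<lambda>x. ph i x * deriv v x)
      - flux_sum N xs (weighted_avg (1 - \<delta>) N xs (ph i)) v
      = \<beta> * l1_history \<alpha> \<gamma> \<tau> i (\<lambda>m. integral {a..b} (\<lambda>x. uh m x * v x)) + integral {a..b} (\<lambda>x. f x (t i) * v x)"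
    if "i \<in> {1..M}" "v \<in> ?V" for i v
    using sch that unfolding ldg_scheme_def Let_def l1_history_def \<beta>_def t_def \<tau>_def by blast
  have sch2: "integral {a..b} (\<lambda>x. ph i x * w x) + integral {a..b} (\<lambda>x. uh i x * deriv w x)
      - flux_sum N xs (weighted_avg \<delta> N xs (uh i)) w = 0"
    if "i \<in> {1..M}" "w \<in> ?V" for i w
    using sch that unfolding ldg_scheme_def Let_def by blast

  have cu: "continuous_on UNIV (\<lambda>x. D i x (t j))" if "i \<le> Suc (Suc k)" "j \<le> M" for i j
    using Dc[OF that(1) tT[OF that(2)]] .
  have pD: "pwc N xs (\<lambda>x. D i x (t j))" if "i \<le> Suc (Suc k)" "j \<le> M" for i j
    using cu[OF that] by (intro pwc_continuous_on[OF m]) (auto intro: continuous_on_subset)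
  \<comment> \<open>Projections are determined only up to values at the interfaces and outside the
    interval; requiring \<open>uh 0\<close> at level 0 makes the initial discrete error vanish
    identically.\<close>
  have "\<forall>i. \<exists>v. i \<le> M \<longrightarrow> gauss_radau \<delta> k N xs (\<lambda>x. D 0 x (t i)) v \<and> (i = 0 \<longrightarrow> v = uh 0)"
  proof
    fix i
    show "\<exists>v. i \<le> M \<longrightarrow> gauss_radau \<delta> k N xs (\<lambda>x. D 0 x (t i)) v \<and> (i = 0 \<longrightarrow> v = uh 0)"
    proof (cases "i = 0")
      case True
      have "(\<lambda>x. D 0 x (t i)) = u0" using ex True by (auto simp: exact_solution_def D0 t_def)
      then show ?thesis using sch0 by auto
    next
      case False
      then show ?thesis using gauss_radau_exists[OF m delta cu[of 0 i]] by auto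
    qed
  qed
  from choice[OF this] obtain U where U: "\<And>i. i \<le> M \<Longrightarrow> gauss_radau \<delta> k N xs (\<lambda>x. D 0 x (t i)) (U i)"
    and U0: "U 0 = uh 0" by auto
  have UV: "U i \<in> ?V" if "i \<le> M" for i using U[OF that] by (simp add: gauss_radau_def)
  have eta: "\<bar>U i x - D 0 x (t i)\<bar> \<le> C1 * (B * H)" if i: "i \<le> M" and x: "x \<in> cells N xs" for i x
    using C1[THEN spec[of _ a], THEN spec[of _ b], THEN spec[of _ N], THEN spec[of _ xs],
        THEN spec[of _ "\<lambda>j x. D j x (t i)"], THEN spec[of _ B], THEN spec[of _ "U i"]]
      m D[OF _ tT[OF i]] DB[OF _ tT[OF i]] U[OF i] x by (simp add: H_def)
  define \<xi> where "\<xi> = (\<lambda>m x. U m x - uh m x)"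
  have xiV: "\<xi> i \<in> ?V" if "i \<le> M" for i
    unfolding \<xi>_def using UV[OF that] uhV[OF that] by (rule dg_space_diff)
  \<comment> \<open>One bound for all time levels, so constants do not accumulate in the
    induction.\<close>
  define K where "K = energy_const * \<sigma>\<^sup>2"
  have K0: "K \<ge> 0" unfolding K_def energy_const_def using ab rho by auto
  have energy: "integral {a..b} (\<lambda>x. (\<xi> n x)\<^sup>2) \<le> K"
    if n: "n \<in> {1..M}" and prev: "\<And>m. m < n \<Longrightarrow> integral {a..b} (\<lambda>x. (\<xi> m x)\<^sup>2) \<le> K" for n
  proof -
    have nM: "n \<le> M" "1 \<le> n" using n by auto
    have delta': "1 - \<delta> \<noteq> 1/2" using delta by auto
    obtain P where P: "gauss_radau (1 - \<delta>) k N xs (\<lambda>x. D 1 x (t n)) P"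
      using gauss_radau_exists[OF m delta' cu[of 1 n]] nM by auto
    have PV: "P \<in> ?V" using P by (simp add: gauss_radau_def)

    have etaP: "\<bar>P x - D 1 x (t n)\<bar> \<le> C2 * (B * H)" if x: "x \<in> cells N xs" for x
      using C2[THEN spec[of _ a], THEN spec[of _ b], THEN spec[of _ N], THEN spec[of _ xs],
          THEN spec[of _ "\<lambda>j x. D (Suc j) x (t n)"], THEN spec[of _ B], THEN spec[of _ P]]
        m D[OF _ tT[OF nM(1)]] DB[OF _ tT[OF nM(1)]] P x by (simp add: H_def)
    \<comment> \<open>By linearity this is the projection error of \<open>?D 0\<close>. Its
      derivative of order k+1 is of order \<tau>, by Lipschitz continuity in time and because
      \<open>1 - exp (- \<gamma> * \<tau>)\<close> is at most \<open>\<gamma> * \<tau>\<close>. This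
      gains the factor that makes the L1 operator harmless.\<close>
    have eta_diff: "\<bar>(D 0 x (t (Suc i)) - U (Suc i) x) - exp (- \<gamma> * \<tau>) * (D 0 x (t i) - U i x)\<bar>
        \<le> \<tau> * (C1 * ((1 + \<gamma>) * B) * H)" if i: "i < n" and x: "x \<in> cells N xs" for i x
    proof -
      define e where "e = exp (- \<gamma> * \<tau>)"
      have e: "0 \<le> e" "e \<le> 1" "1 - e \<le> \<gamma> * \<tau>"
        using exp_ge_add_one_self[of "- \<gamma> * \<tau>"] ga tau by (auto simp: e_def)
      have iM: "Suc i \<le> M" "i \<le> M" using i nM by auto
      let ?D = "\<lambda>j x. D j x (t (Suc i)) - e * D j x (t i)"
      have gr: "gauss_radau \<delta> k N xs (?D 0) (\<lambda>x. U (Suc i) x - e * U i x)"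
        by (rule gauss_radau_lincomb[OF m cu cu U U]) (use iM in auto)
      have dd: "\<forall>j x. j \<le> k \<longrightarrow> (?D j has_real_derivative ?D (Suc j) x) (at x)"
        by (intro allI impI DERIV_diff DERIV_cmult D tT iM) auto
      have bb: "\<bar>?D (Suc k) x\<bar> \<le> \<tau> * ((1 + \<gamma>) * B)" for x
      proof -
        have "?D (Suc k) x = (D (Suc k) x (t (Suc i)) - D (Suc k) x (t i)) + (1 - e) * D (Suc k) x (t i)"
          by (simp add: algebra_simps)
        also have "\<bar>\<dots>\<bar> \<le> \<bar>D (Suc k) x (t (Suc i)) - D (Suc k) x (t i)\<bar> + \<bar>1 - e\<bar> * \<bar>D (Suc k) x (t i)\<bar>"
          unfolding abs_mult[symmetric] by (rule abs_triangle_ineq)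
        also have "\<dots> \<le> B * \<tau> + (\<gamma> * \<tau>) * B"
        proof (intro add_mono mult_mono)
          have "\<bar>t (Suc i) - t i\<bar> = \<tau>" using tau by (simp add: t_def algebra_simps)
          then show "\<bar>D (Suc k) x (t (Suc i)) - D (Suc k) x (t i)\<bar> \<le> B * \<tau>"
            using Dt[OF tT[OF iM(1)] tT[OF iM(2)], of x] by simp
          show "\<bar>D (Suc k) x (t i)\<bar> \<le> B" using DB[OF _ tT[OF iM(2)]] by simp
        qed (use e ga tau in auto)
        finally show ?thesis by (simp add: algebra_simps)
      qed
      have "\<bar>(U (Suc i) x - e * U i x) - ?D 0 x\<bar> \<le> C1 * (\<tau> * ((1 + \<gamma>) * B) * H)"
        using C1[THEN spec[of _ a], THEN spec[of _ b], THEN spec[of _ N], THEN spec[of _ xs],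
          THEN spec[of _ ?D], THEN spec[of _ "\<tau> * ((1 + \<gamma>) * B)"], THEN spec[of _ "\<lambda>x. U (Suc i) x - e * U i x"],
          THEN mp, OF m, THEN mp, OF dd, THEN mp, OF allI[OF bb], THEN mp, OF gr] x by (simp add: H_def)
      moreover have "(U (Suc i) x - e * U i x) - ?D 0 x = - ((D 0 x (t (Suc i)) - U (Suc i) x) - e * (D 0 x (t i) - U i x))"
        by (simp add: algebra_simps)
      ultimately show ?thesis unfolding e_def[symmetric] by (simp only: abs_minus_cancel) (simp add: mult_ac)
    qed

    \<comment> \<open>Right-hand side minus left-hand side of the first scheme equation at the
      projections; the discrete derivative of \<open>P\<close> appears as u_xx by exactness.\<close>
    define Z where "Z = (\<lambda>x. f x (t n) + D 2 x (t n) - (\<rho> + \<beta>) * U n x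
       + \<beta> * l1_history \<alpha> \<gamma> \<tau> n (\<lambda>m. U m x))"
    have Zb: "\<bar>Z x\<bar> \<le> resid_const * \<sigma>" if x: "x \<in> cells N xs" for x
    proof -
      have xab: "x \<in> {a<..<b}" using cells_subset[OF m] x by auto
      have pde: "tempered_caputo \<alpha> \<gamma> (u x) (t n) + \<rho> * u x (t n) - D 2 x (t n) = f x (t n)"
        using ex xab t0[OF n] unfolding exact_solution_def deriv2_u[OF tT[OF nM(1)], symmetric] by blast
      let ?u = "\<lambda>m. D 0 x (t m)" and ?e = "\<lambda>m. D 0 x (t m) - U m x"
      let ?L = "\<lambda>X. \<beta> * (X n - l1_history \<alpha> \<gamma> \<tau> n X)"
      \<comment> \<open>The differential equation eliminates \<open>f\<close>. Adding and
        subtracting the L1 operator at u separates the truncation error in time from the projection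
        error in space.\<close>
      have "Z x = (tempered_caputo \<alpha> \<gamma> (u x) (t n) - ?L ?u) + (\<rho> * ?e n + ?L ?e)"
        unfolding Z_def pde[symmetric] l1_history_diff D0 by (simp add: algebra_simps)
      moreover have "\<bar>tempered_caputo \<alpha> \<gamma> (u x) (t n) - ?L ?u\<bar> \<le> trunc_const * \<tau> powr (2 - \<alpha>)"
        unfolding trunc_const_def \<beta>_def D0 t_def
        by (rule tempered_caputo_l1_truncation[OF al ga tau nM(2) _ ut(1) ut(2) _ utB(1) utB(2)])
           (use tT[OF nM(1)] DB[of 0] in \<open>auto simp: t_def D0\<close>)
      moreover have "\<bar>?L ?e\<bar> \<le> T powr (1 - \<alpha>) / Gamma (2 - \<alpha>) * (C1 * ((1 + \<gamma>) * B) * H)"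
        unfolding \<beta>_def
        by (rule l1_operator_bound[where X = ?e and A = "C1 * ((1 + \<gamma>) * B) * H", OF al tau nM(2) _ _ eta_diff ga])
           (use tT[OF nM(1)] C12 ga B0 H0 x in \<open>auto simp: t_def\<close>)
      moreover have "\<bar>\<rho> * ?e n\<bar> \<le> \<rho> * (C1 * (B * H))"
        unfolding abs_mult using eta[OF nM(1) x] rho by (intro mult_mono) (auto simp: abs_minus_commute)
      ultimately have "\<bar>Z x\<bar> \<le> trunc_const * \<tau> powr (2 - \<alpha>) + (\<rho> * (C1 * (B * H)) + T powr (1 - \<alpha>) / Gamma (2 - \<alpha>) * (C1 * ((1 + \<gamma>) * B) * H))"
        by linarith
      also have "\<dots> = trunc_const * \<tau> powr (2 - \<alpha>) + space_const * H"
        by (simp add: space_const_def algebra_simps add_divide_distrib)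
      also have "\<dots> \<le> trunc_const * \<sigma> + space_const * \<sigma>"
        using s0 trunc_const_nonneg space_const_nonneg by (intro add_mono mult_left_mono) auto
      finally show ?thesis by (simp add: resid_const_def algebra_simps)
    qed
    have pU: "pwc N xs (U i)" if "i \<le> n" for i using UV that nM by (intro pwc_dg(1)[of _ k]) auto
    have ph: "pwc N xs (\<lambda>x. l1_history \<alpha> \<gamma> \<tau> n (\<lambda>m. U m x))" by (rule pwc_l1_history[OF pU])
    have pD2: "pwc N xs (\<lambda>x. D 2 x (t n))" using pD[of 2 n] nM by simp
    \<comment> \<open>Continuity of \<open>f\<close> is available on the open interval, but no
      bound; boundedness of \<open>Z\<close> is read off from its estimate
      \<open>Zb\<close>.\<close>
    have pZ: "pwc N xs Z"
      unfolding pwc_def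
    proof
      have "continuous_on (cells N xs) (\<lambda>x. f x (t n))"
        using cells_subset[OF m] by (rule continuous_on_subset[OF f[OF t0[OF n]]])
      then show "continuous_on (cells N xs) Z"
        unfolding Z_def using ph pD2 pU[of n] by (auto simp: pwc_def intro!: continuous_intros)
      show "bounded (Z ` cells N xs)" using Zb by (auto simp: bounded_iff)
    qed

    define \<theta> where "\<theta> = (\<lambda>x. P x - ph n x)"
    have thV: "\<theta> \<in> ?V" unfolding \<theta>_def using PV schV(2)[OF n] by (rule dg_space_diff)
    have puh: "pwc N xs (uh i)" if "i \<le> n" for i using uhV that nM by (intro pwc_dg(1)[of _ k]) auto
    note pP = pwc_dg[OF PV] and pph = pwc_dg[OF schV(2)[OF n]]

    have eq1: "(\<rho> + \<beta>) * integral {a..b} (\<lambda>x. \<xi> n x * v x)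
        - \<beta> * l1_history \<alpha> \<gamma> \<tau> n (\<lambda>m. integral {a..b} (\<lambda>x. \<xi> m x * v x))
        + integral {a..b} (\<lambda>x. \<theta> x * deriv v x) - flux_sum N xs (weighted_avg (1 - \<delta>) N xs \<theta>) v
        + integral {a..b} (\<lambda>x. Z x * v x) = 0" if v: "v \<in> ?V" for v
    proof -
      note pv = pwc_dg[OF v]
      have int: "pwc N xs h \<Longrightarrow> h integrable_on {a..b}" for h by (rule pwc_integrable[OF m])
      \<comment> \<open>The definition of \<open>Z\<close> is solved for \<open>f\<close>, which
        expresses the source integral of the scheme through functions already known to be
        integrable.\<close>
      have "integral {a..b} (\<lambda>x. f x (t n) * v x) = integral {a..b} (\<lambda>x. (Z x * v x + (\<rho> + \<beta>) * (U n x * v x))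
         - (D 2 x (t n) * v x + \<beta> * (l1_history \<alpha> \<gamma> \<tau> n (\<lambda>m. U m x) * v x)))"
        by (intro Henstock_Kurzweil_Integration.integral_cong) (simp add: Z_def algebra_simps)
      also have "\<dots> = integral {a..b} (\<lambda>x. Z x * v x + (\<rho> + \<beta>) * (U n x * v x))
         - integral {a..b} (\<lambda>x. D 2 x (t n) * v x + \<beta> * (l1_history \<alpha> \<gamma> \<tau> n (\<lambda>m. U m x) * v x))"
        by (intro Henstock_Kurzweil_Integration.integral_diff int pwc_add pwc_mult pwc_const pZ pD2 ph pv pU) auto
      also have "integral {a..b} (\<lambda>x. Z x * v x + (\<rho> + \<beta>) * (U n x * v x))
         = integral {a..b} (\<lambda>x. Z x * v x) + integral {a..b} (\<lambda>x. (\<rho> + \<beta>) * (U n x * v x))"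
        by (intro Henstock_Kurzweil_Integration.integral_add int pwc_mult pwc_const pZ pv pU) auto
      also have "integral {a..b} (\<lambda>x. D 2 x (t n) * v x + \<beta> * (l1_history \<alpha> \<gamma> \<tau> n (\<lambda>m. U m x) * v x))
         = integral {a..b} (\<lambda>x. D 2 x (t n) * v x) + integral {a..b} (\<lambda>x. \<beta> * (l1_history \<alpha> \<gamma> \<tau> n (\<lambda>m. U m x) * v x))"
        by (intro Henstock_Kurzweil_Integration.integral_add int pwc_mult pwc_const pD2 ph pv)
      finally have fv: "integral {a..b} (\<lambda>x. f x (t n) * v x) = integral {a..b} (\<lambda>x. Z x * v x)
         + (\<rho> + \<beta>) * integral {a..b} (\<lambda>x. U n x * v x) - integral {a..b} (\<lambda>x. D 2 x (t n) * v x)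
         - \<beta> * l1_history \<alpha> \<gamma> \<tau> n (\<lambda>m. integral {a..b} (\<lambda>x. U m x * v x))"
        using integral_l1_history[OF m pU pv(1), of n] by simp
      have Pv: "integral {a..b} (\<lambda>x. P x * deriv v x) - flux_sum N xs (weighted_avg (1 - \<delta>) N xs P) v
        = - integral {a..b} (\<lambda>x. D 2 x (t n) * v x)"
        by (rule gauss_radau_weak_derivative[OF m _ _ D1_periodic[OF tT[OF nM(1)]] P v])
           (use D[OF _ tT[OF nM(1)], of 1] cu[of 2 n] nM in \<open>auto simp: numeral_2_eq_2\<close>)
      have d1: "integral {a..b} (\<lambda>x. \<xi> i x * v x) = integral {a..b} (\<lambda>x. U i x * v x) - integral {a..b} (\<lambda>x. uh i x * v x)"
        if "i \<le> n" for i
        unfolding \<xi>_def by (rule integral_diff_mult[OF m pU[OF that] puh[OF that] pv(1)])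
      have d2: "l1_history \<alpha> \<gamma> \<tau> n (\<lambda>m. integral {a..b} (\<lambda>x. \<xi> m x * v x))
        = l1_history \<alpha> \<gamma> \<tau> n (\<lambda>m. integral {a..b} (\<lambda>x. U m x * v x)) - l1_history \<alpha> \<gamma> \<tau> n (\<lambda>m. integral {a..b} (\<lambda>x. uh m x * v x))"
        unfolding l1_history_diff[symmetric] by (simp add: l1_history_def d1)
      have d3: "integral {a..b} (\<lambda>x. \<theta> x * deriv v x) = integral {a..b} (\<lambda>x. P x * deriv v x) - integral {a..b} (\<lambda>x. ph n x * deriv v x)"
        unfolding \<theta>_def by (rule integral_diff_mult[OF m pP(1) pph(1) pv(2)])
      have d4: "flux_sum N xs (weighted_avg (1 - \<delta>) N xs \<theta>) v
        = flux_sum N xs (weighted_avg (1 - \<delta>) N xs P) v - flux_sum N xs (weighted_avg (1 - \<delta>) N xs (ph n)) v"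
        unfolding \<theta>_def by (rule flux_sum_weighted_avg_diff[OF m PV schV(2)[OF n]])
      show ?thesis
        using sch1[OF n v] fv Pv unfolding d1[OF order_refl] d2 d3 d4 right_diff_distrib by linarith
    qed

    have eq2: "integral {a..b} (\<lambda>x. \<theta> x * w x) - integral {a..b} (\<lambda>x. (P x - D 1 x (t n)) * w x)
        + integral {a..b} (\<lambda>x. \<xi> n x * deriv w x) - flux_sum N xs (weighted_avg \<delta> N xs (\<xi> n)) w = 0"
      if w: "w \<in> ?V" for w
    proof -
      note pv = pwc_dg[OF w]
      have per: "D 0 b (t n) = D 0 a (t n)" using u_periodic[OF tT[OF nM(1)], of a] by (simp add: D0)
      have Uw: "integral {a..b} (\<lambda>x. U n x * deriv w x) - flux_sum N xs (weighted_avg \<delta> N xs (U n)) w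
        = - integral {a..b} (\<lambda>x. D 1 x (t n) * w x)"
        by (rule gauss_radau_weak_derivative[OF m _ _ per U[OF nM(1)] w])
           (use D[OF _ tT[OF nM(1)], of 0] cu[of 1 n] nM in auto)
      have d1: "integral {a..b} (\<lambda>x. \<theta> x * w x) = integral {a..b} (\<lambda>x. P x * w x) - integral {a..b} (\<lambda>x. ph n x * w x)"
        unfolding \<theta>_def by (rule integral_diff_mult[OF m pP(1) pph(1) pv(1)])
      have d2: "integral {a..b} (\<lambda>x. (P x - D 1 x (t n)) * w x) = integral {a..b} (\<lambda>x. P x * w x) - integral {a..b} (\<lambda>x. D 1 x (t n) * w x)"
        using nM by (intro integral_diff_mult[OF m pP(1) pD pv(1)]) auto
      have d3: "integral {a..b} (\<lambda>x. \<xi> n x * deriv w x) = integral {a..b} (\<lambda>x. U n x * deriv w x) - integral {a..b} (\<lambda>x. uh n x * deriv w x)"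
        unfolding \<xi>_def by (rule integral_diff_mult[OF m pU puh pv(2)]) auto
      have d4: "flux_sum N xs (weighted_avg \<delta> N xs (\<xi> n)) w
        = flux_sum N xs (weighted_avg \<delta> N xs (U n)) w - flux_sum N xs (weighted_avg \<delta> N xs (uh n)) w"
        unfolding \<xi>_def by (rule flux_sum_weighted_avg_diff[OF m UV[OF nM(1)] uhV[OF nM(1)]])
      show ?thesis using sch2[OF n w] Uw unfolding d1 d2 d3 d4 by linarith
    qed
    show ?thesis
    proof (rule dg_energy_bound[OF m nM(2) al ga _ rho beta xiV thV pZ Zb _ _ eq1 eq2 prev])
      show "pwc N xs (\<lambda>x. P x - D 1 x (t n))" using nM by (intro pwc_diff pP(1) pD) auto
      fix x assume x: "x \<in> cells N xs"
      have "C2 * (B * H) \<le> C2 * B * \<sigma>" using s0 C12 B0 by (simp add: mult.assoc mult_left_mono)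
      then show "\<bar>P x - D 1 x (t n)\<bar> \<le> C2 * B * \<sigma>" using etaP[OF x] by linarith
    next
      show "2 * (b - a) * ((resid_const * \<sigma>)\<^sup>2 / (2 * \<rho>) + (C2 * B * \<sigma>)\<^sup>2) / \<rho> \<le> K"
        unfolding K_def energy_const_def by (simp add: power_mult_distrib algebra_simps add_divide_distrib)
    qed (use tau nM in auto)
  qed
  have "integral {a..b} (\<lambda>x. (\<xi> n x)\<^sup>2) \<le> K" if "n \<le> M" for n
    using that
  proof (induction n rule: less_induct)
    case (less n)
    \<comment> \<open>At level 0 the error \<open>\<xi>\<close> is zero because \<open>U 0\<close>
      is \<open>uh 0\<close>; every later level uses all earlier ones through the history.\<close>
    then show ?case using energy[of n] K0 by (cases "n = 0") (auto simp: \<xi>_def U0)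
  qed
  then have xiK: "integral {a..b} (\<lambda>x. (\<xi> n0 x)\<^sup>2) \<le> K" using n0 by simp
  have nM: "n0 \<le> M" using n0 by simp
  note pw = pwc_dg(1)[OF xiV[OF nM]] pD[OF le0 nM] pwc_dg(1)[OF UV[OF nM]] pwc_dg(1)[OF uhV[OF nM]]
  have "integral {a..b} (\<lambda>x. (D 0 x (t n0) - uh n0 x)\<^sup>2)
    \<le> integral {a..b} (\<lambda>x. 2 * (\<xi> n0 x)\<^sup>2 + 2 * (C1 * (B * H))\<^sup>2)"
  proof (rule integral_mono_cells[OF m])
    fix x assume x: "x \<in> cells N xs"
    let ?e = "U n0 x - D 0 x (t n0)"
    have "?e\<^sup>2 \<le> (C1 * (B * H))\<^sup>2" using eta[OF nM x] by (metis abs_ge_zero power2_abs power_mono)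
    moreover have "(D 0 x (t n0) - uh n0 x)\<^sup>2 = (\<xi> n0 x - ?e)\<^sup>2" by (simp add: \<xi>_def)
    moreover have "(\<xi> n0 x - ?e)\<^sup>2 \<le> 2 * (\<xi> n0 x)\<^sup>2 + 2 * ?e\<^sup>2"
      using zero_le_power2[of "\<xi> n0 x + ?e"] by (simp add: power2_eq_square algebra_simps)
    ultimately show "(D 0 x (t n0) - uh n0 x)\<^sup>2 \<le> 2 * (\<xi> n0 x)\<^sup>2 + 2 * (C1 * (B * H))\<^sup>2" by linarith
  qed (intro pwc_add pwc_diff pwc_mult pwc_power2 pwc_const pw)+
  also have "\<dots> = 2 * integral {a..b} (\<lambda>x. (\<xi> n0 x)\<^sup>2) + (b - a) * (2 * (C1 * (B * H))\<^sup>2)"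
    using pw ab by (subst Henstock_Kurzweil_Integration.integral_add) (auto intro!: pwc_integrable[OF m])
  also have "\<dots> \<le> 2 * K + (b - a) * (2 * (C1 * (B * \<sigma>))\<^sup>2)"
    using xiK ab s0 H0 C12 B0
    by (intro add_mono mult_left_mono power_mono mult_nonneg_nonneg) auto
  also have "\<dots> = error_const * \<sigma>\<^sup>2"
    by (simp add: error_const_def K_def power_mult_distrib algebra_simps)
  finally have "sqrt (integral {a..b} (\<lambda>x. (D 0 x (t n0) - uh n0 x)\<^sup>2)) \<le> sqrt (error_const * \<sigma>\<^sup>2)"
    by simp
  also have "\<dots> = sqrt error_const * \<sigma>" using s0 by (simp add: real_sqrt_mult)
  finally show ?thesis
    by (simp add: L2_norm_on_def D0 t_def \<tau>_def \<sigma>_def H_def)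
qed

end

theorem theorem4p1:
  fixes a b T \<alpha> \<rho> \<gamma> \<delta> \<kappa> :: real and k :: nat
  assumes "a < b" and "T > 0" and "0 < \<alpha>" and "\<alpha> < 1" and "\<rho> > 0" and "\<gamma> \<ge> 0"
    and "\<delta> \<noteq> 1/2" and "\<kappa> > 0"
  shows "\<exists>m. \<forall>(u :: real \<Rightarrow> real \<Rightarrow> real) (f :: real \<Rightarrow> real \<Rightarrow> real) (u0 :: real \<Rightarrow> real).
           smooth_on {a<..<b} {0<..T} f \<longrightarrow>
           (\<forall>i. (deriv ^^ i) u0 differentiable_on UNIV) \<longrightarrow>
           exact_solution a b T \<alpha> \<rho> \<gamma> f u0 u \<longrightarrow>
           Ck_bounded_on m UNIV {0..T} u \<longrightarrow>
           (\<exists>C. \<forall>(N :: nat) (xs :: nat \<Rightarrow> real) (M :: nat)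
                 (uh :: nat \<Rightarrow> real \<Rightarrow> real) (ph :: nat \<Rightarrow> real \<Rightarrow> real).
              mesh a b N xs \<longrightarrow> quasi_uniform \<kappa> N xs \<longrightarrow> M \<ge> 1 \<longrightarrow>
              ldg_scheme a b T \<alpha> \<rho> \<gamma> \<delta> k f u0 M N xs uh ph \<longrightarrow>
              (\<forall>n\<in>{1..M}.
                 L2_norm_on a b (\<lambda>x. u x (real n * (T / real M)) - uh n x)
                   \<le> C * (mesh_size N xs ^ (k + 1) + (T / real M) powr (2 - \<alpha>))))"
proof -
  have delta': "1 - \<delta> \<noteq> 1/2" using assms(7) by auto
  obtain C1 where C1: "C1 \<ge> 0" "\<forall>a b N xs D B v. mesh a b N xs \<longrightarrow>
     (\<forall>i x. i \<le> k \<longrightarrow> (D i has_real_derivative D (Suc i) x) (at x)) \<longrightarrow> (\<forall>x. \<bar>D (Suc k) x\<bar> \<le> B) \<longrightarrow>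
     gauss_radau \<delta> k N xs (D 0) v \<longrightarrow>
     (\<forall>x\<in>cells N xs. \<bar>v x - D 0 x\<bar> \<le> C1 * (B * mesh_size N xs ^ Suc k))"
    using gauss_radau_bound[OF assms(7), of k] by (elim exE conjE)
  obtain C2 where C2: "C2 \<ge> 0" "\<forall>a b N xs D B v. mesh a b N xs \<longrightarrow>
     (\<forall>i x. i \<le> k \<longrightarrow> (D i has_real_derivative D (Suc i) x) (at x)) \<longrightarrow> (\<forall>x. \<bar>D (Suc k) x\<bar> \<le> B) \<longrightarrow>
     gauss_radau (1 - \<delta>) k N xs (D 0) v \<longrightarrow>
     (\<forall>x\<in>cells N xs. \<bar>v x - D 0 x\<bar> \<le> C2 * (B * mesh_size N xs ^ Suc k))"
    using gauss_radau_bound[OF delta', of k] by (elim exE conjE)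
  show ?thesis
  \<comment> \<open>The projection error of u_x involves the x-derivative of u of order k+2; two
    further orders leave room for derivatives in time.\<close>
  proof (rule exI[of _ "Suc (Suc k) + 2"], intro allI impI)
    fix u f :: "real \<Rightarrow> real \<Rightarrow> real" and u0 :: "real \<Rightarrow> real"
    assume fs: "smooth_on {a<..<b} {0<..T} f" and ex: "exact_solution a b T \<alpha> \<rho> \<gamma> f u0 u"
      and ck: "Ck_bounded_on (Suc (Suc k) + 2) UNIV {0..T} u"
    have f: "continuous_on {a<..<b} (\<lambda>x. f x t)" if "t \<in> {0<..T}" for t
    proof -
      have "continuous_on ({a<..<b} \<times> {0<..T}) (\<lambda>(x, t). f x t)"
        using fs unfolding smooth_on_def Ck_on_def by (metis partials_satisfy.simps(1))
      then have "continuous_on {a<..<b} (\<lambda>x. (\<lambda>(x, t). f x t) (x, t))"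
        by (rule continuous_on_compose2) (use that in \<open>auto intro!: continuous_intros\<close>)
      then show ?thesis by simp
    qed
    obtain D where D: "D 0 = u"
      "\<forall>i<Suc (Suc k). \<forall>x. \<forall>t\<in>{0..T}. ((\<lambda>y. D i y t) has_real_derivative D (Suc i) x t) (at x)"
      "\<forall>i\<le>Suc (Suc k). Ck_bounded_on (Suc (Suc k) + 2 - i) UNIV {0..T} (D i)"
      using Ck_bounded_on_x_derivatives[OF ck] by blast
    have "\<forall>i. \<exists>B. i \<le> Suc (Suc k) \<longrightarrow> (\<forall>x. \<forall>t\<in>{0..T}. \<bar>D i x t\<bar> \<le> B)"
      using D(3) Ck_bounded_on_bounded by (metis UNIV_I)
    from choice[OF this] obtain BD where BD: "\<And>i x t. i \<le> Suc (Suc k) \<Longrightarrow> t \<in> {0..T} \<Longrightarrow> \<bar>D i x t\<bar> \<le> BD i"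
      by blast
    have "Ck_bounded_on (Suc 2) UNIV {0..T} (D (Suc k))" using D(3)[rule_format, of "Suc k"] by simp
    from Ck_bounded_on_lipschitz_t[OF this] obtain BL where
      BL: "\<And>x t s. t \<in> {0..T} \<Longrightarrow> s \<in> {0..T} \<Longrightarrow> \<bar>D (Suc k) x t - D (Suc k) x s\<bar> \<le> BL * \<bar>t - s\<bar>" by blast
    have ck3: "Ck_bounded_on (Suc (k + 3)) UNIV {0..T} u" using ck by (simp add: numeral_eq_Suc)
    obtain ux ut where "\<And>x t. x \<in> UNIV \<Longrightarrow> t \<in> {0..T} \<Longrightarrow> ((\<lambda>y. u y t) has_real_derivative ux x t) (at x)"
      and ut: "\<And>x t. x \<in> UNIV \<Longrightarrow> t \<in> {0..T} \<Longrightarrow> (u x has_real_derivative ut x t) (at t within {0..T})"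
      and "Ck_bounded_on (k + 3) UNIV {0..T} ux" and ckt: "Ck_bounded_on (k + 3) UNIV {0..T} ut"
      by (rule Ck_bounded_on_SucE[OF ck3], rule that)
    have ck2: "Ck_bounded_on (Suc (k + 2)) UNIV {0..T} ut" using ckt by (simp add: numeral_eq_Suc)
    obtain utx utt where "\<And>x t. x \<in> UNIV \<Longrightarrow> t \<in> {0..T} \<Longrightarrow> ((\<lambda>y. ut y t) has_real_derivative utx x t) (at x)"
      and utt: "\<And>x t. x \<in> UNIV \<Longrightarrow> t \<in> {0..T} \<Longrightarrow> (ut x has_real_derivative utt x t) (at t within {0..T})"
      and "Ck_bounded_on (k + 2) UNIV {0..T} utx" and cktt: "Ck_bounded_on (k + 2) UNIV {0..T} utt"
      by (rule Ck_bounded_on_SucE[OF ck2], rule that)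
    obtain B1 where B1: "\<forall>x\<in>UNIV. \<forall>t\<in>{0..T}. \<bar>ut x t\<bar> \<le> B1" using Ck_bounded_on_bounded[OF ckt] by blast
    obtain B2 where B2: "\<forall>x\<in>UNIV. \<forall>t\<in>{0..T}. \<bar>utt x t\<bar> \<le> B2" using Ck_bounded_on_bounded[OF cktt] by blast
    define B where "B = (\<Sum>i\<le>Suc (Suc k). \<bar>BD i\<bar>) + \<bar>BL\<bar> + \<bar>B1\<bar> + \<bar>B2\<bar>"
    have S0: "(\<Sum>i\<le>Suc (Suc k). \<bar>BD i\<bar>) \<ge> 0" by (intro sum_nonneg) auto
    have Bge: "\<bar>BL\<bar> \<le> B" "\<bar>B1\<bar> \<le> B" "\<bar>B2\<bar> \<le> B" "0 \<le> B" using S0 by (auto simp: B_def simp del: sum.atMost_Suc)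
    have BDB: "BD i \<le> B" if "i \<le> Suc (Suc k)" for i
    proof -
      have "\<bar>BD i\<bar> \<le> (\<Sum>i\<le>Suc (Suc k). \<bar>BD i\<bar>)" by (rule member_le_sum) (use that in auto)
      then show ?thesis by (simp add: B_def del: sum.atMost_Suc)
    qed
    interpret ldg_problem a b T \<alpha> \<rho> \<gamma> \<delta> B C1 C2 k f u u0 D ut utt
    proof
      show "\<bar>D i x t\<bar> \<le> B" if "i \<le> Suc (Suc k)" "t \<in> {0..T}" for i x t
        using BD[OF that, of x] BDB[OF that(1)] by linarith
      show "\<bar>D (Suc k) x t - D (Suc k) x s\<bar> \<le> B * \<bar>t - s\<bar>" if "t \<in> {0..T}" "s \<in> {0..T}" for x t s
        using BL[OF that, of x] Bge(1) mult_right_mono[of BL B "\<bar>t - s\<bar>"] by linarith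
      show "\<bar>ut x t\<bar> \<le> B" "\<bar>utt x t\<bar> \<le> B" if "t \<in> {0..T}" for x t
        using B1[rule_format, OF UNIV_I that, of x] B2[rule_format, OF UNIV_I that, of x] Bge by linarith+
      show "continuous_on UNIV (\<lambda>x. D i x t)" if "i \<le> Suc (Suc k)" "t \<in> {0..T}" for i t
        using D(3) that by (blast intro: Ck_bounded_on_continuous)
    qed (use assms C1 C2 f ex D ut utt Bge in auto)
    \<comment> \<open>\<open>error_const\<close> is built from the data, the bound \<open>B\<close>
      on the solution and the projection constants, all fixed before the mesh, \<open>M\<close> and
      the discrete solution are introduced.\<close>
    show "\<exists>C. \<forall>(N :: nat) (xs :: nat \<Rightarrow> real) (M :: nat)
                 (uh :: nat \<Rightarrow> real \<Rightarrow> real) (ph :: nat \<Rightarrow> real \<Rightarrow> real).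
              mesh a b N xs \<longrightarrow> quasi_uniform \<kappa> N xs \<longrightarrow> M \<ge> 1 \<longrightarrow>
              ldg_scheme a b T \<alpha> \<rho> \<gamma> \<delta> k f u0 M N xs uh ph \<longrightarrow>
              (\<forall>n\<in>{1..M}.
                 L2_norm_on a b (\<lambda>x. u x (real n * (T / real M)) - uh n x)
                   \<le> C * (mesh_size N xs ^ (k + 1) + (T / real M) powr (2 - \<alpha>)))"
      by (rule exI[of _ "sqrt error_const"], intro allI impI ballI ldg_error)
  qed
qed

end
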